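(* For $\alpha,\beta,m,\gamma_1,\dots,\gamma_m\ge1$ define $$R^{(\mathrm D,1)}_{\alpha,\beta;\gamma_1,\dots,\gamma_m}:=\frac1{m!}\left.\frac{\partial^{m+2}F_{D_N}}{\partial t_\alpha\,\partial t_\beta\,\partial t_{N-\gamma_1}\cdots\partial t_{N-\gamma_m}}\right|_{t=0},\qquad R^{(\mathrm D,2)}_{\alpha;\gamma_1,\dots,\gamma_m}:=\frac1{m!}\left.\frac{\partial^{m+1}v_1^{(N)}}{\partial t_\alpha\,\partial t_{N-\gamma_1}\cdots\partial t_{N-\gamma_m}}\right|_{t=0},$$ where $1\le\gamma_i\le N-1$ and $N\ge4$ is any integer with $N>\alpha+\beta$ (respectively $N>\alpha$); these numbers do not depend on the choice of such $N$, and they vanish unless $\gamma_1+\dots+\gamma_m=\alpha+\beta-1$ (respectively $\gamma_1+\dots+\gamma_m=\alpha-1$). Consider the system of PDEs on $f=f(t_0,t_1,t_2,\dots)$, for all $\alpha,\beta\ge2$, $$\partial_\alpha\partial_\beta f=\sum_{m\ge1}\sum_{\gamma_1,\dots,\gamma_m\ge1}R^{(\mathrm D,1)}_{\alpha,\beta;\gamma_1,\dots,\gamma_m}\prod_{k=1}^m\partial_1\partial_{\gamma_k}f,$$ $$\partial_0\partial_\alpha f=\partial_0\partial_1f\cdot\sum_{m\ge1}\sum_{\gamma_1,\dots,\gamma_m\ge1}R^{(\mathrm D,2)}_{\alpha;\gamma_1,\dots,\gamma_m}\prod_{k=1}^m\partial_1\partial_{\gamma_k}f .$$ This system coincides with the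 reduction (in the second set of variables) of the dispersionless 2-component BKP hierarchy after the change of variables $t_k\mapsto t_{2k-1}/(2k-1)$, $t_0\mapsto\bar t_1$ and the substitution $f\mapsto2F_0$. That is, for $F_0=F_0(T_1,T_3,T_5,\dots;\bar T_1)$ the function $f(t_0,t_1,t_2,\dots):=2F_0\big|_{T_{2k-1}=t_k/(2k-1)\ (k\ge1),\ \bar T_1=t_0}$ satisfies the system above if and only if $F_0$ satisfies the reduced dispersionless 2-component BKP hierarchy.
   Context: The $D_N$ Frobenius potential $F_{D_N}$ ($N\ge4$). The coordinates $t_1,\dots,t_{N-1}$ and $v_1,\dots,v_{N-1}$ are related by the invertible polynomial change $$t_\gamma=\sum_{\substack{a_1,\dots,a_{N-1}\ge0\\ \sum_k(N-k)a_k=N-\gamma}}(-1)^{|a|-1}\prod_{k=0}^{|a|-2}\bigl(2\gamma-1+2k(N-1)\bigr)\prod_{k=1}^{N-1}\frac{v_k^{a_k}}{a_k!},\qquad1\le\gamma\le N-1,\quad|a|=\sum_ka_k,$$ (empty products equal $1$), and $v_1^{(N)}=v_1(t_1,\dots,t_{N-1})$ denotes the resulting polynomial. $F_{D_N}\in\mathbb{Q}[t_1,\dots,t_N]$ is the polynomial without constant term determined by $\frac{\partial F_{D_N}}{\partial t_N}=v_1^{(N)}t_N$ and, for $1\le\alpha\le N-1$, $$\left.\frac{\partial F_{D_N}}{\partial t_\alpha}\right|_{t_N=0}=\sum_{\substack{a_1,\dots,a_{N-1}\ge0\\ \sum_k(N-k)a_k=N-1+\alpha}}(-1)^{|a|}\prod_{k=0}^{|a|-3}\bigl(2(N-\alpha)-1+2k(N-1)\bigr)\prod_{k=1}^{N-1}\frac{v_k^{a_k}}{a_k!},$$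 where $v_k=v_k(t_1,\dots,t_{N-1})$. Notation: $\partial_k=\partial/\partial t_k$ for $k\ge0$ in the system for $f$. Reduced dispersionless 2-component BKP hierarchy. The dispersionless 2-component BKP hierarchy is a system of Fay-type identities on a function of two sets of times $T_1,T_3,\dots$ and $\bar T_1,\bar T_3,\dots$, involving $D^{\mathrm B}(z)=\sum_{n\ge0}\frac{z^{-2n-1}}{2n+1}\frac{\partial}{\partial T_{2n+1}}$ and the analogous $\bar D^{\mathrm B}(z)$. The reduction sets $\bar D^{\mathrm B}(z)=z^{-1}\bar\partial_1$, $\bar\partial_1=\partial/\partial\bar T_1$, and keeps $\bar D^{\mathrm B}(z)$ only to first order in $z^{-1}$. With $\partial_{T_1}=\partial/\partial T_1$, the reduced hierarchy for $F_0=F_0(T_1,T_3,\dots;\bar T_1)$ consists of the two identities of formal power series in $z_1^{-1},z_2^{-1}$ (resp. $z_1^{-1}$): $$\left(1-\frac{\partial_{T_1}(2D^{\mathrm B}(z_1)+2D^{\mathrm B}(z_2))F_0}{z_1+z_2}\right)e^{2D^{\mathrm B}(z_1)\cdot2D^{\mathrm B}(z_2)F_0}=1-\frac{\partial_{T_1}(2D^{\mathrm B}(z_1)-2D^{\mathrm B}(z_2))F_0}{z_1-z_2},$$ $$D^{\mathrm B}(z_1)\,\bar\partial_1(2F_0)=\sum_{m\ge1}\bar\partial_1\partial_{T_1}(2F_0)\cdot z_1^{-m}\bigl(\partial_{T_1}D^{\mathrm B}(z_1)(2F_0)\bigr)^{m-1}.$$ Functions may be taken to be formal power series in the time variables. 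*)

theory Defs
  imports
    Complex_Main
    "HOL-Library.Poly_Mapping"
    "HOL-Computational_Algebra.Formal_Power_Series"
begin

section \<open>Formal power series in an arbitrary set of variables\<close>

text \<open>
  A series in variables indexed by \<open>'v\<close> (possibly infinitely many) is an arbitrary function from
  monomials, i.e. finitely supported exponent vectors, to coefficients.
\<close>

typedef ('v, 'a) mfps = "UNIV :: (('v \<Rightarrow>\<^sub>0 nat) \<Rightarrow> 'a) set"
  morphisms mfps_coeff Abs_mfps
  by simp

lemma mfps_coeff_Abs [simp]: "mfps_coeff (Abs_mfps f) = f"
  by (simp add: Abs_mfps_inverse)

lemma mfps_eqI: "(\<And>m. mfps_coeff p m = mfps_coeff q m) \<Longrightarrow> p = q"
  by (metis ext mfps_coeff_inject)

lemma finite_monomial_splits [simp]: "finite {(a, b). a + b = (m :: 'v \<Rightarrow>\<^sub>0 nat)}"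
proof -
  let ?l = "Poly_Mapping.lookup"
  let ?K = "Poly_Mapping.keys m"
  let ?B = "{.. Max (?l m ` ?K)}"
  let ?S = "{f. \<forall>x. (x \<in> ?K \<longrightarrow> f x \<in> ?B) \<and> (x \<notin> ?K \<longrightarrow> f x = 0)}"
  let ?A = "{a. \<exists>b. a + b = m}"
  have "?l a \<in> ?S" if "a + b = m" for a b :: "'v \<Rightarrow>\<^sub>0 nat"
  proof -
    have le: "?l a x \<le> ?l m x" for x
      using that by (auto simp: Poly_Mapping.lookup_add)
    have "?l a x \<le> Max (?l m ` ?K)" if "x \<in> ?K" for x
      using le[of x] Max_ge[of "?l m ` ?K" "?l m x"] that by (auto intro: order_trans)
    moreover have "?l a x = 0" if "x \<notin> ?K" for x
      using le[of x] that by (simp add: in_keys_iff)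
    ultimately show ?thesis by auto
  qed
  then have "?l ` ?A \<subseteq> ?S"
    by (intro image_subsetI) (elim CollectE exE)
  moreover have "finite ?S"
    by (rule finite_set_of_finite_funs) auto
  ultimately have "finite (?l ` ?A)"
    by (rule finite_subset)
  then have "finite ?A"
    by (rule finite_imageD) (auto intro!: inj_onI poly_mapping_eqI)
  then have "finite ((\<lambda>a. (a, m - a)) ` ?A)" by simp
  moreover have "{(a, b). a + b = m} \<subseteq> (\<lambda>a. (a, m - a)) ` ?A"
    by (auto simp: image_iff)
  ultimately show ?thesis by (rule rev_finite_subset)
qed

instantiation mfps :: (type, comm_ring_1) comm_ring_1
begin

definition zero_mfps :: "('a, 'b) mfps" where
  "0 = Abs_mfps (\<lambda>_. 0)"

definition one_mfps :: "('a, 'b) mfps" where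
  "1 = Abs_mfps (\<lambda>m. if m = 0 then 1 else 0)"

definition plus_mfps :: "('a, 'b) mfps \<Rightarrow> ('a, 'b) mfps \<Rightarrow> ('a, 'b) mfps" where
  "p + q = Abs_mfps (\<lambda>m. mfps_coeff p m + mfps_coeff q m)"

definition uminus_mfps :: "('a, 'b) mfps \<Rightarrow> ('a, 'b) mfps" where
  "- p = Abs_mfps (\<lambda>m. - mfps_coeff p m)"

definition minus_mfps :: "('a, 'b) mfps \<Rightarrow> ('a, 'b) mfps \<Rightarrow> ('a, 'b) mfps" where
  "p - q = Abs_mfps (\<lambda>m. mfps_coeff p m - mfps_coeff q m)"

definition times_mfps :: "('a, 'b) mfps \<Rightarrow> ('a, 'b) mfps \<Rightarrow> ('a, 'b) mfps" where
  "p * q = Abs_mfps (\<lambda>m. \<Sum>(a, b) | a + b = m. mfps_coeff p a * mfps_coeff q b)"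

instance
proof
  fix p q r :: "('a, 'b) mfps"
  show "p * q * r = p * (q * r)"
  proof (rule mfps_eqI)
    fix m :: "'a \<Rightarrow>\<^sub>0 nat"
    let ?p = "mfps_coeff p" and ?q = "mfps_coeff q" and ?r = "mfps_coeff r"
    have "mfps_coeff (p * q * r) m =
        (\<Sum>x | fst x + snd x = m. \<Sum>y | fst y + snd y = fst x. ?p (fst y) * ?q (snd y) * ?r (snd x))"
      by (simp add: times_mfps_def sum_distrib_right case_prod_unfold)
    also have "\<dots> = (\<Sum>(x, y) \<in> (SIGMA x : {x. fst x + snd x = m}. {y. fst y + snd y = fst x}).
        ?p (fst y) * ?q (snd y) * ?r (snd x))"
      using finite_monomial_splits by (subst sum.Sigma) (auto simp: case_prod_unfold)
    also have "\<dots> = (\<Sum>(x, y) \<in> (SIGMA x : {x. fst x + snd x = m}. {y. fst y + snd y = snd x}).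
        ?p (fst x) * ?q (fst y) * ?r (snd y))"
      by (rule sum.reindex_bij_witness[where
            i = "\<lambda>(x, y). ((fst x + fst y, snd y), (fst x, fst y))" and
            j = "\<lambda>(x, y). ((fst y, snd y + snd x), (snd y, snd x))"])
         (auto simp: add.assoc mult.assoc)
    also have "\<dots> = (\<Sum>x | fst x + snd x = m. \<Sum>y | fst y + snd y = snd x.
        ?p (fst x) * ?q (fst y) * ?r (snd y))"
      using finite_monomial_splits by (subst sum.Sigma) (auto simp: case_prod_unfold)
    also have "\<dots> = mfps_coeff (p * (q * r)) m"
      by (simp add: times_mfps_def sum_distrib_left case_prod_unfold mult.assoc)
    finally show "mfps_coeff (p * q * r) m = mfps_coeff (p * (q * r)) m" .
  qed
  show "p * q = q * p"
    unfolding times_mfps_def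
    by (rule arg_cong[where f = Abs_mfps], rule ext,
        rule sum.reindex_bij_witness[where i = prod.swap and j = prod.swap])
       (auto simp: add.commute mult.commute)
  show "1 * p = p"
  proof (rule mfps_eqI)
    fix m :: "'a \<Rightarrow>\<^sub>0 nat"
    have "mfps_coeff (1 * p) m =
        (\<Sum>x\<in>{x. fst x + snd x = m}. if x = (0, m) then mfps_coeff p m else 0)"
      by (auto simp: times_mfps_def one_mfps_def case_prod_unfold intro!: sum.cong)
    also have "\<dots> = mfps_coeff p m"
      using finite_monomial_splits[of m] by (simp add: sum.delta case_prod_unfold)
    finally show "mfps_coeff (1 * p) m = mfps_coeff p m" .
  qed
  show "(p + q) * r = p * r + q * r"
    by (rule mfps_eqI)
       (simp add: times_mfps_def plus_mfps_def case_prod_unfold distrib_right sum.distrib)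
  have "mfps_coeff 0 (0 :: 'a \<Rightarrow>\<^sub>0 nat) \<noteq> mfps_coeff (1 :: ('a, 'b) mfps) 0"
    by (simp add: zero_mfps_def one_mfps_def)
  then show "(0 :: ('a, 'b) mfps) \<noteq> 1" by metis
qed (auto intro!: mfps_eqI simp: zero_mfps_def plus_mfps_def uminus_mfps_def minus_mfps_def)

end

definition mfps_const :: "'a::comm_ring_1 \<Rightarrow> ('v, 'a) mfps" where
  "mfps_const c = Abs_mfps (\<lambda>m. if m = 0 then c else 0)"

definition mfps_deriv :: "'v \<Rightarrow> ('v, 'a::comm_ring_1) mfps \<Rightarrow> ('v, 'a) mfps" where
  "mfps_deriv v F = Abs_mfps (\<lambda>m.
     of_nat (Poly_Mapping.lookup m v + 1) * mfps_coeff F (m + Poly_Mapping.single v 1))"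

text \<open>
  For bijective \<open>\<pi> :: 'v \<Rightarrow> 'w\<close>, the series obtained from \<open>F\<close> by putting \<open>c v \<cdot> (variable \<pi> v)\<close>
  in place of each variable \<open>v\<close>.
\<close>

definition mfps_rescale ::
  "('v \<Rightarrow> 'w) \<Rightarrow> ('v \<Rightarrow> 'a) \<Rightarrow> ('v, 'a::comm_ring_1) mfps \<Rightarrow> ('w, 'a) mfps" where
  "mfps_rescale \<pi> c F = Abs_mfps (\<lambda>m.
     mfps_coeff F (Poly_Mapping.map_key \<pi> m) *
     (\<Prod>v\<in>Poly_Mapping.keys (Poly_Mapping.map_key \<pi> m). c v ^ Poly_Mapping.lookup m (\<pi> v)))"


section \<open>Polynomials with rational coefficients\<close>

text \<open>A polynomial in variables indexed by \<open>nat\<close>; the ring structure is that of \<open>Poly_Mapping\<close>.\<close>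

type_synonym qpoly = "(nat \<Rightarrow>\<^sub>0 nat) \<Rightarrow>\<^sub>0 rat"

definition pvar :: "nat \<Rightarrow> qpoly" where
  "pvar i = Poly_Mapping.single (Poly_Mapping.single i 1) 1"

definition pvars :: "qpoly \<Rightarrow> nat set" where
  "pvars p = (\<Union>m\<in>Poly_Mapping.keys p. Poly_Mapping.keys m)"

definition pdiff :: "nat \<Rightarrow> qpoly \<Rightarrow> qpoly" where
  "pdiff i p = (\<Sum>m\<in>Poly_Mapping.keys p.
     Poly_Mapping.single (m - Poly_Mapping.single i 1)
       (of_nat (Poly_Mapping.lookup m i) * Poly_Mapping.lookup p m))"

definition psubst :: "(nat \<Rightarrow> qpoly) \<Rightarrow> qpoly \<Rightarrow> qpoly" where
  "psubst \<sigma> p = (\<Sum>m\<in>Poly_Mapping.keys p.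
     Poly_Mapping.single 0 (Poly_Mapping.lookup p m) *
     (\<Prod>k\<in>Poly_Mapping.keys m. \<sigma> k ^ Poly_Mapping.lookup m k))"

text \<open>The value at the origin of the iterated partial derivative along the listed variables.\<close>

definition pdiffs_at_0 :: "nat list \<Rightarrow> qpoly \<Rightarrow> rat" where
  "pdiffs_at_0 ks p = Poly_Mapping.lookup (foldr pdiff ks p) 0"


section \<open>The Frobenius potential of type D\<close>

definition DN_exponents :: "nat \<Rightarrow> nat \<Rightarrow> (nat \<Rightarrow>\<^sub>0 nat) set" where
  "DN_exponents N d = {a. Poly_Mapping.keys a \<subseteq> {1..<N} \<and>
     (\<Sum>k=1..<N. (N - k) * Poly_Mapping.lookup a k) = d}"

definition exp_size :: "nat \<Rightarrow> (nat \<Rightarrow>\<^sub>0 nat) \<Rightarrow> nat" where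
  "exp_size N a = (\<Sum>k=1..<N. Poly_Mapping.lookup a k)"

definition exp_fact :: "nat \<Rightarrow> (nat \<Rightarrow>\<^sub>0 nat) \<Rightarrow> rat" where
  "exp_fact N a = (\<Prod>k=1..<N. fact (Poly_Mapping.lookup a k))"

text \<open>
  The flat coordinate \<open>t_\<gamma>\<close> as a polynomial in \<open>v_1, \<dots>, v_(N-1)\<close>. Every exponent vector \<open>a\<close> in the
  sum has \<open>|a| \<ge> 1\<close> when \<open>\<gamma> < N\<close>, so the subtraction in the sign is not truncated; a product with
  empty index range \<open>{..<0}\<close> is 1.
\<close>

definition DN_t_of_v :: "nat \<Rightarrow> nat \<Rightarrow> qpoly" where
  "DN_t_of_v N \<gamma> = (\<Sum>a\<in>DN_exponents N (N - \<gamma>).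
     Poly_Mapping.single a
       ((-1) ^ (exp_size N a - 1) *
        (\<Prod>k<exp_size N a - 1. 2 * of_nat \<gamma> - 1 + 2 * of_nat k * (of_nat N - 1)) / exp_fact N a))"

text \<open>The coordinates \<open>v_k\<close> as polynomials in \<open>t_1, \<dots>, t_(N-1)\<close>: the inverse coordinate change.\<close>

definition DN_v :: "nat \<Rightarrow> nat \<Rightarrow> qpoly" where
  "DN_v N = (THE v.
     (\<forall>k. k \<notin> {1..<N} \<longrightarrow> v k = 0) \<and>
     (\<forall>k\<in>{1..<N}. pvars (v k) \<subseteq> {1..<N} \<and> psubst (DN_t_of_v N) (v k) = pvar k) \<and>
     (\<forall>\<gamma>\<in>{1..<N}. psubst v (DN_t_of_v N \<gamma>) = pvar \<gamma>))"

text \<open>The gradient of the potential on \<open>t_N = 0\<close>, in the coordinates \<open>v_1, \<dots>, v_(N-1)\<close>.\<close>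

definition DN_grad_v :: "nat \<Rightarrow> nat \<Rightarrow> qpoly" where
  "DN_grad_v N \<alpha> = (\<Sum>a\<in>DN_exponents N (N - 1 + \<alpha>).
     Poly_Mapping.single a
       ((-1) ^ exp_size N a *
        (\<Prod>k<exp_size N a - 2. 2 * (of_nat N - of_nat \<alpha>) - 1 + 2 * of_nat k * (of_nat N - 1)) /
        exp_fact N a))"

definition DN_potential :: "nat \<Rightarrow> qpoly" where
  "DN_potential N = (THE F.
     pvars F \<subseteq> {1..N} \<and>
     Poly_Mapping.lookup F 0 = 0 \<and>
     pdiff N F = DN_v N 1 * pvar N \<and>
     (\<forall>\<alpha>\<in>{1..<N}. psubst (\<lambda>k. if k = N then 0 else pvar k) (pdiff \<alpha> F) =
        psubst (DN_v N) (DN_grad_v N \<alpha>)))"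


section \<open>The coefficients and the system of PDEs\<close>

text \<open>
  A tuple \<open>\<gamma>_1, \<dots>, \<gamma>_m\<close> is a list. The first two definitions compute the coefficients from a given
  \<open>N\<close>; the last two take the least \<open>N\<close> for which the expression makes sense.
\<close>

definition RD1_at :: "nat \<Rightarrow> nat \<Rightarrow> nat \<Rightarrow> nat list \<Rightarrow> rat" where
  "RD1_at N \<alpha> \<beta> \<gamma>s =
     1 / fact (length \<gamma>s) * pdiffs_at_0 (\<alpha> # \<beta> # map (\<lambda>\<gamma>. N - \<gamma>) \<gamma>s) (DN_potential N)"

definition RD2_at :: "nat \<Rightarrow> nat \<Rightarrow> nat list \<Rightarrow> rat" where
  "RD2_at N \<alpha> \<gamma>s =
     1 / fact (length \<gamma>s) * pdiffs_at_0 (\<alpha> # map (\<lambda>\<gamma>. N - \<gamma>) \<gamma>s) (DN_v N 1)"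

definition RD1_admissible :: "nat \<Rightarrow> nat \<Rightarrow> nat \<Rightarrow> nat list \<Rightarrow> bool" where
  "RD1_admissible N \<alpha> \<beta> \<gamma>s \<longleftrightarrow> N \<ge> 4 \<and> N > \<alpha> + \<beta> \<and> (\<forall>\<gamma>\<in>set \<gamma>s. \<gamma> \<le> N - 1)"

definition RD2_admissible :: "nat \<Rightarrow> nat \<Rightarrow> nat list \<Rightarrow> bool" where
  "RD2_admissible N \<alpha> \<gamma>s \<longleftrightarrow> N \<ge> 4 \<and> N > \<alpha> \<and> (\<forall>\<gamma>\<in>set \<gamma>s. \<gamma> \<le> N - 1)"

definition RD1 :: "nat \<Rightarrow> nat \<Rightarrow> nat list \<Rightarrow> rat" where
  "RD1 \<alpha> \<beta> \<gamma>s = RD1_at (LEAST N. RD1_admissible N \<alpha> \<beta> \<gamma>s) \<alpha> \<beta> \<gamma>s"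

definition RD2 :: "nat \<Rightarrow> nat list \<Rightarrow> rat" where
  "RD2 \<alpha> \<gamma>s = RD2_at (LEAST N. RD2_admissible N \<alpha> \<gamma>s) \<alpha> \<gamma>s"

text \<open>All tuples \<open>\<gamma>_1, \<dots>, \<gamma>_m \<ge> 1\<close> with \<open>m \<ge> 1\<close>.\<close>

definition index_tuples :: "nat list set" where
  "index_tuples = {\<gamma>s. \<gamma>s \<noteq> [] \<and> (\<forall>\<gamma>\<in>set \<gamma>s. \<gamma> \<ge> 1)}"

text \<open>
  The sums over \<open>m\<close> and \<open>\<gamma>_1, \<dots>, \<gamma>_m\<close> have finitely many nonzero terms (the coefficients vanish
  unless \<open>\<gamma>_1 + \<dots> + \<gamma>_m\<close> has the right value); they are taken over the tuples with nonzero
  coefficient because \<open>sum\<close> over an infinite set is 0 by convention.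
\<close>

definition DN_system :: "(nat, 'k::field_char_0) mfps \<Rightarrow> bool" where
  "DN_system f \<longleftrightarrow>
     (\<forall>\<alpha>\<ge>2. \<forall>\<beta>\<ge>2.
        mfps_deriv \<alpha> (mfps_deriv \<beta> f) =
        (\<Sum>\<gamma>s | \<gamma>s \<in> index_tuples \<and> RD1 \<alpha> \<beta> \<gamma>s \<noteq> 0.
           mfps_const (of_rat (RD1 \<alpha> \<beta> \<gamma>s)) *
           (\<Prod>\<gamma>\<leftarrow>\<gamma>s. mfps_deriv 1 (mfps_deriv \<gamma> f)))) \<and>
     (\<forall>\<alpha>\<ge>2.
        mfps_deriv 0 (mfps_deriv \<alpha> f) =
        mfps_deriv 0 (mfps_deriv 1 f) *
        (\<Sum>\<gamma>s | \<gamma>s \<in> index_tuples \<and> RD2 \<alpha> \<gamma>s \<noteq> 0.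
           mfps_const (of_rat (RD2 \<alpha> \<gamma>s)) *
           (\<Prod>\<gamma>\<leftarrow>\<gamma>s. mfps_deriv 1 (mfps_deriv \<gamma> f))))"


section \<open>The reduced dispersionless 2-component BKP hierarchy\<close>

text \<open>\<open>T_odd n\<close> is the time \<open>T_(2n+1)\<close>, and \<open>T_bar\<close> is the first time of the second set.\<close>

datatype bkp_time = T_odd nat | T_bar

abbreviation d_T1 :: "(bkp_time, 'k::field_char_0) mfps \<Rightarrow> (bkp_time, 'k) mfps" where
  "d_T1 \<equiv> mfps_deriv (T_odd 0)"

abbreviation d_bar :: "(bkp_time, 'k::field_char_0) mfps \<Rightarrow> (bkp_time, 'k) mfps" where
  "d_bar \<equiv> mfps_deriv T_bar"

text \<open>A series in \<open>z^(-1)\<close> is an \<open>fps\<close> whose variable \<open>fps_X\<close> plays the role of \<open>z^(-1)\<close>.\<close>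

definition DB :: "(bkp_time, 'k::field_char_0) mfps \<Rightarrow> (bkp_time, 'k) mfps fps" where
  "DB F = Abs_fps (\<lambda>j. if odd j then mfps_const (1 / of_nat j) * mfps_deriv (T_odd (j div 2)) F else 0)"

text \<open>Operators on functions of the times act on series in \<open>z^(-1)\<close> coefficientwise.\<close>

definition coeffwise :: "('a \<Rightarrow> 'b) \<Rightarrow> 'a fps \<Rightarrow> 'b fps" where
  "coeffwise g A = Abs_fps (\<lambda>n. g (fps_nth A n))"

text \<open>
  A series in \<open>z_1^(-1)\<close> and \<open>z_2^(-1)\<close> is a series in \<open>z_2^(-1)\<close> (outer) with coefficients that
  are series in \<open>z_1^(-1)\<close> (inner).
\<close>

definition in_z1 :: "'a::comm_ring_1 fps \<Rightarrow> 'a fps fps" where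
  "in_z1 A = fps_const A"

definition in_z2 :: "'a::comm_ring_1 fps \<Rightarrow> 'a fps fps" where
  "in_z2 A = coeffwise fps_const A"

definition DB1_DB2 :: "(bkp_time, 'k::field_char_0) mfps \<Rightarrow> (bkp_time, 'k) mfps fps fps" where
  "DB1_DB2 F = coeffwise DB (DB F)"

text \<open>The exponential of a series \<open>A\<close> without terms of degree 0 in \<open>z_2^(-1)\<close>.\<close>

definition fay_exp ::
  "('v, 'k::field_char_0) mfps fps fps \<Rightarrow> ('v, 'k) mfps fps fps" where
  "fay_exp A = fps_compose (Abs_fps (\<lambda>n. fps_const (mfps_const (1 / fact n)))) A"

text \<open>
  With \<open>w_i = z_i^(-1)\<close>, division by \<open>z_1 \<plusminus> z_2\<close> is multiplication by \<open>w_1 w_2 / (w_2 \<plusminus> w_1)\<close>. Neither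
  \<open>w_2 + w_1\<close> nor \<open>w_2 - w_1\<close> is a zero divisor, so quotients by them are unique; those in the
  identity below exist as power series because only odd powers of \<open>z\<close> occur in \<open>DB\<close>.
\<close>

definition exact_quot :: "'a::comm_ring_1 \<Rightarrow> 'a \<Rightarrow> 'a" where
  "exact_quot a b = (THE q. q * b = a)"

definition over_z1_plus_z2 :: "'a::comm_ring_1 fps fps \<Rightarrow> 'a fps fps" where
  "over_z1_plus_z2 A =
     exact_quot (in_z1 fps_X * in_z2 fps_X * A) (in_z2 fps_X + in_z1 fps_X)"

definition over_z1_minus_z2 :: "'a::comm_ring_1 fps fps \<Rightarrow> 'a fps fps" where
  "over_z1_minus_z2 A =
     exact_quot (in_z1 fps_X * in_z2 fps_X * A) (in_z2 fps_X - in_z1 fps_X)"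

text \<open>
  In the second identity \<open>m \<ge> 1\<close> is written \<open>n + 1\<close>, and \<open>sums\<close> is convergence of formal power
  series in \<open>z_1^(-1)\<close>.
\<close>

definition reduced_BKP :: "(bkp_time, 'k::field_char_0) mfps \<Rightarrow> bool" where
  "reduced_BKP F0 \<longleftrightarrow>
     (1 - over_z1_plus_z2 (coeffwise (coeffwise d_T1) (2 * in_z1 (DB F0) + 2 * in_z2 (DB F0)))) *
       fay_exp (2 * 2 * DB1_DB2 F0) =
     1 - over_z1_minus_z2 (coeffwise (coeffwise d_T1) (2 * in_z1 (DB F0) - 2 * in_z2 (DB F0))) \<and>
     (\<lambda>n. fps_const (d_bar (d_T1 (2 * F0))) * fps_X ^ (n + 1) * coeffwise d_T1 (DB (2 * F0)) ^ n)
       sums DB (d_bar (2 * F0))"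


section \<open>The change of variables\<close>

fun time_index :: "bkp_time \<Rightarrow> nat" where
  "time_index (T_odd n) = n + 1"
| "time_index T_bar = 0"

fun time_scale :: "bkp_time \<Rightarrow> 'k::field_char_0" where
  "time_scale (T_odd n) = 1 / of_nat (2 * n + 1)"
| "time_scale T_bar = 1"

lemma bij_time_index: "bij time_index"
proof (rule bijI')
  show "time_index x = time_index y \<longleftrightarrow> x = y" for x y
    by (cases x; cases y) auto
  show "\<exists>x. y = time_index x" for y
    by (cases y) (auto intro: exI[of _ T_bar] exI[of _ "T_odd _"])
qed

text \<open>\<open>2 F_0\<close> at \<open>T_(2k-1) = t_k / (2k-1)\<close> for \<open>k \<ge> 1\<close>, and at \<open>T_bar = t_0\<close>.\<close>

definition f_of :: "(bkp_time, 'k::field_char_0) mfps \<Rightarrow> (nat, 'k) mfps" where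
  "f_of F0 = mfps_rescale time_index time_scale (2 * F0)"

end

theory Submission
  imports Defs
begin

text \<open>
  Put \<open>f = 2F\<^sub>0\<close>, \<open>D(z) = \<Sum>z\<^bsup>1-2\<gamma>\<^esup>\<partial>\<^sub>\<gamma>\<close> and \<open>p(z) = z - \<partial>\<^sub>1D(z)f = z q(z\<^bsup>-2\<^esup>)\<close>. The first identity of the
  hierarchy becomes \<open>(p\<^sub>1 + p\<^sub>2)/(z\<^sub>1 + z\<^sub>2) exp(2D\<^sub>1D\<^sub>2f) = (p\<^sub>1 - p\<^sub>2)/(z\<^sub>1 - z\<^sub>2)\<close>: it says that the
  \<open>\<partial>\<^sub>\<alpha>\<partial>\<^sub>\<beta>f\<close> are the Grunsky coefficients of \<open>p\<close>, which are universal polynomials in the \<open>\<partial>\<^sub>1\<partial>\<^sub>\<gamma>f\<close>.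
  The geometric series in the second identity sums to \<open>\<partial>\<^sub>0\<partial>\<^sub>1f/p\<close>.

  On the Frobenius side let \<open>p\<close> be the inverse of the superpotential
  \<open>z\<^bsup>2N-2\<^esup> = p\<^bsup>2N-2\<^esup> + (2N - 2)\<Sum>v\<^sub>kp\<^bsup>2k-2\<^esup>\<close>. By Lagrange inversion
  \<open>p = z - \<Sum>t\<^bsub>N-\<gamma>\<^esub>z\<^bsup>1-2\<gamma>\<^esup> - \<Sum>(2\<alpha> - 1)(\<partial>F/\<partial>t\<^sub>\<alpha>)z\<^bsup>3-2N-2\<alpha>\<^esup>\<close> at \<open>t\<^sub>N = 0\<close>. Since the superpotential is a
  polynomial in \<open>p\<^sup>2\<close>, its derivative along \<open>t\<^sub>\<beta>\<close> is fixed by its leading terms, so the second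
  derivatives of the potential are the same Grunsky coefficients, and \<open>\<partial>v\<^sub>1/\<partial>t\<^sub>\<beta>\<close> is a coefficient
  of \<open>1/p\<close>.
\<close>

text \<open>Both sides encode one logarithm. With x = z_1^-2 and y = z_2^-2,
  \<open>grunsky q\<close> is z_1^2 z_2 times the z_1-derivative of half the logarithm of (z_1 -
  z_2)(p_1 + p_2) / ((z_1 + z_2)(p_1 - p_2)), and the Fay identity says that this logarithm is -2
  D_1 D_2 f. A derivative removes the exponential and leaves equations linear in the second
  derivatives of f; nothing is lost, since both sides of the identity equal 1 at z_2^-1 = 0. The
  coefficient rings are only known to be commutative, so quotients are multiplied out and every
  cancellation is justified by hand. The polynomials are built once over the rationals, for a
  generic q with coefficients -y_\<gamma>, and specialised by ring homomorphisms: y_\<gamma> becomes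
  t_(N-\<gamma>) or \<partial>_1\<partial>_\<gamma> f. If y_\<gamma> has weight \<gamma>, the entry
  (\<alpha>, \<beta>) has weight \<alpha> + \<beta> - 1. For N > \<alpha> + \<beta> it therefore
  sees only those coefficients of q that are flat coordinates, and none that is a component of the
  gradient; this gives the independence of N.\<close>

unbundle fps_syntax

section \<open>Grunsky coefficients\<close>

lemma coeffwise_nth [simp]: "coeffwise g A $ n = g (A $ n)"
  by (simp add: coeffwise_def)

lemma in_z1_nth [simp]: "in_z1 A $ n = (if n = 0 then A else 0)"
  by (simp add: in_z1_def)

lemma in_z2_nth [simp]: "in_z2 A $ n = fps_const (A $ n)"
  by (simp add: in_z2_def)

lemma coeffwise_add:
  assumes "\<And>a b. g (a + b) = g a + g b"
  shows "coeffwise g (A + B) = coeffwise g A + coeffwise g B"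
  by (simp add: fps_eq_iff assms)

lemmas additive_zero = additive.zero[OF additive.intro]
lemmas additive_uminus = additive.minus[OF additive.intro]
lemmas additive_diff = additive.diff[OF additive.intro]
lemmas additive_sum = additive.sum[OF additive.intro]

lemma coeffwise_mult:
  fixes g :: "'a::comm_ring_1 \<Rightarrow> 'b::comm_ring_1"
  assumes "\<And>a b. g (a + b) = g a + g b" and "\<And>a b. g (a * b) = g a * g b"
  shows "coeffwise g (A * B) = coeffwise g A * coeffwise g B"
  by (simp add: fps_eq_iff fps_mult_nth additive_sum[of g, OF assms(1)] assms(2))

lemma coeffwise_X:
  fixes g :: "'a::comm_ring_1 \<Rightarrow> 'b::comm_ring_1"
  assumes "g 0 = 0" and "g 1 = 1"
  shows "coeffwise g fps_X = fps_X"
  by (simp add: fps_eq_iff fps_X_def assms)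

lemma in_z1_add: "in_z1 (A + B) = in_z1 A + in_z1 B" by (simp add: in_z1_def)
lemma in_z1_diff: "in_z1 (A - B) = in_z1 A - in_z1 B" by (simp add: in_z1_def)
lemma in_z1_mult: "in_z1 (A * B) = in_z1 A * in_z1 B" by (simp add: in_z1_def)
lemma in_z1_1: "in_z1 1 = 1" by (simp add: in_z1_def)
lemma in_z1_power: "in_z1 (A ^ n) = in_z1 A ^ n" by (induction n) (simp_all add: in_z1_mult in_z1_1)

lemma in_z2_add: "in_z2 (A + B) = in_z2 A + in_z2 B" by (simp add: fps_eq_iff)
lemma in_z2_diff: "in_z2 (A - B) = in_z2 A - in_z2 B" by (simp add: fps_eq_iff)
lemma in_z2_mult: "in_z2 (A * B) = in_z2 A * in_z2 B"
  unfolding in_z2_def by (rule coeffwise_mult) auto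
lemma in_z2_1: "in_z2 1 = 1" by (simp add: fps_eq_iff)
lemma in_z2_power: "in_z2 (A ^ n) = in_z2 A ^ n" by (induction n) (simp_all add: in_z2_mult in_z2_1)
lemma in_z2_X: "in_z2 fps_X = fps_X" by (simp add: fps_eq_iff)

lemma in_z2_numeral: "in_z2 (numeral w) = numeral w"
  by (simp add: numeral_fps_const in_z2_def fps_eq_iff)

lemmas in_z_simps = in_z1_add in_z1_diff in_z1_mult in_z1_1 in_z1_power
  in_z2_add in_z2_diff in_z2_mult in_z2_1 in_z2_power in_z2_X

abbreviation X1 :: "'a::comm_ring_1 fps fps" where "X1 \<equiv> in_z1 fps_X"
abbreviation X2 :: "'a::comm_ring_1 fps fps" where "X2 \<equiv> fps_X"

lemma X1_mult_nth [simp]: "(X1 * A) $ n = fps_X * A $ n"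
  by (simp add: in_z1_def)

lemma fps_X_mult_eq_0: "fps_X * A = 0 \<Longrightarrow> A = (0 :: 'a::comm_ring_1 fps)"
proof -
  assume *: "fps_X * A = 0"
  have "A $ n = (fps_X * A) $ Suc n" for n by simp
  then show "A = 0" unfolding * by (simp add: fps_eq_iff)
qed

lemma X_minus_const_mult_eq_0:
  fixes A :: "'a::comm_ring_1 fps"
  assumes "\<And>b. a * b = 0 \<Longrightarrow> b = 0" and "(fps_X - fps_const a) * A = 0"
  shows "A = 0"
proof -
  have e: "(fps_X * A) $ n = a * A $ n" for n
  proof -
    have "((fps_X - fps_const a) * A) $ n = (fps_X * A) $ n - a * A $ n"
      by (simp only: left_diff_distrib fps_sub_nth fps_mult_left_const_nth)
    then show ?thesis using assms(2) by simp
  qed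
  have "A $ n = 0" for n
  proof (induction n)
    case 0
    show ?case using e[of 0] assms(1)[of "A $ 0"] by simp
  next
    case (Suc n)
    show ?case using e[of "Suc n"] assms(1)[of "A $ Suc n"] Suc by simp
  qed
  then show ?thesis by (simp add: fps_eq_iff)
qed

lemma X2_minus_X1_mult_eq_0: "(X2 - X1) * A = 0 \<Longrightarrow> A = 0"
  unfolding in_z1_def by (rule X_minus_const_mult_eq_0[of fps_X]) (auto dest: fps_X_mult_eq_0)

lemma X2_plus_X1_mult_eq_0: "(X2 + X1) * A = 0 \<Longrightarrow> A = 0"
proof (rule X_minus_const_mult_eq_0[of "- fps_X"])
  fix b :: "'a fps" assume "- fps_X * b = 0"
  then show "b = 0" using fps_X_mult_eq_0[of b] by simp
next
  assume "(X2 + X1) * A = 0"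
  moreover have "(X2 - fps_const (- fps_X)) = X2 + (X1 :: 'a fps fps)"
    by (simp add: in_z1_def)
  ultimately show "(X2 - fps_const (- fps_X)) * A = 0" by (simp only:)
qed

lemma X1_mult_eq_0: "X1 * A = 0 \<Longrightarrow> A = 0"
proof -
  assume "X1 * A = 0"
  then have "fps_X * A $ n = 0" for n by (metis X1_mult_nth fps_zero_nth)
  then have "A $ n = 0" for n by (rule fps_X_mult_eq_0)
  then show ?thesis by (simp add: fps_eq_iff)
qed

lemma unit_const_mult_eq_0:
  fixes A :: "'a::comm_ring_1 fps"
  assumes "A $ 0 = 1" and "A * B = 0"
  shows "B = 0"
proof -
  have "fps_right_inverse A 1 * A = 1"
    using fps_right_inverse[of A 1] assms(1) by (simp add: mult.commute)
  then have "B = fps_right_inverse A 1 * (A * B)" by (simp flip: mult.assoc)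
  with assms(2) show ?thesis by simp
qed

definition fps_swap :: "'a::comm_ring_1 fps fps \<Rightarrow> 'a fps fps" where
  "fps_swap A = Abs_fps (\<lambda>n. Abs_fps (\<lambda>m. A $ m $ n))"

lemma fps_swap_nth [simp]: "fps_swap A $ n $ m = A $ m $ n" by (simp add: fps_swap_def)
lemma fps_swap_add: "fps_swap (A + B) = fps_swap A + fps_swap B" by (simp add: fps_eq_iff)
lemma fps_swap_diff: "fps_swap (A - B) = fps_swap A - fps_swap B" by (simp add: fps_eq_iff)
lemma fps_swap_uminus: "fps_swap (- A) = - fps_swap A" by (simp add: fps_eq_iff)
lemma fps_swap_mult: "fps_swap (A * B) = fps_swap A * fps_swap B"
proof -
  have "(\<Sum>i=0..m. \<Sum>j=0..n. A $ i $ j * B $ (m - i) $ (n - j)) =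
        (\<Sum>j=0..n. \<Sum>i=0..m. A $ i $ j * B $ (m - i) $ (n - j))" for m n
    by (rule sum.swap)
  then show ?thesis by (simp add: fps_eq_iff fps_mult_nth fps_sum_nth)
qed
lemma fps_swap_1: "fps_swap 1 = 1" by (simp add: fps_eq_iff fps_one_nth)
lemma fps_swap_power: "fps_swap (A ^ n) = fps_swap A ^ n"
  by (induction n) (simp_all add: fps_swap_mult fps_swap_1)
lemma fps_swap_z1: "fps_swap (in_z1 A) = in_z2 A" by (simp add: fps_eq_iff)
lemma fps_swap_z2: "fps_swap (in_z2 A) = in_z1 A" by (simp add: fps_eq_iff)
lemma fps_swap_X2: "fps_swap X2 = X1" using fps_swap_z2[of fps_X] by (simp add: in_z2_X)
lemma fps_swap_X1: "fps_swap X1 = X2" using fps_swap_z1[of fps_X] by (simp add: in_z2_X)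
lemma fps_swap_swap [simp]: "fps_swap (fps_swap A) = A" by (simp add: fps_eq_iff)

lemmas fps_swap_simps = in_z2_X fps_swap_add fps_swap_diff fps_swap_uminus fps_swap_mult fps_swap_1
  fps_swap_power fps_swap_z1 fps_swap_z2 fps_swap_X2 fps_swap_X1

text \<open>The divided difference (b(y) - b(x)) / (y - x), with x the inner and y the outer
  variable; see \<open>divdiff_eq\<close>.\<close>

definition divdiff :: "'a::comm_ring_1 fps \<Rightarrow> 'a fps fps" where
  "divdiff b = Abs_fps (\<lambda>n. Abs_fps (\<lambda>m. b $ (m + n + 1)))"

text \<open>The second divided difference with the node x taken twice, (\<open>divdiff b\<close> -
  b'(x)) / (y - x).\<close>

definition divdiff2 :: "'a::comm_ring_1 fps \<Rightarrow> 'a fps fps" where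
  "divdiff2 b = Abs_fps (\<lambda>n. Abs_fps (\<lambda>m. of_nat (m + 1) * b $ (m + n + 2)))"

lemma divdiff_eq: "(X2 - X1) * divdiff b = in_z2 b - in_z1 b"
proof -
  have "((X2 - X1) * divdiff b) $ n $ m = (in_z2 b - in_z1 b) $ n $ m" for n m
    by (cases n; cases m) (simp_all add: left_diff_distrib divdiff_def)
  then show ?thesis by (simp add: fps_eq_iff)
qed

lemma divdiff2_eq: "(X2 - X1) * divdiff2 b = divdiff b - in_z1 (fps_deriv b)"
proof -
  have "((X2 - X1) * divdiff2 b) $ n $ m = (divdiff b - in_z1 (fps_deriv b)) $ n $ m" for n m
    by (cases n; cases m) (simp_all add: left_diff_distrib divdiff_def divdiff2_def algebra_simps)
  then show ?thesis by (simp add: fps_eq_iff)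
qed

text \<open>
  With \<open>x = z\<^sub>1\<^bsup>-2\<^esup>\<close> (inner) and \<open>y = z\<^sub>2\<^bsup>-2\<^esup>\<close> (outer variable): \<open>dp_dz q\<close> is \<open>dp/dz\<close>, \<open>sq_diff q\<close> is
  \<open>xy(p\<^sub>1\<^sup>2 - p\<^sub>2\<^sup>2)\<close>, and \<open>grunsky q\<close> is \<open>1/(y - x) - dp_dz(x)q(y)/sq_diff\<close>, whose coefficient at \<open>x\<^bsup>\<alpha>-1\<^esup>y\<^bsup>\<beta>-1\<^esup>\<close>
  will be \<open>(2\<alpha> - 1)\<partial>\<^sub>\<alpha>\<partial>\<^sub>\<beta>f\<close>. It is written with second divided differences to avoid the
  division by \<open>y - x\<close>.
\<close>

definition dp_dz :: "'a::comm_ring_1 fps \<Rightarrow> 'a fps" where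
  "dp_dz q = q - 2 * fps_X * fps_deriv q"

definition sq_quot :: "'a::comm_ring_1 fps \<Rightarrow> 'a fps fps" where
  "sq_quot q = in_z1 (q ^ 2) - X1 * divdiff (q ^ 2)"

definition sq_diff :: "'a::comm_ring_1 fps \<Rightarrow> 'a fps fps" where
  "sq_diff q = in_z1 q ^ 2 * X2 - in_z2 q ^ 2 * X1"

definition grunsky :: "'a::comm_ring_1 fps \<Rightarrow> 'a fps fps" where
  "grunsky q = fps_right_inverse (sq_quot q) 1 * (- (in_z1 (dp_dz q) * divdiff q + X1 * divdiff2 (q ^ 2)))"

lemma sq_quot_sq_diff: "(X2 - X1) * sq_quot q = sq_diff q"
proof -
  have "(X2 - X1) * sq_quot q = (X2 - X1) * in_z1 q ^ 2 - X1 * ((X2 - X1) * divdiff (q ^ 2))"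
    unfolding sq_quot_def by (simp add: in_z_simps algebra_simps)
  also have "\<dots> = sq_diff q" unfolding divdiff_eq sq_diff_def by (simp add: in_z_simps algebra_simps)
  finally show ?thesis .
qed

lemma power2_nth_0: "q $ 0 = 1 \<Longrightarrow> (q ^ 2) $ 0 = (1 :: 'a::comm_ring_1)"
  by (simp add: power2_eq_square)

text \<open>At y = 0 the divided difference of \<open>q ^ 2\<close> is (q(x)^2 - 1) / x, so
  everything but 1 cancels. This makes \<open>sq_quot q\<close> invertible, which
  \<open>sq_diff q\<close> is not.\<close>

lemma sq_quot_0:
  fixes q :: "'a::comm_ring_1 fps"
  assumes "q $ 0 = 1" shows "sq_quot q $ 0 = 1"
proof -
  have "sq_quot q $ 0 $ n = 1 $ n" for n
    using power2_nth_0[OF assms] by (cases n) (simp_all add: sq_quot_def divdiff_def)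
  then show ?thesis by (simp add: fps_eq_iff)
qed

lemma sq_quot_grunsky:
  assumes "q $ 0 = 1" shows "sq_quot q * grunsky q = - (in_z1 (dp_dz q) * divdiff q + X1 * divdiff2 (q ^ 2))"
  using fps_right_inverse[of "sq_quot q" 1] sq_quot_0[OF assms] by (simp add: grunsky_def flip: mult.assoc)

text \<open>The right side vanishes on the diagonal y = x, where \<open>sq_quot q\<close> becomes q
  (q - 2 x q'). This is why the quotient described above is a power series; the two divided
  differences in \<open>grunsky\<close> are what remains after the factor y - x is removed.\<close>

lemma sq_diff_grunsky:
  fixes q :: "'a::comm_ring_1 fps"
  assumes "q $ 0 = 1" shows "sq_diff q * grunsky q = sq_quot q - in_z1 (dp_dz q) * in_z2 q"
proof -
  have d: "fps_deriv (q ^ 2) = 2 * q * fps_deriv q"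
    by (simp add: fps_deriv_power algebra_simps power2_eq_square)
  have "sq_diff q * grunsky q = (X2 - X1) * (sq_quot q * grunsky q)" by (simp flip: sq_quot_sq_diff add: mult.assoc)
  also have "\<dots> = - (in_z1 (dp_dz q) * ((X2 - X1) * divdiff q) + X1 * ((X2 - X1) * divdiff2 (q ^ 2)))"
    unfolding sq_quot_grunsky[OF assms] by (simp only: ring_distribs mult.left_commute mult_minus_right)
  also have "\<dots> = - (in_z1 (dp_dz q) * (in_z2 q - in_z1 q) + X1 * (divdiff (q ^ 2) - in_z1 (fps_deriv (q ^ 2))))"
    unfolding divdiff_eq divdiff2_eq ..
  also have "\<dots> = sq_quot q - in_z1 (dp_dz q) * in_z2 q"
    unfolding sq_quot_def dp_dz_def d by (simp add: in_z_simps algebra_simps power2_eq_square)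
  finally show ?thesis .
qed

lemma sq_diff_mult_eq_0:
  assumes "q $ 0 = 1" "sq_diff q * A = 0" shows "A = 0"
proof -
  have "(X2 - X1) * (sq_quot q * A) = 0" using assms(2) by (simp flip: sq_quot_sq_diff add: mult.assoc)
  then have "sq_quot q * A = 0" by (rule X2_minus_X1_mult_eq_0)
  then show ?thesis by (rule unit_const_mult_eq_0[OF sq_quot_0[OF assms(1)]])
qed

text \<open>The form in which the Grunsky series is recognised later: a linear equation, in which no
  inverse series has to be computed or transported.\<close>

lemma grunsky_unique:
  fixes q :: "'a::comm_ring_1 fps"
  assumes "q $ 0 = 1" "sq_diff q * A = sq_quot q - in_z1 (dp_dz q) * in_z2 q"
  shows "A = grunsky q"
proof -
  have "sq_diff q * (A - grunsky q) = 0" using assms sq_diff_grunsky[OF assms(1)] by (simp add: right_diff_distrib)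
  then have "A - grunsky q = 0" by (rule sq_diff_mult_eq_0[OF assms(1)])
  then show ?thesis by simp
qed

section \<open>Symmetry of the Grunsky coefficients\<close>

lemma sq_diff_swap: "fps_swap (sq_diff q) = - sq_diff q"
  by (simp add: sq_diff_def fps_swap_simps)

lemma sq_quot_swap: "fps_swap (sq_quot q) = sq_quot q"
proof -
  have "(X2 - X1) * (fps_swap (sq_quot q) - sq_quot q) = - fps_swap ((X2 - X1) * sq_quot q) - (X2 - X1) * sq_quot q"
    by (simp add: fps_swap_simps algebra_simps)
  also have "\<dots> = 0" by (simp add: sq_quot_sq_diff sq_diff_swap)
  finally have "fps_swap (sq_quot q) - sq_quot q = 0" by (rule X2_minus_X1_mult_eq_0)
  then show ?thesis by simp
qed

lemma in_z2_deriv: "fps_deriv (in_z2 q) = in_z2 (fps_deriv q)"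
  by (simp add: fps_eq_iff fps_const_mult fps_of_nat[symmetric] flip: fps_const_mult)

lemma in_z1_deriv: "fps_deriv (in_z1 q) = 0"
  by (simp add: in_z1_def)

text \<open>The quotient rule for (1 + 2y d/dy)(Z / (d K)) with denominators cleared. Here
  \<open>p\<close>, \<open>r\<close>, \<open>k1\<close> stand for q(x), q(y) and
  \<open>dp_dz q\<close> at x. Divided by (d K)^2 the right side is k1 k2 (p^2 y + r^2 x) / K^2 - (x
  + y) / d^2 with k2 = r - 2 y r', which is symmetric in the two variables.\<close>

lemma theta_identity:
  fixes x y p r r' k1 :: "'a::comm_ring_1"
  assumes "K = p ^ 2 * y - r ^ 2 * x" "d = y - x" "Z = K - d * k1 * r" "K' = p ^ 2 - 2 * r * r' * x"
  shows "d * K * Z + 2 * y * (d * K * (K' - k1 * r - d * k1 * r') - (K + d * K') * Z) =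
    d ^ 2 * (k1 * (r - 2 * (y * r')) * (p ^ 2 * y + r ^ 2 * x)) - (x + y) * K ^ 2"
  unfolding assms power2_eq_square by (simp add: algebra_simps)

text \<open>The operator 1 + 2y d/dy is 1 - z_2 d/dz_2. It turns z_1^2 z_2 times the z_1-derivative
  of the half logarithm into -z_1^2 z_2^2 times its mixed second derivative, and the logarithm is
  symmetric.\<close>

lemma grunsky_theta_swap:
  fixes q :: "'a::comm_ring_1 fps"
  assumes q: "q $ 0 = 1"
  defines "Th \<equiv> grunsky q + 2 * X2 * fps_deriv (grunsky q)"
  shows "fps_swap Th = Th"
proof -
  define d where "d = (X2 - X1 :: 'a fps fps)"
  define p r p' r' where "p = in_z1 q" "r = in_z2 q" "p' = in_z1 (fps_deriv q)" "r' = in_z2 (fps_deriv q)"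
  define s where "s = X2 * r'"
  define Z where "Z = sq_diff q - d * in_z1 (dp_dz q) * r"
  have Z: "d * sq_diff q * grunsky q = Z"
    using sq_diff_grunsky[OF q] sq_quot_sq_diff[of q] unfolding Z_def d_def p_r_p'_r'_def
    by (simp add: mult.assoc right_diff_distrib)
  have Kd: "fps_deriv (sq_diff q) = p ^ 2 - 2 * r * r' * X1"
    by (simp add: sq_diff_def p_r_p'_r'_def in_z1_deriv in_z2_deriv fps_deriv_power in_z_simps power2_eq_square algebra_simps)
  have k1d: "fps_deriv (in_z1 (dp_dz q)) = 0" by (rule in_z1_deriv)
  have divdiff: "fps_deriv d = 1" by (simp add: d_def in_z1_deriv)
  have Zd: "fps_deriv Z = fps_deriv (sq_diff q) - in_z1 (dp_dz q) * r - d * in_z1 (dp_dz q) * r'"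
    unfolding Z_def by (simp add: divdiff in_z1_deriv p_r_p'_r'_def in_z2_deriv)
  have Z': "sq_diff q * grunsky q + d * fps_deriv (sq_diff q) * grunsky q + d * sq_diff q * fps_deriv (grunsky q) = fps_deriv Z"
    unfolding Z[symmetric] by (simp add: divdiff algebra_simps)
  define k1 k2 where "k1 = in_z1 (dp_dz q)" "k2 = in_z2 (dp_dz q)"
  have k2: "k2 = r - 2 * s" by (simp add: k1_k2_def dp_dz_def p_r_p'_r'_def s_def in_z_simps in_z2_numeral mult.assoc)
  have "(d * sq_diff q) ^ 2 * Th = d * sq_diff q * (d * sq_diff q * grunsky q) + 2 * X2 * (d * sq_diff q * (d * sq_diff q * fps_deriv (grunsky q)))"
    unfolding Th_def by (simp add: algebra_simps power2_eq_square)
  also have "d * sq_diff q * (d * sq_diff q * fps_deriv (grunsky q)) =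
     d * sq_diff q * (fps_deriv Z) - (sq_diff q + d * fps_deriv (sq_diff q)) * (d * sq_diff q * grunsky q)"
    unfolding Z'[symmetric] by (simp add: algebra_simps)
  also have "d * sq_diff q * (d * sq_diff q * grunsky q) + 2 * X2 * (d * sq_diff q * fps_deriv Z - (sq_diff q + d * fps_deriv (sq_diff q)) * (d * sq_diff q * grunsky q))
     = d * sq_diff q * Z + 2 * X2 * (d * sq_diff q * fps_deriv Z - (sq_diff q + d * fps_deriv (sq_diff q)) * Z)"
    unfolding Z ..
  also have "\<dots> = d ^ 2 * (k1 * k2 * (p ^ 2 * X2 + r ^ 2 * X1)) - (X1 + X2) * sq_diff q ^ 2"
  proof -
    have K: "sq_diff q = p ^ 2 * X2 - r ^ 2 * X1" by (simp add: sq_diff_def p_r_p'_r'_def)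
    show ?thesis
      using theta_identity[OF K d_def Z_def[folded k1_k2_def(1)] Kd]
      unfolding Zd k1_k2_def(1)[symmetric] k2 s_def .
  qed
  finally have e: "(d * sq_diff q) ^ 2 * Th = d ^ 2 * (k1 * k2 * (p ^ 2 * X2 + r ^ 2 * X1)) - (X1 + X2) * sq_diff q ^ 2" .
  have ds: "fps_swap d = - d" by (simp add: d_def fps_swap_simps)
  \<comment> \<open>Both \<open>d\<close> and \<open>sq_diff q\<close> change sign under the swap,
    so the square of their product is invariant and can be cancelled afterwards.\<close>
  have "fps_swap ((d * sq_diff q) ^ 2 * Th) = (d * sq_diff q) ^ 2 * Th"
    unfolding e
    by (simp add: fps_swap_simps sq_diff_swap ds p_r_p'_r'_def k1_k2_def add.commute mult.commute mult.left_commute)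
  moreover have "fps_swap ((d * sq_diff q) ^ 2 * Th) = (d * sq_diff q) ^ 2 * fps_swap Th"
    by (simp add: fps_swap_simps sq_diff_swap ds)
  ultimately have "d * (sq_diff q * (d * (sq_diff q * (fps_swap Th - Th)))) = 0"
    by (simp add: power2_eq_square algebra_simps)
  then have "fps_swap Th - Th = 0"
    unfolding d_def by (blast dest: X2_minus_X1_mult_eq_0 sq_diff_mult_eq_0[OF q])
  then show ?thesis by simp
qed

lemma of_nat_mult_fps_nth: "(of_nat c * f) $ m = of_nat c * f $ m"
  for f :: "'a::comm_ring_1 fps"
  by (simp flip: fps_of_nat)

lemma numeral_mult_fps_nth: "(numeral c * f) $ m = numeral c * f $ m"
  for f :: "'a::comm_ring_1 fps"
  by (simp add: numeral_fps_const)

lemma X_deriv_nth: "(fps_X * fps_deriv A) $ n = of_nat n * A $ n"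
  for A :: "'a::comm_ring_1 fps"
  by (cases n) simp_all

lemma grunsky_symmetric:
  fixes q :: "'a::comm_ring_1 fps"
  assumes "q $ 0 = 1"
  shows "of_nat (2 * n + 1) * grunsky q $ n $ m = of_nat (2 * m + 1) * grunsky q $ m $ n"
proof -
  let ?T = "grunsky q + 2 * X2 * fps_deriv (grunsky q)"
  have T: "?T $ n $ m = of_nat (2 * n + 1) * grunsky q $ n $ m" for n m
  proof -
    have "(2 * X2 * fps_deriv (grunsky q)) $ n $ m = 2 * (of_nat n * grunsky q $ n $ m)"
      by (simp only: mult.assoc numeral_mult_fps_nth X_deriv_nth of_nat_mult_fps_nth)
    then show ?thesis by (simp add: algebra_simps)
  qed
  have "?T $ n $ m = ?T $ m $ n"
    using grunsky_theta_swap[OF assms] by (metis fps_swap_nth)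
  then show ?thesis unfolding T .
qed

text \<open>At y = 0, where \<open>sq_quot q\<close> is 1, x times the row collapses to
  \<open>dp_dz q - 1\<close>, and \<open>dp_dz\<close> multiplies the coefficient of x^(m+1) by 1 -
  2(m+1). This row is what makes the \<partial>_1\<partial>_\<gamma> f the free variables.\<close>

lemma grunsky_0:
  fixes q :: "'a::comm_ring_1 fps"
  assumes "q $ 0 = 1"
  shows "grunsky q $ 0 $ m = - of_nat (2 * m + 1) * q $ Suc m"
proof -
  have "sq_quot q $ 0 * grunsky q $ 0 = - (dp_dz q * divdiff q $ 0 + fps_X * divdiff2 (q ^ 2) $ 0)"
    using arg_cong[OF sq_quot_grunsky[OF assms], of "\<lambda>A. A $ 0"] by simp
  then have e: "grunsky q $ 0 = - (dp_dz q * divdiff q $ 0 + fps_X * divdiff2 (q ^ 2) $ 0)" using sq_quot_0[OF assms] by simp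
  have 1: "fps_X * divdiff q $ 0 = q - 1"
  proof -
    have "(fps_X * divdiff q $ 0) $ n = (q - 1) $ n" for n using assms by (cases n) (simp_all add: divdiff_def)
    then show ?thesis by (simp add: fps_eq_iff)
  qed
  have 2: "fps_X * (fps_X * divdiff2 (q ^ 2) $ 0) = fps_X * fps_deriv (q ^ 2) - q ^ 2 + 1"
  proof -
    have "(fps_X * (fps_X * divdiff2 (q ^ 2) $ 0)) $ n = (fps_X * fps_deriv (q ^ 2) - q ^ 2 + 1) $ n" for n
    proof (cases n)
      case 0 then show ?thesis using power2_nth_0[OF assms] by simp
    next
      case (Suc k)
      then show ?thesis by (cases k) (simp_all add: divdiff2_def algebra_simps)
    qed
    then show ?thesis by (simp add: fps_eq_iff)
  qed
  have d: "fps_deriv (q ^ 2) = 2 * q * fps_deriv q"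
    by (simp add: fps_deriv_power algebra_simps power2_eq_square)
  have "fps_X * grunsky q $ 0 = - (dp_dz q * (fps_X * divdiff q $ 0) + fps_X * (fps_X * divdiff2 (q ^ 2) $ 0))"
    unfolding e by (simp add: algebra_simps)
  also have "\<dots> = dp_dz q - 1" unfolding 1 2 d dp_dz_def by (simp add: algebra_simps power2_eq_square)
  finally have "(fps_X * grunsky q $ 0) $ Suc m = (dp_dz q - 1) $ Suc m" by simp
  also have "(dp_dz q - 1) $ Suc m = q $ Suc m - 2 * (of_nat (Suc m) * q $ Suc m)"
    unfolding dp_dz_def by (simp only: mult.assoc numeral_mult_fps_nth X_deriv_nth fps_sub_nth) simp
  finally show ?thesis by (simp add: algebra_simps)
qed

section \<open>Rows of the Grunsky series as polynomials in p^2\<close>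

lemma in_z2_mult_nth: "(in_z2 A * B) $ n = (\<Sum>i\<le>n. fps_const (A $ i) * B $ (n - i))"
  by (simp add: fps_mult_nth atLeast0AtMost)

lemma X_power_mult_divdiff:
  "fps_X ^ Suc n * divdiff b $ n = b - (\<Sum>i\<le>n. fps_const (b $ i) * fps_X ^ i)"
proof -
  have "(fps_X ^ Suc n * divdiff b $ n) $ m = (b - (\<Sum>i\<le>n. fps_const (b $ i) * fps_X ^ i)) $ m" for m
  proof -
    have "(\<Sum>i\<le>n. (fps_const (b $ i) * fps_X ^ i) $ m) = (\<Sum>i\<le>n. if m = i then b $ i else 0)"
      by (rule sum.cong) (simp_all add: fps_X_power_nth)
    also have "\<dots> = (if m \<le> n then b $ m else 0)" by simp
    finally show ?thesis
      by (simp add: fps_X_power_mult_nth fps_sum_nth divdiff_def del: power_Suc)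
  qed
  then show ?thesis by (simp add: fps_eq_iff)
qed

text \<open>
  The row \<open>\<beta> = n + 1\<close> of \<open>grunsky q\<close>: \<open>z\<^bsup>2n+1\<^esup> flow_series q n = z p'(z) A(p(z))\<close> for an even polynomial \<open>A\<close>
  of degree \<open>2n\<close> (lemma \<open>flow_series_lspan\<close>).
\<close>

definition flow_series :: "'a::comm_ring_1 fps \<Rightarrow> nat \<Rightarrow> 'a fps" where
  "flow_series q n = 1 + fps_X ^ Suc n * grunsky q $ n"

lemma sq_diff_mult_nth:
  "(sq_diff q * A) $ n = (if n = 0 then 0 else q ^ 2 * A $ (n - 1)) -
     fps_X * (\<Sum>i\<le>n. fps_const ((q ^ 2) $ i) * A $ (n - i))"
proof -
  have "sq_diff q * A = in_z1 (q ^ 2) * (X2 * A) - X1 * (in_z2 (q ^ 2) * A)"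
    by (simp add: sq_diff_def in_z_simps algebra_simps)
  then have "(sq_diff q * A) $ n = q ^ 2 * (X2 * A) $ n - fps_X * (in_z2 (q ^ 2) * A) $ n"
    by (simp add: in_z1_def)
  then show ?thesis unfolding in_z2_mult_nth by simp
qed

lemma flow_series_0:
  fixes q :: "'a::comm_ring_1 fps"
  assumes "q $ 0 = 1"
  shows "flow_series q 0 = dp_dz q"
proof -
  have Q: "(q ^ 2) $ 0 = 1" by (rule power2_nth_0[OF assms])
  have "(sq_diff q * grunsky q) $ 0 = (sq_quot q - in_z1 (dp_dz q) * in_z2 q) $ 0" unfolding sq_diff_grunsky[OF assms] ..
  then have "- (fps_X * grunsky q $ 0) = 1 - dp_dz q"
    unfolding sq_diff_mult_nth using Q sq_quot_0[OF assms] assms by simp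
  then have "fps_X * grunsky q $ 0 = dp_dz q - 1" by (metis minus_diff_eq minus_minus)
  then show ?thesis by (simp add: flow_series_def)
qed

text \<open>This is the coefficient of y^(n+1) in \<open>sq_diff_grunsky\<close>. The part q(x)^2 y
  of \<open>sq_diff\<close> multiplies the previous row by p^2, the part q(y)^2 x brings in all
  lower rows, and the product \<open>dp_dz\<close> times q(y) supplies the last term.\<close>

lemma flow_series_Suc:
  fixes q :: "'a::comm_ring_1 fps"
  assumes q: "q $ 0 = 1"
  shows "flow_series q (Suc n) = q ^ 2 * flow_series q n - (\<Sum>i=1..Suc n. fps_const ((q ^ 2) $ i) * fps_X ^ i * flow_series q (Suc n - i))
    + dp_dz q * fps_const (q $ Suc n) * fps_X ^ Suc n"
proof -
  let ?Q = "\<lambda>i. fps_const ((q ^ 2) $ i)"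
  let ?S = "\<Sum>i=1..Suc n. ?Q i * grunsky q $ (Suc n - i)"
  have Q: "(q ^ 2) $ 0 = 1" by (rule power2_nth_0[OF q])
  have at: "{..Suc n} = insert 0 {1..Suc n}" by auto
  have split: "(\<Sum>i\<le>Suc n. f i) = f 0 + (\<Sum>i=1..Suc n. f i)" for f :: "nat \<Rightarrow> 'a fps"
    unfolding at by simp
  have "(sq_diff q * grunsky q) $ Suc n = (sq_quot q - in_z1 (dp_dz q) * in_z2 q) $ Suc n" unfolding sq_diff_grunsky[OF q] ..
  then have "q ^ 2 * grunsky q $ n - fps_X * (grunsky q $ Suc n + ?S) =
      - (fps_X * divdiff (q ^ 2) $ Suc n) - dp_dz q * fps_const (q $ Suc n)"
    unfolding sq_diff_mult_nth split using Q by (simp add: sq_quot_def in_z1_def)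
  then have e: "fps_X * grunsky q $ Suc n = q ^ 2 * grunsky q $ n - fps_X * ?S + fps_X * divdiff (q ^ 2) $ Suc n
      + dp_dz q * fps_const (q $ Suc n)"
    by (simp add: algebra_simps add_eq_0_iff)
  have S: "fps_X ^ Suc (Suc n) * ?S = (\<Sum>i=1..Suc n. ?Q i * fps_X ^ i * (flow_series q (Suc n - i) - 1))"
  proof -
    have "fps_X ^ Suc (Suc n) * (?Q i * grunsky q $ (Suc n - i)) = ?Q i * fps_X ^ i * (flow_series q (Suc n - i) - 1)"
      if "i \<in> {1..Suc n}" for i
    proof -
      have "fps_X ^ Suc (Suc n) = fps_X ^ i * (fps_X ^ Suc (Suc n - i) :: 'a fps)"
        using that by (simp only: power_add[symmetric]) (simp add: Suc_diff_le)
      then show ?thesis by (simp add: flow_series_def algebra_simps del: power_Suc)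
    qed
    then show ?thesis unfolding sum_distrib_left by (intro sum.cong) auto
  qed
  define S where "S = ?S"
  have "flow_series q (Suc n) - 1 = fps_X ^ Suc n * (fps_X * grunsky q $ Suc n)"
    by (simp add: flow_series_def algebra_simps)
  also have "\<dots> = q ^ 2 * (flow_series q n - 1) - fps_X ^ Suc (Suc n) * S + fps_X ^ Suc (Suc n) * divdiff (q ^ 2) $ Suc n
     + dp_dz q * fps_const (q $ Suc n) * fps_X ^ Suc n"
    unfolding e S_def[symmetric] by (simp add: flow_series_def algebra_simps)
  also have "\<dots> = q ^ 2 * (flow_series q n - 1) - (\<Sum>i=1..Suc n. ?Q i * fps_X ^ i * (flow_series q (Suc n - i) - 1))
     + (q ^ 2 - (\<Sum>i\<le>Suc n. ?Q i * fps_X ^ i)) + dp_dz q * fps_const (q $ Suc n) * fps_X ^ Suc n"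
    unfolding S_def S X_power_mult_divdiff ..
  \<comment> \<open>The constants -1 attached to the rows cancel against the Taylor polynomial of
    \<open>q ^ 2\<close> that the divided difference leaves behind.\<close>
  also have "(\<Sum>i\<le>Suc n. ?Q i * fps_X ^ i) = 1 + (\<Sum>i=1..Suc n. ?Q i * fps_X ^ i)"
    unfolding split using Q by simp
  finally show ?thesis
    by (simp add: right_diff_distrib sum_subtractf del: power_Suc sum.cl_ivl_Suc)
qed

text \<open>Times z^(2n), \<open>S\<close> is an even polynomial in p of degree at most 2n;
  \<open>c\<close> is its constant term, which is tracked because it becomes a derivative of
  v_1.\<close>

definition lspan :: "'a::comm_ring_1 fps \<Rightarrow> nat \<Rightarrow> 'a fps \<Rightarrow> 'a \<Rightarrow> bool" where
  "lspan q n S c \<longleftrightarrow> (\<exists>b. S = (\<Sum>j\<le>n. fps_const (b j) * fps_X ^ j * q ^ (2 * (n - j))) \<and> b n = c)"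

lemma lspan_0: "lspan q n 0 0"
  unfolding lspan_def by (rule exI[of _ "\<lambda>_. 0"]) simp

lemma lspan_add: "lspan q n S c \<Longrightarrow> lspan q n T d \<Longrightarrow> lspan q n (S + T) (c + d)"
  unfolding lspan_def
proof (elim exE conjE)
  fix b b'
  assume "S = (\<Sum>j\<le>n. fps_const (b j) * fps_X ^ j * q ^ (2 * (n - j)))" "b n = c"
    "T = (\<Sum>j\<le>n. fps_const (b' j) * fps_X ^ j * q ^ (2 * (n - j)))" "b' n = d"
  then show "\<exists>b. S + T = (\<Sum>j\<le>n. fps_const (b j) * fps_X ^ j * q ^ (2 * (n - j))) \<and> b n = c + d"
    by (intro exI[of _ "\<lambda>j. b j + b' j"]) (simp add: sum.distrib distrib_right flip: fps_const_add)
qed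

lemma lspan_const_mult: "lspan q n S c \<Longrightarrow> lspan q n (fps_const a * S) (a * c)"
  unfolding lspan_def
proof (elim exE conjE)
  fix b
  assume "S = (\<Sum>j\<le>n. fps_const (b j) * fps_X ^ j * q ^ (2 * (n - j)))" "b n = c"
  then show "\<exists>b. fps_const a * S = (\<Sum>j\<le>n. fps_const (b j) * fps_X ^ j * q ^ (2 * (n - j))) \<and> b n = a * c"
    by (intro exI[of _ "\<lambda>j. a * b j"]) (simp add: sum_distrib_left mult.assoc flip: fps_const_mult)
qed

lemma lspan_sum:
  "(\<And>i. i \<in> I \<Longrightarrow> lspan q n (S i) (c i)) \<Longrightarrow> lspan q n (sum S I) (sum c I)"
  by (induction I rule: infinite_finite_induct) (auto intro: lspan_0 lspan_add)

lemma lspan_X: "lspan q n S c \<Longrightarrow> lspan q (n + i) (fps_X ^ i * S) c"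
  unfolding lspan_def
proof (elim exE conjE)
  fix b
  assume S: "S = (\<Sum>j\<le>n. fps_const (b j) * fps_X ^ j * q ^ (2 * (n - j)))" "b n = c"
  let ?b = "\<lambda>j. if j < i then 0 else b (j - i)"
  have "fps_X ^ i * S = (\<Sum>j\<le>n. fps_const (b j) * fps_X ^ (j + i) * q ^ (2 * (n - j)))"
    unfolding S sum_distrib_left by (rule sum.cong) (simp_all add: power_add mult_ac)
  also have "\<dots> = (\<Sum>j\<in>{i..n+i}. fps_const (?b j) * fps_X ^ j * q ^ (2 * (n + i - j)))"
    by (rule sum.reindex_bij_witness[of _ "\<lambda>j. j - i" "\<lambda>j. j + i"]) auto
  also have "\<dots> = (\<Sum>j\<le>n+i. fps_const (?b j) * fps_X ^ j * q ^ (2 * (n + i - j)))"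
    by (rule sum.mono_neutral_left) auto
  finally show "\<exists>b. fps_X ^ i * S = (\<Sum>j\<le>n+i. fps_const (b j) * fps_X ^ j * q ^ (2 * (n + i - j))) \<and> b (n + i) = c"
    using S(2) by (intro exI[of _ ?b]) simp
qed

lemma lspan_q2: "lspan q n S c \<Longrightarrow> lspan q (Suc n) (q ^ 2 * S) 0"
  unfolding lspan_def
proof (elim exE conjE)
  fix b
  assume S: "S = (\<Sum>j\<le>n. fps_const (b j) * fps_X ^ j * q ^ (2 * (n - j)))" "b n = c"
  let ?b = "\<lambda>j. if j = Suc n then 0 else b j"
  have "q ^ 2 * S = (\<Sum>j\<le>n. fps_const (?b j) * fps_X ^ j * q ^ (2 * (Suc n - j)))"
    unfolding S sum_distrib_left
  proof (rule sum.cong)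
    fix j assume "j \<in> {..n}"
    then have "q ^ (2 * (Suc n - j)) = q ^ 2 * q ^ (2 * (n - j))"
      by (simp flip: power_add add: Suc_diff_le)
    then show "q ^ 2 * (fps_const (b j) * fps_X ^ j * q ^ (2 * (n - j))) = fps_const (?b j) * fps_X ^ j * q ^ (2 * (Suc n - j))"
      using \<open>j \<in> {..n}\<close> by (simp add: mult_ac)
  qed simp
  then show "\<exists>b. q ^ 2 * S = (\<Sum>j\<le>Suc n. fps_const (b j) * fps_X ^ j * q ^ (2 * (Suc n - j))) \<and> b (Suc n) = 0"
    by (intro exI[of _ ?b]) simp
qed

lemma lspan_top: "lspan q n (fps_const c * fps_X ^ n) c"
  unfolding lspan_def
proof (intro exI conjI)
  let ?b = "\<lambda>j. if j = n then c else 0"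
  have "(\<Sum>j\<le>n. fps_const (?b j) * fps_X ^ j * q ^ (2 * (n - j))) = (\<Sum>j\<le>n. if n = j then fps_const c * fps_X ^ n else 0)"
    by (rule sum.cong) auto
  then show "fps_const c * fps_X ^ n = (\<Sum>j\<le>n. fps_const (?b j) * fps_X ^ j * q ^ (2 * (n - j)))" by simp
qed simp

definition recip :: "'a::comm_ring_1 fps \<Rightarrow> 'a fps" where
  "recip q = fps_right_inverse q 1"

lemma recip_mult: "q $ 0 = 1 \<Longrightarrow> q * recip q = 1"
  unfolding recip_def by (rule fps_right_inverse) simp

lemma recip_unique:
  assumes "q $ 0 = 1" "q * c = 1" shows "c = recip q"
proof -
  have "q * (c - recip q) = 0" using assms recip_mult[OF assms(1)] by (simp add: right_diff_distrib)
  then have "c - recip q = 0" by (rule unit_const_mult_eq_0[OF assms(1)])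
  then show ?thesis by simp
qed

text \<open>Read off from q^2 (1/q) = q rather than from q (1/q) = 1, in order to match the
  recursion of the constant terms in \<open>flow_series_Suc\<close>.\<close>

lemma recip_recurrence:
  fixes q :: "'a::comm_ring_1 fps"
  assumes "q $ 0 = 1"
  shows "recip q $ n = q $ n - (\<Sum>i=1..n. (q ^ 2) $ i * recip q $ (n - i))"
proof -
  have "q ^ 2 * recip q = q" using recip_mult[OF assms] by (simp add: power2_eq_square mult.assoc)
  then have "q $ n = (\<Sum>i=0..n. (q ^ 2) $ i * recip q $ (n - i))" by (metis fps_mult_nth)
  also have "\<dots> = recip q $ n + (\<Sum>i=1..n. (q ^ 2) $ i * recip q $ (n - i))"
    using power2_nth_0[OF assms] by (simp add: sum.atLeast_Suc_atMost)
  finally show ?thesis by simp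
qed

text \<open>Multiplication by p^2 has no constant term, so in \<open>flow_series_Suc\<close> only
  the lower rows and the last summand contribute to it, and they do so by
  \<open>recip_recurrence\<close>. Up to the factor 2n + 1 the polynomial is the derivative of a
  Faber polynomial of p(z).\<close>

lemma flow_series_lspan:
  fixes q :: "'a::comm_ring_1 fps"
  assumes q: "q $ 0 = 1"
  shows "\<exists>S. flow_series q n = dp_dz q * S \<and> lspan q n S (recip q $ n)"
proof (induction n rule: less_induct)
  case (less n)
  show ?case
  proof (cases n)
    case 0
    have "lspan q 0 1 1" using lspan_top[of q 0 1] by simp
    moreover have "recip q $ 0 = 1" using recip_recurrence[OF q, of 0] q by simp
    ultimately show ?thesis using flow_series_0[OF q] 0 by (intro exI[of _ 1]) simp
  next
    case (Suc m)
    obtain S where S: "\<And>i. i < n \<Longrightarrow> flow_series q i = dp_dz q * S i" "\<And>i. i < n \<Longrightarrow> lspan q i (S i) (recip q $ i)"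
      using less by metis
    let ?T = "q ^ 2 * S m + (\<Sum>i=1..n. fps_const (- (q ^ 2) $ i) * (fps_X ^ i * S (n - i))) + fps_const (q $ n) * fps_X ^ n"
    have "flow_series q n = q ^ 2 * flow_series q m - (\<Sum>i=1..n. fps_const ((q ^ 2) $ i) * fps_X ^ i * flow_series q (n - i))
        + dp_dz q * fps_const (q $ n) * fps_X ^ n"
      using flow_series_Suc[OF q, of m] Suc by simp
    also have "(\<Sum>i=1..n. fps_const ((q ^ 2) $ i) * fps_X ^ i * flow_series q (n - i)) =
        (\<Sum>i=1..n. - (dp_dz q * (fps_const (- (q ^ 2) $ i) * (fps_X ^ i * S (n - i)))))"
      by (rule sum.cong) (auto simp: S(1) algebra_simps simp flip: fps_const_neg)
    also have "\<dots> = - (dp_dz q * (\<Sum>i=1..n. fps_const (- (q ^ 2) $ i) * (fps_X ^ i * S (n - i))))"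
      by (simp add: sum_negf sum_distrib_left)
    finally have "flow_series q n = dp_dz q * ?T" using S(1)[of m] Suc by (simp add: algebra_simps)
    moreover have "lspan q n ?T (0 + (\<Sum>i=1..n. - (q ^ 2) $ i * recip q $ (n - i)) + q $ n)"
    proof (intro lspan_add lspan_sum lspan_const_mult lspan_top)
      show "lspan q n (q ^ 2 * S m) 0" using lspan_q2[OF S(2)[of m]] Suc by simp
      show "lspan q n (fps_X ^ i * S (n - i)) (recip q $ (n - i))" if "i \<in> {1..n}" for i
        using lspan_X[OF S(2)[of "n - i"], of i] that by simp
    qed
    moreover have "0 + (\<Sum>i=1..n. - (q ^ 2) $ i * recip q $ (n - i)) + q $ n = recip q $ n"
      unfolding recip_recurrence[OF q, of n] by (simp add: sum_negf)
    ultimately show ?thesis by (intro exI[of _ ?T]) simp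
  qed
qed

lemma triangular_sum_eq_0:
  fixes u :: "nat \<Rightarrow> 'a::comm_ring_1 fps"
  assumes "\<And>j. u j $ 0 = 1"
    and "\<And>i. i \<le> M \<Longrightarrow> (\<Sum>j\<le>M. fps_const (a j) * fps_X ^ j * u j) $ i = 0"
    and "i \<le> M"
  shows "a i = 0"
  using assms(3)
proof (induction i rule: less_induct)
  case (less i)
  have "(fps_const (a j) * fps_X ^ j * u j) $ i = (if j = i then a i else 0)" for j
  proof -
    have "(fps_const (a j) * fps_X ^ j * u j) $ i = a j * (if i < j then 0 else u j $ (i - j))"
      by (simp add: mult.assoc fps_X_power_mult_nth)
    then show ?thesis using less.IH[of j] less.prems assms(1)[of j] by (cases "j < i"; cases "j = i") auto
  qed
  then have "(\<Sum>j\<le>M. fps_const (a j) * fps_X ^ j * u j) $ i = (\<Sum>j\<le>M. if j = i then a i else 0)"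
    unfolding fps_sum_nth by simp
  then show ?case using assms(2)[OF less.prems] less.prems by simp
qed

text \<open>
  An element of the span of the \<open>p\<^bsup>2k\<^esup>\<close> is determined by the terms of \<open>z p'(z) A(p(z))\<close> up to order
  \<open>x\<^sup>M\<close>; the remaining terms are then Grunsky coefficients.
\<close>

lemma flow_unique:
  fixes q :: "'a::comm_ring_1 fps"
  assumes q: "q $ 0 = 1" and n: "n \<le> M"
    and flow: "dp_dz q * (\<Sum>j\<le>M. fps_const (a j) * fps_X ^ j * q ^ (2 * (M - j))) = fps_X ^ (M - n) + fps_X ^ Suc M * B"
  shows "B = grunsky q $ n" and "a M = recip q $ n"
proof -
  obtain S where S: "flow_series q n = dp_dz q * S" "lspan q n S (recip q $ n)" using flow_series_lspan[OF q] by blast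
  have "lspan q M (fps_X ^ (M - n) * S) (recip q $ n)" using lspan_X[OF S(2), of "M - n"] n by simp
  then obtain b where b: "fps_X ^ (M - n) * S = (\<Sum>j\<le>M. fps_const (b j) * fps_X ^ j * q ^ (2 * (M - j)))" "b M = recip q $ n"
    unfolding lspan_def by auto
  have D: "dp_dz q * (\<Sum>j\<le>M. fps_const (b j) * fps_X ^ j * q ^ (2 * (M - j))) = fps_X ^ (M - n) + fps_X ^ Suc M * grunsky q $ n"
  proof -
    have "dp_dz q * (\<Sum>j\<le>M. fps_const (b j) * fps_X ^ j * q ^ (2 * (M - j))) = fps_X ^ (M - n) * flow_series q n"
      unfolding b(1)[symmetric] S(1) by (simp add: mult_ac)
    also have "\<dots> = fps_X ^ (M - n) + fps_X ^ (M - n + Suc n) * grunsky q $ n"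
      unfolding flow_series_def power_add by (simp add: algebra_simps)
    finally show ?thesis using n by simp
  qed
  \<comment> \<open>Both combinations produce the same terms up to x^M, so their difference starts
    at x^(M+1). Its M + 1 unknown coefficients then vanish by triangularity.\<close>
  let ?A = "\<Sum>j\<le>M. fps_const (a j - b j) * fps_X ^ j * q ^ (2 * (M - j))"
  have A: "dp_dz q * ?A = fps_X ^ Suc M * (B - grunsky q $ n)"
    using flow D by (simp add: left_diff_distrib right_diff_distrib sum_subtractf del: power_Suc flip: fps_const_sub)
  have k0: "dp_dz q $ 0 = 1" using q by (simp add: dp_dz_def mult.assoc)
  have "?A = recip (dp_dz q) * (dp_dz q * ?A)" using recip_mult[OF k0] by (simp only: mult.assoc[symmetric] mult.commute[of "recip (dp_dz q)"] mult_1_left)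
  also have "\<dots> = fps_X ^ Suc M * (recip (dp_dz q) * (B - grunsky q $ n))" unfolding A by (rule mult.left_commute)
  finally have "?A $ i = 0" if "i \<le> M" for i using that by (simp add: fps_X_power_mult_nth del: power_Suc)
  then have ab: "a i - b i = 0" if "i \<le> M" for i
    using triangular_sum_eq_0[of "\<lambda>j. q ^ (2 * (M - j))" M "\<lambda>j. a j - b j" i] that q
    by (simp add: fps_power_zeroth)
  then show "a M = recip q $ n" using b(2) by simp
  have "?A = 0" using ab by simp
  then have "fps_X ^ Suc M * (B - grunsky q $ n) = 0" using A by simp
  then have "(fps_X ^ Suc M * (B - grunsky q $ n)) $ (i + Suc M) = 0" for i by simp
  then show "B = grunsky q $ n" by (simp add: fps_X_power_mult_nth fps_eq_iff del: power_Suc)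
qed

section \<open>Ring homomorphisms acting on coefficients\<close>

locale comm_ring_hom =
  fixes \<phi> :: "'a::comm_ring_1 \<Rightarrow> 'b::comm_ring_1"
  assumes add: "\<phi> (a + b) = \<phi> a + \<phi> b" and mult: "\<phi> (a * b) = \<phi> a * \<phi> b" and one: "\<phi> 1 = 1"
begin

lemma zero: "\<phi> 0 = 0" by (rule additive_zero[of \<phi>, OF add])
lemma uminus: "\<phi> (- a) = - \<phi> a" by (rule additive_uminus[of \<phi>, OF add])
lemma diff: "\<phi> (a - b) = \<phi> a - \<phi> b" by (rule additive_diff[of \<phi>, OF add])
lemma hsum: "\<phi> (sum f A) = (\<Sum>i\<in>A. \<phi> (f i))" by (rule additive_sum[of \<phi>, OF add])
lemma hprod: "\<phi> (prod f A) = (\<Prod>i\<in>A. \<phi> (f i))"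
  by (induction A rule: infinite_finite_induct) (auto simp: one mult)
lemma power: "\<phi> (a ^ n) = \<phi> a ^ n" by (induction n) (simp_all add: one mult)
lemma of_nat: "\<phi> (of_nat n) = of_nat n" by (induction n) (simp_all add: zero one add)
lemma numeral: "\<phi> (numeral n) = numeral n" using of_nat[of "numeral n"] by simp

lemma coeffwise_hom: "comm_ring_hom (coeffwise \<phi>)"
  by standard
    (simp_all add: coeffwise_add[of \<phi>, OF add] coeffwise_mult[of \<phi>, OF add mult] fps_eq_iff fps_one_nth one zero)

lemma coeffwise_fps_const: "coeffwise \<phi> (fps_const c) = fps_const (\<phi> c)"
  by (simp add: fps_eq_iff zero)

lemma coeffwise_deriv: "coeffwise \<phi> (fps_deriv A) = fps_deriv (coeffwise \<phi> A)"
  by (simp add: fps_eq_iff mult add of_nat one)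

lemma coeffwise_fps_X: "coeffwise \<phi> fps_X = fps_X"
  by (rule coeffwise_X) (simp_all add: zero one)

lemma coeffwise_in_z1: "coeffwise (coeffwise \<phi>) (in_z1 A) = in_z1 (coeffwise \<phi> A)"
  by (auto simp: fps_eq_iff zero)

lemma coeffwise_in_z2: "coeffwise (coeffwise \<phi>) (in_z2 A) = in_z2 (coeffwise \<phi> A)"
  by (auto simp: fps_eq_iff zero)

lemma coeffwise_divdiff: "coeffwise (coeffwise \<phi>) (divdiff A) = divdiff (coeffwise \<phi> A)"
  by (simp add: fps_eq_iff divdiff_def)

lemma coeffwise_dp_dz: "coeffwise \<phi> (dp_dz q) = dp_dz (coeffwise \<phi> q)"
proof -
  interpret c: comm_ring_hom "coeffwise \<phi>" by (rule coeffwise_hom)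
  show ?thesis by (simp add: dp_dz_def c.diff c.mult c.numeral coeffwise_fps_X coeffwise_deriv)
qed

text \<open>By \<open>grunsky_unique\<close> it suffices to transport the linear equation that
  characterises the series.\<close>

lemma coeffwise_grunsky:
  assumes "q $ 0 = 1"
  shows "coeffwise (coeffwise \<phi>) (grunsky q) = grunsky (coeffwise \<phi> q)"
proof -
  interpret c: comm_ring_hom "coeffwise \<phi>" by (rule coeffwise_hom)
  interpret cc: comm_ring_hom "coeffwise (coeffwise \<phi>)" by (rule c.coeffwise_hom)
  note s = cc.diff cc.mult cc.power c.power c.mult coeffwise_in_z1 coeffwise_in_z2 coeffwise_divdiff c.coeffwise_fps_X
    coeffwise_fps_X coeffwise_dp_dz
  have 1: "coeffwise (coeffwise \<phi>) (sq_diff q) = sq_diff (coeffwise \<phi> q)"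
    unfolding sq_diff_def s ..
  have 2: "coeffwise (coeffwise \<phi>) (sq_quot q) = sq_quot (coeffwise \<phi> q)"
    unfolding sq_quot_def s ..
  have "sq_diff (coeffwise \<phi> q) * coeffwise (coeffwise \<phi>) (grunsky q) = coeffwise (coeffwise \<phi>) (sq_diff q * grunsky q)"
    unfolding cc.mult 1 ..
  also have "\<dots> = coeffwise (coeffwise \<phi>) (sq_quot q - in_z1 (dp_dz q) * in_z2 q)"
    unfolding sq_diff_grunsky[OF assms] ..
  also have "\<dots> = sq_quot (coeffwise \<phi> q) - in_z1 (dp_dz (coeffwise \<phi> q)) * in_z2 (coeffwise \<phi> q)"
    unfolding cc.diff cc.mult 2 coeffwise_in_z1 coeffwise_in_z2 coeffwise_dp_dz ..
  finally show ?thesis by (intro grunsky_unique) (simp_all add: assms one)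
qed

lemma coeffwise_recip:
  assumes "q $ 0 = 1"
  shows "coeffwise \<phi> (recip q) = recip (coeffwise \<phi> q)"
proof -
  interpret c: comm_ring_hom "coeffwise \<phi>" by (rule coeffwise_hom)
  have "coeffwise \<phi> q * coeffwise \<phi> (recip q) = 1"
    unfolding c.mult[symmetric] recip_mult[OF assms] by (rule c.one)
  then show ?thesis by (intro recip_unique) (simp_all add: assms one)
qed

end

section \<open>Polynomials with rational coefficients\<close>

abbreviation "lookup \<equiv> Poly_Mapping.lookup"
abbreviation "single \<equiv> Poly_Mapping.single"
abbreviation "keys \<equiv> Poly_Mapping.keys"

section \<open>Evaluation and substitution of polynomials\<close>

lemma sum_singles: "(\<Sum>m\<in>keys p. single m (lookup p m)) = p"
proof (rule poly_mapping_eqI)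
  fix n
  have "lookup (\<Sum>m\<in>keys p. single m (lookup p m)) n = (\<Sum>m\<in>keys p. if m = n then lookup p m else 0)"
    unfolding lookup_sum by (rule sum.cong) (auto simp: lookup_single when_def)
  also have "\<dots> = lookup p n" by (simp add: in_keys_iff)
  finally show "lookup (\<Sum>m\<in>keys p. single m (lookup p m)) n = lookup p n" .
qed

definition monom :: "(nat \<Rightarrow> 'b::comm_ring_1) \<Rightarrow> (nat \<Rightarrow>\<^sub>0 nat) \<Rightarrow> 'b" where
  "monom \<sigma> m = (\<Prod>k\<in>keys m. \<sigma> k ^ lookup m k)"

lemma monom_superset: "finite A \<Longrightarrow> keys m \<subseteq> A \<Longrightarrow> monom \<sigma> m = (\<Prod>k\<in>A. \<sigma> k ^ lookup m k)"
  unfolding monom_def by (rule prod.mono_neutral_left) (auto simp: in_keys_iff)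

lemma keys_add_nat: "keys (m + n) = keys m \<union> keys (n :: 'v \<Rightarrow>\<^sub>0 nat)"
  by (auto simp: in_keys_iff lookup_add)

lemma monom_add: "monom \<sigma> (m + n) = monom \<sigma> m * monom \<sigma> n"
  by (simp add: monom_superset[of "keys m \<union> keys n"] keys_add_nat lookup_add power_add prod.distrib)

lemma monom_0 [simp]: "monom \<sigma> 0 = 1" by (simp add: monom_def)
lemma monom_single [simp]: "monom \<sigma> (single k j) = \<sigma> k ^ j" by (simp add: monom_def)

text \<open>Coefficients pass through \<open>\<phi>\<close>, so that one notion covers both the
  substitution of polynomials and the evaluation of rational polynomials at power series over
  another field.\<close>

definition peval :: "(rat \<Rightarrow> 'b::comm_ring_1) \<Rightarrow> (nat \<Rightarrow> 'b) \<Rightarrow> qpoly \<Rightarrow> 'b" where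
  "peval \<phi> \<sigma> p = (\<Sum>m\<in>keys p. \<phi> (lookup p m) * monom \<sigma> m)"

lemma psubst_peval: "psubst \<sigma> = peval (single 0) \<sigma>"
  by (simp add: fun_eq_iff psubst_def peval_def monom_def)

lemma hom_single_0: "comm_ring_hom (single 0 :: rat \<Rightarrow> qpoly)"
  by standard (simp_all add: single_add mult_single)

context comm_ring_hom
begin

lemma comp_hom: "comm_ring_hom \<psi> \<Longrightarrow> comm_ring_hom (\<lambda>x. \<phi> (\<psi> x))"
  unfolding comm_ring_hom_def by (simp add: add mult one)

end

locale rat_hom = comm_ring_hom \<phi> for \<phi> :: "rat \<Rightarrow> 'b::comm_ring_1"
begin

lemma peval_superset: "finite M \<Longrightarrow> keys p \<subseteq> M \<Longrightarrow> peval \<phi> \<sigma> p = (\<Sum>m\<in>M. \<phi> (lookup p m) * monom \<sigma> m)"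
  unfolding peval_def by (rule sum.mono_neutral_left) (auto simp: in_keys_iff zero)

lemma peval_add: "peval \<phi> \<sigma> (p + q) = peval \<phi> \<sigma> p + peval \<phi> \<sigma> q"
proof -
  have "keys (p + q) \<subseteq> keys p \<union> keys q" by (rule Poly_Mapping.keys_add)
  then show ?thesis
    by (simp add: peval_superset[of "keys p \<union> keys q"] lookup_add add distrib_right sum.distrib)
qed

lemma peval_single [simp]: "peval \<phi> \<sigma> (single m c) = \<phi> c * monom \<sigma> m"
  by (subst peval_superset[of "{m}"]) auto

lemma peval_sum: "peval \<phi> \<sigma> (sum f A) = (\<Sum>i\<in>A. peval \<phi> \<sigma> (f i))"
  by (rule additive_sum) (rule peval_add)

lemma peval_mult: "peval \<phi> \<sigma> (p * q) = peval \<phi> \<sigma> p * peval \<phi> \<sigma> q"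
proof -
  have "p * q = (\<Sum>m\<in>keys p. \<Sum>n\<in>keys q. single m (lookup p m) * single n (lookup q n))"
    by (simp only: sum_product[symmetric] sum_singles)
  then have "peval \<phi> \<sigma> (p * q) =
      (\<Sum>m\<in>keys p. \<Sum>n\<in>keys q. (\<phi> (lookup p m) * monom \<sigma> m) * (\<phi> (lookup q n) * monom \<sigma> n))"
    by (simp add: peval_sum mult_single mult monom_add mult_ac)
  then show ?thesis unfolding peval_def sum_product .
qed

lemma peval_hom: "comm_ring_hom (peval \<phi> \<sigma>)"
proof
  show "peval \<phi> \<sigma> 1 = 1" using peval_single[of \<sigma> 0 1] by (simp add: one)
qed (rule peval_add peval_mult)+

lemma peval_pvar [simp]: "peval \<phi> \<sigma> (pvar k) = \<sigma> k"
  by (simp add: pvar_def one)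

lemma peval_cong:
  assumes "\<And>k. k \<in> pvars p \<Longrightarrow> \<sigma> k = \<tau> k"
  shows "peval \<phi> \<sigma> p = peval \<phi> \<tau> p"
proof -
  have "monom \<sigma> m = monom \<tau> m" if "m \<in> keys p" for m
    unfolding monom_def using that by (intro prod.cong) (auto simp: pvars_def intro!: arg_cong2[of _ _ _ _ power] assms)
  then show ?thesis unfolding peval_def by simp
qed

end

interpretation sub: rat_hom "single 0 :: rat \<Rightarrow> qpoly"
  unfolding rat_hom_def by (rule hom_single_0)

interpretation psubst: comm_ring_hom "psubst \<sigma>" for \<sigma>
  unfolding psubst_peval by (rule sub.peval_hom)

lemma psubst_pvar [simp]: "psubst \<sigma> (pvar k) = \<sigma> k"
  by (simp add: psubst_peval)

lemma psubst_single: "psubst \<sigma> (single m c) = single 0 c * monom \<sigma> m"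
  by (simp add: psubst_peval)

lemma psubst_single_0 [simp]: "psubst \<sigma> (single 0 c) = single 0 c"
  by (simp add: psubst_single)

lemma psubst_cong: "(\<And>k. k \<in> pvars p \<Longrightarrow> \<sigma> k = \<tau> k) \<Longrightarrow> psubst \<sigma> p = psubst \<tau> p"
  unfolding psubst_peval by (rule sub.peval_cong)

lemma single_Suc_monom: "lookup m k > 0 \<Longrightarrow> single m c = single (m - single k 1) c * pvar k"
proof -
  assume "lookup m k > 0"
  then have "m - single k 1 + single k 1 = m"
    by (intro poly_mapping_eqI) (auto simp: lookup_add lookup_minus lookup_single when_def)
  then show ?thesis by (simp add: pvar_def mult_single)
qed

definition tdeg :: "(nat \<Rightarrow>\<^sub>0 nat) \<Rightarrow> nat" where "tdeg m = (\<Sum>k\<in>keys m. lookup m k)"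

lemma tdeg_superset: "finite A \<Longrightarrow> keys m \<subseteq> A \<Longrightarrow> tdeg m = (\<Sum>k\<in>A. lookup m k)"
  unfolding tdeg_def by (rule sum.mono_neutral_left) (auto simp: in_keys_iff)

lemma tdeg_add: "tdeg (m + n) = tdeg m + tdeg n"
  by (simp add: tdeg_superset[of "keys m \<union> keys n"] keys_add_nat lookup_add sum.distrib)

lemma tdeg_single [simp]: "tdeg (single k j) = j" by (simp add: tdeg_def)

lemma minus_single_add: "lookup m k > 0 \<Longrightarrow> m - single k 1 + single k (1 :: nat) = m"
  by (intro poly_mapping_eqI) (auto simp: lookup_add lookup_minus lookup_single when_def)

lemma tdeg_minus: "lookup m k > 0 \<Longrightarrow> Suc (tdeg (m - single k 1)) = tdeg m"
  using tdeg_add[of "m - single k 1" "single k 1"] by (simp only: minus_single_add tdeg_single)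

lemma keys_empty_iff: "keys m = {} \<longleftrightarrow> m = 0" for m :: "'v \<Rightarrow>\<^sub>0 nat"
proof
  assume "keys m = {}"
  then have "lookup m k = 0" for k by (metis empty_iff in_keys_iff)
  then show "m = 0" by (intro poly_mapping_eqI) simp
qed simp

lemma tdeg_0_iff: "tdeg m = 0 \<longleftrightarrow> m = 0"
proof
  assume "tdeg m = 0"
  then have "lookup m k = 0" for k by (cases "k \<in> keys m") (auto simp: tdeg_def in_keys_iff)
  then show "m = 0" by (intro poly_mapping_eqI) simp
qed (simp add: tdeg_def)

text \<open>Monomials grow one variable at a time, so rules for \<open>pdiff\<close> and
  \<open>psubst\<close> need checking only for a factor \<open>pvar k\<close>.\<close>

lemma qpoly_induct [consumes 1, case_names const add mult]:
  assumes vars: "pvars p \<subseteq> A"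
    and const: "\<And>c. P (single 0 c)"
    and add: "\<And>p q. P p \<Longrightarrow> P q \<Longrightarrow> P (p + q)"
    and mult: "\<And>p k. P p \<Longrightarrow> k \<in> A \<Longrightarrow> P (p * pvar k)"
  shows "P p"
proof -
  have s: "P (single m c)" if "keys m \<subseteq> A" for m c
    using that
  proof (induction "tdeg m" arbitrary: m)
    case 0
    then have "m = 0" by (simp add: tdeg_0_iff)
    then show ?case by (simp add: const)
  next
    case (Suc n)
    then have "m \<noteq> 0" by (metis tdeg_0_iff nat.distinct(1))
    then obtain k where k: "k \<in> keys m" using keys_empty_iff by blast
    then have pos: "lookup m k > 0" by (simp add: in_keys_iff)
    have "keys (m - single k 1) \<subseteq> keys m" by (auto simp: in_keys_iff lookup_minus)
    then have "P (single (m - single k 1) c)" using Suc tdeg_minus[OF pos] by auto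
    then show ?case unfolding single_Suc_monom[OF pos] using k Suc.prems by (intro mult) auto
  qed
  have "P (\<Sum>m\<in>M. single m (lookup p m))" if "finite M" "M \<subseteq> keys p" for M
    using that
  proof (induction M)
    case empty
    show ?case using const[of 0] by simp
  next
    case (insert m M)
    then have "keys m \<subseteq> A" using vars by (auto simp: pvars_def)
    with insert show ?case by (simp add: add s)
  qed
  from this[of "keys p"] show ?thesis by (simp add: sum_singles)
qed

lemmas qpoly_induct_all = qpoly_induct[where A = UNIV, OF subset_UNIV, case_names const add mult]

section \<open>Partial derivatives\<close>

lemma lookup_pdiff: "lookup (pdiff i p) m = of_nat (lookup m i + 1) * lookup p (m + single i 1)"
proof -
  have "lookup (single (n - single i 1) (of_nat (lookup n i) * lookup p n)) m =
      (if n = m + single i 1 then of_nat (lookup m i + 1) * lookup p (m + single i 1) else 0)" for n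
  proof (cases "lookup n i = 0")
    case True
    then have "n \<noteq> m + single i 1" by (auto simp: lookup_add)
    with True show ?thesis by simp
  next
    case False
    then have "n - single i 1 = m \<longleftrightarrow> n = m + single i 1"
      using minus_single_add[of n i] by auto
    then show ?thesis by (auto simp: lookup_single when_def lookup_add)
  qed
  then have "lookup (pdiff i p) m = (\<Sum>n\<in>keys p. if n = m + single i 1 then of_nat (lookup m i + 1) * lookup p (m + single i 1) else 0)"
    unfolding pdiff_def lookup_sum by simp
  then show ?thesis by (simp add: in_keys_iff)
qed

lemma pdiff_add: "pdiff i (p + q) = pdiff i p + pdiff i q"
  by (rule poly_mapping_eqI) (simp add: lookup_pdiff lookup_add algebra_simps)

lemma pdiff_0 [simp]: "pdiff i 0 = 0" by (rule poly_mapping_eqI) (simp add: lookup_pdiff)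

lemma pdiff_const [simp]: "pdiff i (single 0 c) = 0"
proof (rule poly_mapping_eqI)
  fix m :: "nat \<Rightarrow>\<^sub>0 nat"
  have "lookup (m + single i 1) i \<noteq> lookup (0 :: nat \<Rightarrow>\<^sub>0 nat) i" by (simp add: lookup_add)
  then have "0 \<noteq> m + single i 1" by metis
  then show "lookup (pdiff i (single 0 c)) m = lookup 0 m" by (simp add: lookup_pdiff lookup_single when_def)
qed

lemma pdiff_1 [simp]: "pdiff i 1 = 0" using pdiff_const[of i 1] by simp

lemma lookup_mult_pvar: "lookup (p * pvar k) n = (if lookup n k = 0 then 0 else lookup p (n - single k 1))"
proof -
  have "p * pvar k = (\<Sum>m\<in>keys p. single (m + single k 1) (lookup p m))"
    by (subst (1) sum_singles[of p, symmetric]) (simp add: sum_distrib_right pvar_def mult_single)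
  then have "lookup (p * pvar k) n = (\<Sum>m\<in>keys p. if m + single k 1 = n then lookup p m else 0)"
    unfolding lookup_sum by (simp add: lookup_sum lookup_single when_def)
  also have "\<dots> = (\<Sum>m\<in>keys p. if m = n - single k 1 then (if lookup n k = 0 then 0 else lookup p (n - single k 1)) else 0)"
  proof (rule sum.cong)
    fix m
    have "m + single k 1 = n \<longleftrightarrow> lookup n k \<noteq> 0 \<and> m = n - single k 1"
      using minus_single_add[of n k] by (auto simp: lookup_add)
    then show "(if m + single k 1 = n then lookup p m else 0) =
       (if m = n - single k 1 then (if lookup n k = 0 then 0 else lookup p (n - single k 1)) else 0)" by auto
  qed simp
  also have "\<dots> = (if lookup n k = 0 then 0 else lookup p (n - single k 1))" by (simp add: in_keys_iff)
  finally show ?thesis .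
qed

lemma pdiff_mult_pvar: "pdiff i (p * pvar k) = pdiff i p * pvar k + (if i = k then p else 0)"
proof (rule poly_mapping_eqI)
  fix m :: "nat \<Rightarrow>\<^sub>0 nat"
  show "lookup (pdiff i (p * pvar k)) m = lookup (pdiff i p * pvar k + (if i = k then p else 0)) m"
  proof (cases "i = k")
    case True
    show ?thesis
    proof (cases "lookup m k = 0")
      case False
      then have "m + single k 1 - single k 1 = m - single k 1 + single k 1"
        using minus_single_add[of m k] by simp
      with True False show ?thesis
        by (simp add: lookup_pdiff lookup_mult_pvar lookup_add lookup_minus) (simp add: algebra_simps)
    qed (simp add: True lookup_pdiff lookup_mult_pvar lookup_add)
  next
    case False
    have "m + single i 1 - single k 1 = m - single k 1 + single i 1" if "lookup m k \<noteq> 0"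
      using that False by (intro poly_mapping_eqI) (auto simp: lookup_add lookup_minus lookup_single when_def)
    with False show ?thesis
      by (auto simp: lookup_pdiff lookup_mult_pvar lookup_add lookup_minus lookup_single when_def)
  qed
qed

lemma pdiff_pvar: "pdiff i (pvar k) = (if i = k then 1 else 0)"
  using pdiff_mult_pvar[of i 1 k] by simp

lemma lookup_const_mult: "lookup (single 0 c * p) m = c * lookup p m"
  for p :: qpoly
  by (simp flip: mult_map_scale_conv_mult add: Poly_Mapping.map.rep_eq when_def)

lemma pdiff_const_mult: "pdiff i (single 0 c * p) = single 0 c * pdiff i p"
  by (intro poly_mapping_eqI) (simp add: lookup_pdiff lookup_const_mult)

lemma pdiff_mult: "pdiff i (p * q) = pdiff i p * q + p * pdiff i q"
proof (induction q rule: qpoly_induct_all)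
  case (const c)
  have "pdiff i (p * single 0 c) = single 0 c * pdiff i p"
    by (subst mult.commute) (rule pdiff_const_mult)
  then show ?case by (simp add: mult.commute)
next
  case (add q r)
  then show ?case by (simp add: pdiff_add algebra_simps)
next
  case (mult q k)
  have "pdiff i (p * q * pvar k) = pdiff i (p * q) * pvar k + (if i = k then p * q else 0)"
    by (rule pdiff_mult_pvar)
  with mult show ?case by (simp add: pdiff_mult_pvar mult.assoc algebra_simps)
qed

lemma pdiff_commute: "pdiff i (pdiff j p) = pdiff j (pdiff i p)"
  by (rule poly_mapping_eqI)
     (auto simp: lookup_pdiff lookup_add lookup_single when_def add.assoc add.commute[of "single i (Suc 0)" "single j (Suc 0)"])

lemma foldr_pdiff_commute: "pdiff i (foldr pdiff ks p) = foldr pdiff ks (pdiff i p)"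
  by (induction ks) (simp_all add: pdiff_commute)

lemma lookup_foldr_pdiff:
  "\<exists>c>0. lookup (foldr pdiff ks p) m = of_nat c * lookup p (m + (\<Sum>k\<leftarrow>ks. single k 1))"
proof (induction ks arbitrary: m)
  case Nil
  show ?case by (rule exI[of _ 1]) simp
next
  case (Cons k ks)
  obtain c where "c > 0" "lookup (foldr pdiff ks p) (m + single k 1) = of_nat c * lookup p (m + single k 1 + (\<Sum>k\<leftarrow>ks. single k 1))"
    using Cons by blast
  then show ?case
    by (intro exI[of _ "(lookup m k + 1) * c"]) (simp add: lookup_pdiff add.assoc algebra_simps)
qed

lemma chain_rule:
  assumes "pvars p \<subseteq> A" "finite A"
  shows "pdiff i (psubst \<sigma> p) = (\<Sum>k\<in>A. psubst \<sigma> (pdiff k p) * pdiff i (\<sigma> k))"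
  using assms(1)
proof (induction p rule: qpoly_induct)
  case (const c)
  then show ?case by (simp add: psubst.zero)
next
  case (add p q)
  then show ?case by (simp add: psubst.add pdiff_add distrib_right sum.distrib)
next
  case (mult p k)
  have "(\<Sum>j\<in>A. psubst \<sigma> (pdiff j (p * pvar k)) * pdiff i (\<sigma> j)) =
      (\<Sum>j\<in>A. (psubst \<sigma> (pdiff j p) * pdiff i (\<sigma> j)) * \<sigma> k + (if j = k then psubst \<sigma> p * pdiff i (\<sigma> k) else 0))"
    by (rule sum.cong) (auto simp: pdiff_mult_pvar psubst.add psubst.mult psubst.zero algebra_simps)
  also have "\<dots> = pdiff i (psubst \<sigma> p) * \<sigma> k + psubst \<sigma> p * pdiff i (\<sigma> k)"
    using mult assms(2) by (simp add: sum.distrib sum_distrib_right)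
  finally show ?case by (simp add: psubst.mult pdiff_mult)
qed

lemma psubst_psubst: "psubst \<tau> (psubst \<sigma> p) = psubst (\<lambda>k. psubst \<tau> (\<sigma> k)) p"
proof (induction p rule: qpoly_induct_all)
  case (add p q) then show ?case by (simp add: psubst.add)
next
  case (mult p k) then show ?case by (simp add: psubst.mult)
qed simp_all

lemma psubst_id: "(\<And>k. k \<in> pvars p \<Longrightarrow> \<sigma> k = pvar k) \<Longrightarrow> psubst \<sigma> p = p"
proof -
  have *: "psubst pvar p = p"
    by (induction p rule: qpoly_induct_all) (simp_all add: psubst.add psubst.mult)
  assume "\<And>k. k \<in> pvars p \<Longrightarrow> \<sigma> k = pvar k"
  then have "psubst \<sigma> p = psubst pvar p" by (rule psubst_cong)
  with * show ?thesis by simp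
qed

lemma pvars_add: "pvars (p + q) \<subseteq> pvars p \<union> pvars q"
  unfolding pvars_def using Poly_Mapping.keys_add[of p q] by blast

lemma pvars_mult: "pvars (p * q) \<subseteq> pvars p \<union> pvars q"
proof -
  have "keys (p * q) \<subseteq> {a + b | a b. a \<in> keys p \<and> b \<in> keys q}" by (rule Poly_Mapping.keys_mult)
  then show ?thesis unfolding pvars_def by (fastforce simp: keys_add_nat)
qed

lemma pvars_single: "pvars (single m c) \<subseteq> keys m" by (simp add: pvars_def)
lemma pvars_pvar [simp]: "pvars (pvar k) = {k}" by (simp add: pvars_def pvar_def)
lemma pvars_const [simp]: "pvars (single 0 c) = {}" by (simp add: pvars_def)
lemma pvars_0 [simp]: "pvars 0 = {}" by (simp add: pvars_def)
lemma pvars_uminus [simp]: "pvars (- p) = pvars p"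
  by (simp add: pvars_def in_keys_iff set_eq_iff)
lemma pvars_sum: "(\<And>i. i \<in> I \<Longrightarrow> pvars (f i) \<subseteq> V) \<Longrightarrow> pvars (sum f I) \<subseteq> V"
  by (induction I rule: infinite_finite_induct) (use pvars_add in force)+

lemma pvars_psubst:
  assumes "\<And>k. k \<in> pvars p \<Longrightarrow> pvars (\<sigma> k) \<subseteq> V"
  shows "pvars (psubst \<sigma> p) \<subseteq> V"
proof -
  have "pvars p \<subseteq> {k. pvars (\<sigma> k) \<subseteq> V}" using assms by auto
  then show ?thesis
  proof (induction p rule: qpoly_induct)
    case (add p q) then show ?case using pvars_add by (fastforce simp: psubst.add)
  next
    case (mult p k) then show ?case using pvars_mult by (fastforce simp: psubst.mult)
  qed simp
qed

lemma pvars_pdiff: "pvars (pdiff i p) \<subseteq> pvars p"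
proof
  fix k assume "k \<in> pvars (pdiff i p)"
  then obtain m where "lookup (pdiff i p) m \<noteq> 0" "lookup m k \<noteq> 0" by (auto simp: pvars_def in_keys_iff)
  then have "lookup p (m + single i 1) \<noteq> 0" "lookup (m + single i 1) k \<noteq> 0"
    by (auto simp: lookup_pdiff lookup_add)
  then show "k \<in> pvars p" by (auto simp: pvars_def in_keys_iff)
qed

section \<open>Weighted homogeneity\<close>

definition weight :: "(nat \<Rightarrow>\<^sub>0 nat) \<Rightarrow> nat" where "weight m = (\<Sum>k\<in>keys m. k * lookup m k)"

lemma weight_superset: "finite A \<Longrightarrow> keys m \<subseteq> A \<Longrightarrow> weight m = (\<Sum>k\<in>A. k * lookup m k)"
  unfolding weight_def by (rule sum.mono_neutral_left) (auto simp: in_keys_iff)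

lemma weight_add: "weight (m + n) = weight m + weight n"
  by (simp add: weight_superset[of "keys m \<union> keys n"] keys_add_nat lookup_add sum.distrib algebra_simps)

lemma weight_0 [simp]: "weight 0 = 0" by (simp add: weight_def)
lemma weight_single [simp]: "weight (single k j) = k * j" by (simp add: weight_def)
lemma weight_sum_list: "weight (\<Sum>k\<leftarrow>ks. single k 1) = sum_list ks"
  by (induction ks) (simp_all add: weight_add)

text \<open>Variable 0 would have weight 0. Excluding it bounds the total degree by the weight
  (\<open>homog_tdeg\<close>) and confines the variables to {1..d}
  (\<open>homog_pvars\<close>).\<close>

definition homog :: "nat \<Rightarrow> qpoly \<Rightarrow> bool" where
  "homog d p \<longleftrightarrow> (\<forall>m\<in>keys p. 0 \<notin> keys m \<and> weight m = d)"

lemma homog_0 [simp]: "homog d 0" by (simp add: homog_def)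
lemma homog_add: "homog d p \<Longrightarrow> homog d q \<Longrightarrow> homog d (p + q)"
  unfolding homog_def using Poly_Mapping.keys_add[of p q] by blast
lemma homog_uminus: "homog d p \<Longrightarrow> homog d (- p)" by (simp add: homog_def in_keys_iff)
lemma homog_diff: "homog d p \<Longrightarrow> homog d q \<Longrightarrow> homog d (p - q)"
  using homog_add[of d p "- q"] homog_uminus[of d q] by simp
lemma homog_sum: "(\<And>i. i \<in> I \<Longrightarrow> homog d (f i)) \<Longrightarrow> homog d (sum f I)"
  by (induction I rule: infinite_finite_induct) (auto intro: homog_add)
lemma homog_mult: "homog d p \<Longrightarrow> homog e q \<Longrightarrow> homog (d + e) (p * q)"
proof -
  assume a: "homog d p" "homog e q"
  have "keys (p * q) \<subseteq> {a + b | a b. a \<in> keys p \<and> b \<in> keys q}" by (rule Poly_Mapping.keys_mult)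
  with a show ?thesis unfolding homog_def by (fastforce simp: keys_add_nat weight_add)
qed
lemma homog_const: "homog 0 (single 0 c)" by (simp add: homog_def)
lemma homog_1: "homog 0 1" using homog_const[of 1] by simp
lemma homog_pvar: "k > 0 \<Longrightarrow> homog k (pvar k)" by (simp add: homog_def pvar_def)
lemma homog_const_mult: "homog d p \<Longrightarrow> homog d (single 0 c * p)" using homog_mult[OF homog_const, of d p c] by simp
lemma homog_of_nat_mult: "homog d p \<Longrightarrow> homog d (of_nat n * p)"
  using homog_const_mult[of d p "of_nat n"] by simp

lemma homog_lookup_0: "homog d p \<Longrightarrow> d > 0 \<Longrightarrow> lookup p 0 = 0"
  unfolding homog_def by (metis in_keys_iff less_irrefl weight_0)

lemma weight_ge: "k \<in> keys m \<Longrightarrow> k \<le> weight m"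
proof -
  assume k: "k \<in> keys m"
  then have "k \<le> k * lookup m k" by (simp add: in_keys_iff)
  also have "\<dots> \<le> weight m" unfolding weight_def using k by (intro member_le_sum) auto
  finally show ?thesis .
qed

lemma homog_pvars: "homog d p \<Longrightarrow> pvars p \<subseteq> {1..d}"
proof
  fix k assume a: "homog d p" "k \<in> pvars p"
  then obtain m where m: "m \<in> keys p" "k \<in> keys m" by (auto simp: pvars_def)
  with a have "weight m = d" "0 \<notin> keys m" by (auto simp: homog_def)
  with m weight_ge[of k m] show "k \<in> {1..d}" by (cases k) auto
qed

text \<open>An iterated derivative at the origin is a multiple of one coefficient, that of the
  product of the listed variables, and this product has weight \<open>sum_list ks\<close>.\<close>

lemma homog_pdiffs: "homog d p \<Longrightarrow> pdiffs_at_0 ks p \<noteq> 0 \<Longrightarrow> sum_list ks = d"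
proof -
  assume a: "homog d p" "pdiffs_at_0 ks p \<noteq> 0"
  obtain c where "lookup (foldr pdiff ks p) 0 = of_nat c * lookup p (0 + (\<Sum>k\<leftarrow>ks. single k 1))"
    using lookup_foldr_pdiff by blast
  with a(2) have "(\<Sum>k\<leftarrow>ks. single k 1) \<in> keys p" by (auto simp: pdiffs_at_0_def in_keys_iff)
  with a(1) have "weight (\<Sum>k\<leftarrow>ks. single k 1) = d" by (auto simp: homog_def)
  then show ?thesis by (simp only: weight_sum_list)
qed


lemma homog_tdeg: "homog d p \<Longrightarrow> m \<in> keys p \<Longrightarrow> tdeg m \<le> d"
proof -
  assume a: "homog d p" "m \<in> keys p"
  have "tdeg m \<le> weight m" unfolding tdeg_def weight_def
  proof (rule sum_mono)
    fix k assume "k \<in> keys m"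
    then have "k > 0" using a by (auto simp: homog_def intro: gr0I)
    then show "lookup m k \<le> k * lookup m k" by simp
  qed
  with a show ?thesis by (auto simp: homog_def)
qed

lemma pdiffs_at_0_0: "pdiffs_at_0 ks 0 = 0"
proof -
  have "foldr pdiff ks 0 = 0" by (induction ks) simp_all
  then show ?thesis by (simp add: pdiffs_at_0_def)
qed

section \<open>Taylor expansion at the origin over ordered tuples\<close>

context rat_hom
begin

definition taylor_term :: "(nat \<Rightarrow> 'b) \<Rightarrow> nat set \<Rightarrow> nat \<Rightarrow> qpoly \<Rightarrow> 'b" where
  "taylor_term P A j p = (\<Sum>ks | set ks \<subseteq> A \<and> length ks = j. \<phi> (pdiffs_at_0 ks p) * prod_list (map P ks))"

lemma taylor_term_Suc:
  assumes "finite A"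
  shows "taylor_term P A (Suc j) p = (\<Sum>k\<in>A. P k * taylor_term P A j (pdiff k p))"
proof -
  have "taylor_term P A (Suc j) p = (\<Sum>(k, ks) \<in> A \<times> {ks. set ks \<subseteq> A \<and> length ks = j}.
      P k * (\<phi> (pdiffs_at_0 ks (pdiff k p)) * prod_list (map P ks)))"
    unfolding taylor_term_def
    by (rule sum.reindex_bij_witness[of _ "\<lambda>(k, ks). k # ks" "\<lambda>ks. (hd ks, tl ks)"])
       (auto simp: length_Suc_conv pdiffs_at_0_def foldr_pdiff_commute mult_ac)
  also have "\<dots> = (\<Sum>k\<in>A. P k * taylor_term P A j (pdiff k p))"
    using assms finite_lists_length_eq[OF assms]
    by (simp add: sum.cartesian_product[symmetric] taylor_term_def sum_distrib_left)
  finally show ?thesis .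
qed

lemma pdiff_single: "pdiff i (single m c) = single (m - single i 1) (of_nat (lookup m i) * c)"
  by (cases "c = 0") (simp_all add: pdiff_def)

text \<open>Euler's formula, applied to the first entry of the tuple: the sum over k of P_k times
  the k-th derivative multiplies a monomial of degree j + 1 by j + 1. Since tuples are ordered, a
  factor j! accumulates; it is cancelled by the 1/m! in the coefficients of the system.\<close>

lemma taylor_term_single:
  assumes "finite A" "keys m \<subseteq> A"
  shows "taylor_term P A j (single m c) = (if tdeg m = j then of_nat (fact j) * (\<phi> c * monom P m) else 0)"
  using assms(2)
proof (induction j arbitrary: m c)
  case 0
  have "{ks. set ks \<subseteq> A \<and> ks = []} = {[]}" by auto
  then show ?case by (auto simp: taylor_term_def pdiffs_at_0_def tdeg_0_iff lookup_single zero)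
next
  case (Suc j)
  have "P k * taylor_term P A j (pdiff k (single m c)) =
      (if tdeg m = Suc j then of_nat (fact j) * (of_nat (lookup m k) * (\<phi> c * monom P m)) else 0)" for k
  proof (cases "lookup m k = 0")
    case True
    then show ?thesis by (simp add: pdiff_single taylor_term_def zero pdiffs_at_0_0)
  next
    case False
    then have pos: "lookup m k > 0" by simp
    have "keys (m - single k 1) \<subseteq> A" using Suc.prems by (auto simp: in_keys_iff lookup_minus)
    moreover have "monom P m = monom P (m - single k 1) * P k"
      using monom_add[of P "m - single k 1" "single k 1"] minus_single_add[OF pos] by simp
    ultimately show ?thesis
      unfolding pdiff_single using Suc.IH[of "m - single k 1" "of_nat (lookup m k) * c"] tdeg_minus[OF pos]
      by (auto simp: mult of_nat algebra_simps)
  qed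
  then have "taylor_term P A (Suc j) (single m c) =
      (if tdeg m = Suc j then of_nat (fact j) * (of_nat (\<Sum>k\<in>A. lookup m k) * (\<phi> c * monom P m)) else 0)"
    unfolding taylor_term_Suc[OF assms(1)] by (simp add: sum_distrib_left sum_distrib_right)
  also have "(\<Sum>k\<in>A. lookup m k) = tdeg m" using tdeg_superset[OF assms(1) Suc.prems] by simp
  finally show ?case by (auto simp: algebra_simps)
qed

lemma taylor_term_add: "taylor_term P A j (p + q) = taylor_term P A j p + taylor_term P A j q"
proof -
  have "foldr pdiff ks (p + q) = foldr pdiff ks p + foldr pdiff ks q" for ks
    by (induction ks) (simp_all add: pdiff_add)
  then show ?thesis
    by (simp add: taylor_term_def pdiffs_at_0_def lookup_add add distrib_right sum.distrib)
qed

lemma taylor: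
  assumes "finite A" "pvars p \<subseteq> A" "\<And>m. m \<in> keys p \<Longrightarrow> tdeg m \<le> L"
  shows "(\<Sum>j\<le>L. \<phi> (1 / fact j) * taylor_term P A j p) = peval \<phi> P p"
proof -
  have "(\<Sum>j\<le>L. \<phi> (1 / fact j) * taylor_term P A j (single m c)) = \<phi> c * monom P m"
    if "m \<in> keys p" for m c
  proof -
    have "keys m \<subseteq> A" using assms(2) that by (auto simp: pvars_def)
    then have "(\<Sum>j\<le>L. \<phi> (1 / fact j) * taylor_term P A j (single m c)) =
        (\<Sum>j\<le>L. if tdeg m = j then \<phi> (1 / fact j) * (\<phi> (of_nat (fact j)) * (\<phi> c * monom P m)) else 0)"
      by (intro sum.cong) (simp_all add: taylor_term_single[OF assms(1)] of_nat del: of_nat_fact)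
    also have "\<dots> = \<phi> (1 / fact (tdeg m)) * (\<phi> (of_nat (fact (tdeg m))) * (\<phi> c * monom P m))"
      using assms(3)[OF that] by simp
    also have "\<dots> = \<phi> (1 / fact (tdeg m) * fact (tdeg m)) * (\<phi> c * monom P m)"
      by (simp only: mult mult.assoc of_nat_fact)
    finally show ?thesis by (simp add: one)
  qed
  note s = this
  have t: "taylor_term P A j (\<Sum>m\<in>M. f m) = (\<Sum>m\<in>M. taylor_term P A j (f m))"
    for j M and f :: "(nat \<Rightarrow>\<^sub>0 nat) \<Rightarrow> qpoly"
    by (rule additive_sum) (rule taylor_term_add)
  have "(\<Sum>j\<le>L. \<phi> (1 / fact j) * taylor_term P A j p) =
      (\<Sum>j\<le>L. \<phi> (1 / fact j) * taylor_term P A j (\<Sum>m\<in>keys p. single m (lookup p m)))"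
    by (simp add: sum_singles)
  also have "\<dots> = (\<Sum>m\<in>keys p. \<Sum>j\<le>L. \<phi> (1 / fact j) * taylor_term P A j (single m (lookup p m)))"
    unfolding t sum_distrib_left by (rule sum.swap)
  also have "\<dots> = peval \<phi> P p" unfolding peval_def by (rule sum.cong) (simp_all add: s)
  finally show ?thesis .
qed

text \<open>Weight d bounds the entries and the length of every tuple with nonzero coefficient by d,
  so the sum is finite. The empty tuple, absent from \<open>index_tuples\<close>, would contribute
  p(0), which is 0 because d > 0.\<close>

lemma taylor_homog:
  assumes p: "homog d p" "d > 0"
    and r: "\<And>ks. ks \<in> index_tuples \<Longrightarrow> r ks = 1 / fact (length ks) * pdiffs_at_0 ks p"
  shows "(\<Sum>ks | ks \<in> index_tuples \<and> r ks \<noteq> 0. \<phi> (r ks) * prod_list (map P ks)) = peval \<phi> P p"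
proof -
  let ?L = "\<lambda>j. {ks. set ks \<subseteq> {1..d} \<and> length ks = j}"
  let ?t = "\<lambda>ks. \<phi> (1 / fact (length ks) * pdiffs_at_0 ks p) * prod_list (map P ks)"
  have fin: "finite (?L j)" for j by (rule finite_lists_length_eq) simp
  have "peval \<phi> P p = (\<Sum>j\<le>d. \<phi> (1 / fact j) * taylor_term P {1..d} j p)"
    using taylor[of "{1..d}" p d P] homog_pvars[OF p(1)] homog_tdeg[OF p(1)] by simp
  also have "\<dots> = (\<Sum>j\<le>d. \<Sum>ks\<in>?L j. ?t ks)"
    unfolding taylor_term_def sum_distrib_left
    by (intro sum.cong refl) (simp only: mem_Collect_eq mult mult.assoc)
  also have "\<dots> = (\<Sum>ks\<in>(\<Union>j\<le>d. ?L j). ?t ks)"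
    by (subst sum.UNION_disjoint) (use fin in auto)
  also have "\<dots> = (\<Sum>ks | ks \<in> index_tuples \<and> r ks \<noteq> 0. ?t ks)"
  proof (rule sum.mono_neutral_right)
    show "finite (\<Union>j\<le>d. ?L j)" using fin by simp
    show "{ks \<in> index_tuples. r ks \<noteq> 0} \<subseteq> (\<Union>j\<le>d. ?L j)"
    proof
      fix ks assume ks: "ks \<in> {ks \<in> index_tuples. r ks \<noteq> 0}"
      then have s: "sum_list ks = d" using r homog_pdiffs[OF p(1)] by auto
      have pos: "\<forall>k\<in>set ks. 1 \<le> k" using ks by (auto simp: index_tuples_def)
      have "k \<le> d" if "k \<in> set ks" for k using member_le_sum_list[OF that] s by simp
      moreover have "length ks \<le> sum_list ks"
        using pos by (induction ks) force+
      ultimately show "ks \<in> (\<Union>j\<le>d. ?L j)" using s pos by auto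
    qed
    show "\<forall>ks\<in>(\<Union>j\<le>d. ?L j) - {ks \<in> index_tuples. r ks \<noteq> 0}. ?t ks = 0"
    proof
      fix ks assume ks: "ks \<in> (\<Union>j\<le>d. ?L j) - {ks \<in> index_tuples. r ks \<noteq> 0}"
      show "?t ks = 0"
      proof (cases "ks \<in> index_tuples")
        case True
        then have "1 / fact (length ks) * pdiffs_at_0 ks p = 0" using ks r[OF True] by auto
        then show ?thesis by (simp only: zero mult_zero_left)
      next
        case False
        with ks have "ks = []" by (auto simp: index_tuples_def)
        then show ?thesis using homog_lookup_0[OF p] by (simp add: pdiffs_at_0_def zero)
      qed
    qed
  qed
  also have "\<dots> = (\<Sum>ks | ks \<in> index_tuples \<and> r ks \<noteq> 0. \<phi> (r ks) * prod_list (map P ks))"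
    by (intro sum.cong) (auto simp: r)
  finally show ?thesis by simp
qed

end

section \<open>Universal polynomials and their grading\<close>

definition homog_fps :: "nat \<Rightarrow> qpoly fps \<Rightarrow> bool" where
  "homog_fps s A \<longleftrightarrow> (\<forall>i. homog (i + s) (A $ i))"

lemma homog_fps_add: "homog_fps s A \<Longrightarrow> homog_fps s B \<Longrightarrow> homog_fps s (A + B)" by (simp add: homog_fps_def homog_add)
lemma homog_fps_diff: "homog_fps s A \<Longrightarrow> homog_fps s B \<Longrightarrow> homog_fps s (A - B)" by (simp add: homog_fps_def homog_diff)
lemma homog_fps_uminus: "homog_fps s A \<Longrightarrow> homog_fps s (- A)" by (simp add: homog_fps_def homog_uminus)
lemma homog_fps_0: "homog_fps s 0" by (simp add: homog_fps_def)
lemma homog_fps_sum: "(\<And>i. i \<in> I \<Longrightarrow> homog_fps s (f i)) \<Longrightarrow> homog_fps s (sum f I)"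
  by (induction I rule: infinite_finite_induct) (auto intro: homog_fps_add homog_fps_0)
lemma homog_fps_X: "homog_fps (Suc s) A \<Longrightarrow> homog_fps s (fps_X * A)"
proof -
  assume a: "homog_fps (Suc s) A"
  have "homog (i + s) ((fps_X * A) $ i)" for i
    using a[unfolded homog_fps_def, rule_format, of "i - 1"] by (cases i) simp_all
  then show ?thesis by (simp add: homog_fps_def)
qed
lemma homog_fps_mult: "homog_fps s A \<Longrightarrow> homog_fps t B \<Longrightarrow> homog_fps (s + t) (A * B)"
proof -
  assume a: "homog_fps s A" "homog_fps t B"
  have "homog (n + (s + t)) (A $ i * B $ (n - i))" if "i \<le> n" for i n
  proof -
    have "n + (s + t) = (i + s) + ((n - i) + t)" using that by simp
    with a show ?thesis by (metis homog_mult homog_fps_def)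
  qed
  then show ?thesis unfolding homog_fps_def fps_mult_nth by (auto intro!: homog_sum)
qed

text \<open>The generic series, with y_n = \<open>pvar n\<close>. The sign is that of p = z -
  \<partial>_1 D(z) f, so that y_\<gamma> specialises to \<partial>_1\<partial>_\<gamma> f.\<close>

definition q_univ :: "qpoly fps" where
  "q_univ = Abs_fps (\<lambda>n. if n = 0 then 1 else - pvar n)"

lemma q_univ_0 [simp]: "q_univ $ 0 = 1" by (simp add: q_univ_def)

lemma homog_fps_q_univ: "homog_fps 0 q_univ"
  unfolding homog_fps_def q_univ_def by (auto intro: homog_uminus homog_pvar homog_1)

lemma homog_fps_dp_dz: "homog_fps 0 q \<Longrightarrow> homog_fps 0 (dp_dz q)"
proof -
  assume a: "homog_fps 0 q"
  have "dp_dz q $ n = q $ n - of_nat (2 * n) * q $ n" for n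
    by (simp add: dp_dz_def mult.assoc numeral_mult_fps_nth X_deriv_nth)
  then show ?thesis
    using a unfolding homog_fps_def by (simp only:) (blast intro: homog_diff homog_of_nat_mult)
qed

lemma homog_fps_power2: "homog_fps 0 q \<Longrightarrow> homog_fps 0 (q ^ 2)"
  using homog_fps_mult[of 0 q 0 q] by (simp add: power2_eq_square)

lemma homog_fps_divdiff: "homog_fps 0 b \<Longrightarrow> homog_fps (Suc n) (divdiff b $ n)"
  unfolding homog_fps_def divdiff_def by (simp add: add.commute add.left_commute)

lemma homog_fps_divdiff2: "homog_fps 0 b \<Longrightarrow> homog_fps (Suc (Suc n)) (divdiff2 b $ n)"
proof -
  assume a: "homog_fps 0 b"
  have "homog (m + Suc (Suc n)) (divdiff2 b $ n $ m)" for m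
  proof -
    have "homog (m + n + 2) (b $ (m + n + 2))" using a by (simp add: homog_fps_def)
    then have "homog (m + n + 2) (of_nat (m + 1) * b $ (m + n + 2))" by (rule homog_of_nat_mult)
    then show ?thesis by (simp add: divdiff2_def)
  qed
  then show ?thesis by (simp add: homog_fps_def)
qed

lemma homog_fps_sq_quot: "homog_fps 0 q \<Longrightarrow> homog_fps n (sq_quot q $ n)"
  unfolding sq_quot_def by (auto simp: homog_fps_0 intro!: homog_fps_diff homog_fps_uminus homog_fps_X homog_fps_divdiff homog_fps_power2)

text \<open>Since \<open>sq_quot q\<close> starts with 1, its product with \<open>grunsky q\<close>
  is a recursion over the rows whose terms all have the same weight. The coefficient of x^m y^n ends
  up with weight m + n + 1.\<close>

lemma homog_fps_grunsky:
  assumes "homog_fps 0 q" "q $ 0 = 1"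
  shows "homog_fps (Suc n) (grunsky q $ n)"
proof (induction n rule: less_induct)
  case (less n)
  have "(sq_quot q * grunsky q) $ n = grunsky q $ n + (\<Sum>i=1..n. sq_quot q $ i * grunsky q $ (n - i))"
    using sq_quot_0[OF assms(2)] by (simp add: fps_mult_nth sum.atLeast_Suc_atMost)
  then have "grunsky q $ n = (sq_quot q * grunsky q) $ n - (\<Sum>i=1..n. sq_quot q $ i * grunsky q $ (n - i))" by simp
  also have "(sq_quot q * grunsky q) $ n = - (dp_dz q * divdiff q $ n + fps_X * divdiff2 (q ^ 2) $ n)"
    unfolding sq_quot_grunsky[OF assms(2)] by (simp add: in_z1_def)
  finally have e: "grunsky q $ n = - (dp_dz q * divdiff q $ n + fps_X * divdiff2 (q ^ 2) $ n) - (\<Sum>i=1..n. sq_quot q $ i * grunsky q $ (n - i))" .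
  have "homog_fps (Suc n) (sq_quot q $ i * grunsky q $ (n - i))" if "i \<in> {1..n}" for i
    using homog_fps_mult[OF homog_fps_sq_quot[OF assms(1), of i] less.IH[of "n - i"]] that by simp
  moreover have "homog_fps (Suc n) (dp_dz q * divdiff q $ n)"
    using homog_fps_mult[OF homog_fps_dp_dz[OF assms(1)] homog_fps_divdiff[OF assms(1), of n]] by simp
  ultimately show ?case unfolding e
    by (intro homog_fps_diff homog_fps_uminus homog_fps_add homog_fps_X homog_fps_divdiff2 homog_fps_power2 assms homog_fps_sum)
qed

lemma homog_recip:
  assumes "homog_fps 0 q" "q $ 0 = 1"
  shows "homog n (recip q $ n)"
proof (induction n rule: less_induct)
  case (less n)
  have "homog n ((q ^ 2) $ i * recip q $ (n - i))" if "i \<in> {1..n}" for i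
    using homog_mult[of i "(q ^ 2) $ i" "n - i"] less.IH[of "n - i"] homog_fps_power2[OF assms(1)] that
    by (simp add: homog_fps_def)
  moreover have "homog n (q $ n)" using assms(1) by (simp add: homog_fps_def)
  ultimately show ?case unfolding recip_recurrence[OF assms(2), of n] by (intro homog_diff homog_sum)
qed

text \<open>\<open>hess_poly \<alpha> \<beta>\<close> expresses \<open>\<partial>\<^sub>\<alpha>\<partial>\<^sub>\<beta>f\<close> through the variables \<open>y\<^sub>\<gamma> = \<partial>\<^sub>1\<partial>\<^sub>\<gamma>f\<close>.\<close>

definition hess_poly :: "nat \<Rightarrow> nat \<Rightarrow> qpoly" where
  "hess_poly \<alpha> \<beta> = single 0 (1 / of_nat (2 * \<alpha> - 1)) * grunsky q_univ $ (\<beta> - 1) $ (\<alpha> - 1)"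

lemma homog_hess_poly: "\<alpha> \<ge> 1 \<Longrightarrow> \<beta> \<ge> 1 \<Longrightarrow> homog (\<alpha> + \<beta> - 1) (hess_poly \<alpha> \<beta>)"
proof -
  assume a: "\<alpha> \<ge> 1" "\<beta> \<ge> 1"
  have "homog (\<alpha> - 1 + Suc (\<beta> - 1)) (grunsky q_univ $ (\<beta> - 1) $ (\<alpha> - 1))"
    using homog_fps_grunsky[OF homog_fps_q_univ q_univ_0, of "\<beta> - 1"] unfolding homog_fps_def by blast
  then show ?thesis unfolding hess_poly_def using a by (intro homog_const_mult) simp
qed

lemma of_nat_mult_hess_poly: "\<alpha> \<ge> 1 \<Longrightarrow> of_nat (2 * \<alpha> - 1) * hess_poly \<alpha> \<beta> = grunsky q_univ $ (\<beta> - 1) $ (\<alpha> - 1)"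
proof -
  assume "\<alpha> \<ge> 1"
  then have n: "of_nat (2 * \<alpha> - 1) \<noteq> (0 :: rat)" by simp
  have "of_nat (2 * \<alpha> - 1) * hess_poly \<alpha> \<beta> = single 0 (of_nat (2 * \<alpha> - 1)) * single 0 (1 / of_nat (2 * \<alpha> - 1)) * grunsky q_univ $ (\<beta> - 1) $ (\<alpha> - 1)"
    unfolding hess_poly_def single_of_nat by (simp only: mult.assoc)
  also have "single 0 (of_nat (2 * \<alpha> - 1)) * single 0 (1 / of_nat (2 * \<alpha> - 1)) = (1 :: qpoly)"
    using n by (simp add: mult_single del: single_of_nat)
  finally show ?thesis by simp
qed

text \<open>The normalising factor 1/(2\<alpha> - 1) turns the twisted symmetry
  \<open>grunsky_symmetric\<close> into a genuine one. It makes the gradient of the potential a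
  closed form.\<close>

lemma hess_poly_commute: "\<alpha> \<ge> 1 \<Longrightarrow> \<beta> \<ge> 1 \<Longrightarrow> hess_poly \<alpha> \<beta> = hess_poly \<beta> \<alpha>"
proof -
  assume a: "\<alpha> \<ge> 1" "\<beta> \<ge> 1"
  have s: "2 * (\<alpha> - 1) + 1 = 2 * \<alpha> - 1" "2 * (\<beta> - 1) + 1 = 2 * \<beta> - 1" using a by auto
  have "of_nat (2 * \<beta> - 1) * (of_nat (2 * \<alpha> - 1) * hess_poly \<alpha> \<beta>) = of_nat (2 * \<beta> - 1) * grunsky q_univ $ (\<beta> - 1) $ (\<alpha> - 1)"
    using of_nat_mult_hess_poly[OF a(1)] by simp
  also have "\<dots> = of_nat (2 * \<alpha> - 1) * grunsky q_univ $ (\<alpha> - 1) $ (\<beta> - 1)"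
    using grunsky_symmetric[OF q_univ_0, of "\<beta> - 1" "\<alpha> - 1"] unfolding s .
  also have "\<dots> = of_nat (2 * \<alpha> - 1) * (of_nat (2 * \<beta> - 1) * hess_poly \<beta> \<alpha>)"
    using of_nat_mult_hess_poly[OF a(2)] by simp
  finally have "(of_nat (2 * \<beta> - 1) * of_nat (2 * \<alpha> - 1)) * (hess_poly \<alpha> \<beta> - hess_poly \<beta> \<alpha>) = 0"
    by (simp add: algebra_simps)
  moreover have "(of_nat (2 * \<beta> - 1) :: qpoly) \<noteq> 0" "(of_nat (2 * \<alpha> - 1) :: qpoly) \<noteq> 0"
    using a by (simp_all del: of_nat_diff)
  ultimately show ?thesis by simp
qed

section \<open>Lagrange inversion for the superpotential\<close>

definition DN_weight :: "nat \<Rightarrow> (nat \<Rightarrow>\<^sub>0 nat) \<Rightarrow> nat" where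
  "DN_weight N a = (\<Sum>k=1..<N. (N - k) * lookup a k)"

lemma DN_weight_add: "DN_weight N (a + b) = DN_weight N a + DN_weight N b"
  by (simp add: DN_weight_def lookup_add sum.distrib distrib_left)

lemma DN_weight_single: "k \<in> {1..<N} \<Longrightarrow> DN_weight N (single k 1) = N - k"
proof -
  assume k: "k \<in> {1..<N}"
  have "DN_weight N (single k 1) = (\<Sum>j=1..<N. if j = k then N - k else 0)"
    unfolding DN_weight_def by (rule sum.cong) (auto simp: lookup_single when_def)
  with k show ?thesis by simp
qed

lemma DN_exponents_iff: "a \<in> DN_exponents N d \<longleftrightarrow> keys a \<subseteq> {1..<N} \<and> DN_weight N a = d"
  by (simp add: DN_exponents_def DN_weight_def)

lemma exp_size_tdeg: "keys a \<subseteq> {1..<N} \<Longrightarrow> exp_size N a = tdeg a"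
  by (simp add: exp_size_def tdeg_superset[of "{1..<N}"])

lemma DN_weight_ge: "k \<in> keys a \<Longrightarrow> k \<in> {1..<N} \<Longrightarrow> (N - k) * lookup a k \<le> DN_weight N a"
  unfolding DN_weight_def by (rule member_le_sum) auto

lemma mult_le_self: "0 < m \<Longrightarrow> n \<le> m * (n :: nat)" by simp

lemma finite_DN_exponents: "finite (DN_exponents N d)"
proof -
  let ?m = "\<Sum>k=1..<N. single k d"
  have "DN_exponents N d \<subseteq> fst ` {(a, b). a + b = ?m}"
  proof
    fix a assume a: "a \<in> DN_exponents N d"
    have m: "lookup ?m k = (if k \<in> {1..<N} then d else 0)" for k
      by (simp add: lookup_sum lookup_single when_def)
    have "lookup a k \<le> lookup ?m k" for k
    proof (cases "k \<in> keys a")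
      case True
      then have "k \<in> {1..<N}" using a by (auto simp: DN_exponents_iff)
      moreover have "lookup a k \<le> (N - k) * lookup a k"
        by (rule mult_le_self) (use \<open>k \<in> {1..<N}\<close> in auto)
      moreover have "(N - k) * lookup a k \<le> d" using DN_weight_ge[OF True \<open>k \<in> {1..<N}\<close>] a by (auto simp: DN_exponents_iff)
      ultimately have "lookup a k \<le> d" by linarith
      then show ?thesis using m \<open>k \<in> {1..<N}\<close> by simp
    qed (simp add: in_keys_iff)
    then have "a + (?m - a) = ?m" by (intro poly_mapping_eqI) (simp add: lookup_add lookup_minus)
    then show "a \<in> fst ` {(a, b). a + b = ?m}" by (auto simp: image_iff)
  qed
  then show ?thesis by (rule finite_subset) simp
qed

lemma lookup_sum_single:
  "finite S \<Longrightarrow> lookup (\<Sum>a\<in>S. single a (f a)) b = (if b \<in> S then f b else 0)"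
  by (simp add: lookup_sum lookup_single when_def)

lemma DN_weight_le_tdeg: "keys a \<subseteq> {1..<N} \<Longrightarrow> DN_weight N a \<le> (N - 1) * exp_size N a"
  unfolding DN_weight_def exp_size_def sum_distrib_left by (intro sum_mono mult_le_mono1) auto

lemma exp_size_le_DN_weight: "exp_size N a \<le> DN_weight N a"
  unfolding DN_weight_def exp_size_def
proof (rule sum_mono)
  fix k assume "k \<in> {1..<N}"
  then show "lookup a k \<le> (N - k) * lookup a k" by (intro mult_le_self) auto
qed

text \<open>With x = p^-2, the superpotential is p^(2N-2) (1 + (2N - 2)
  \<open>superpot_tail N\<close>).\<close>

definition superpot_tail :: "nat \<Rightarrow> qpoly fps" where
  "superpot_tail N = (\<Sum>k=1..<N. fps_const (pvar k) * fps_X ^ (N - k))"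

text \<open>The multinomial theorem. Splitting one factor v_k off the monomial \<open>a\<close>
  yields the weight \<open>lookup a k\<close>, and these weights add up to the size n + 1.\<close>

lemma superpot_tail_power_nth:
  "lookup (superpot_tail N ^ n $ d) a = (if a \<in> DN_exponents N d \<and> exp_size N a = n then fact n / exp_fact N a else 0)"
proof (induction n arbitrary: d a)
  case 0
  have "a \<in> DN_exponents N d \<and> exp_size N a = 0 \<longleftrightarrow> a = 0 \<and> d = 0"
  proof
    assume h: "a \<in> DN_exponents N d \<and> exp_size N a = 0"
    then have "a = 0" using exp_size_tdeg[of a N] by (simp add: DN_exponents_iff tdeg_0_iff)
    with h show "a = 0 \<and> d = 0" by (simp add: DN_exponents_iff DN_weight_def)
  qed (simp add: DN_exponents_iff DN_weight_def exp_size_def)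
  then show ?case by (auto simp: fps_one_nth exp_fact_def lookup_one when_def)
next
  case (Suc n)
  have red: "a \<in> DN_exponents N d \<and> exp_size N a = Suc n \<longleftrightarrow>
      N - k \<le> d \<and> a - single k 1 \<in> DN_exponents N (d - (N - k)) \<and> exp_size N (a - single k 1) = n"
    if k: "k \<in> {1..<N}" "lookup a k \<noteq> 0" for k
  proof -
    let ?b = "a - single k 1"
    have a: "a = ?b + single k 1" using minus_single_add[of a k] k by simp
    have "DN_weight N a = DN_weight N ?b + (N - k)"
      by (subst (1) a) (simp only: DN_weight_add DN_weight_single[OF k(1)])
    moreover have "keys a = keys ?b \<union> {k}"
      by (subst (1) a) (simp add: keys_add_nat)
    moreover have "tdeg a = Suc (tdeg ?b)" using tdeg_minus[of a k] k by simp
    ultimately show ?thesis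
      using k(1) exp_size_tdeg[of a N] exp_size_tdeg[of ?b N] by (auto simp: DN_exponents_iff)
  qed
  have fct: "fact n / exp_fact N (a - single k 1) = of_nat (lookup a k) * (fact n / exp_fact N a)"
    if k: "k \<in> {1..<N}" "lookup a k \<noteq> 0" for k
  proof -
    let ?b = "a - single k 1"
    have "exp_fact N a = fact (lookup a k) * (\<Prod>j\<in>{1..<N} - {k}. fact (lookup a j))"
      unfolding exp_fact_def using k(1) by (intro prod.remove) auto
    also have "(\<Prod>j\<in>{1..<N} - {k}. fact (lookup a j)) = (\<Prod>j\<in>{1..<N} - {k}. fact (lookup ?b j) :: rat)"
      by (rule prod.cong) (auto simp: lookup_minus lookup_single when_def)
    also have "fact (lookup a k) = (of_nat (lookup a k) * fact (lookup ?b k) :: rat)"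
      using k(2) by (simp add: lookup_minus fact_reduce)
    finally have "exp_fact N a = of_nat (lookup a k) * exp_fact N ?b"
      unfolding exp_fact_def using k(1) by (subst (2) prod.remove[of _ k]) auto
    then show ?thesis using k(2) by simp
  qed
  have "lookup (superpot_tail N ^ Suc n $ d) a = (\<Sum>k=1..<N. lookup ((fps_const (pvar k) * fps_X ^ (N - k) * superpot_tail N ^ n) $ d) a)"
    by (simp add: superpot_tail_def sum_distrib_right fps_sum_nth lookup_sum)
  also have "\<dots> = (\<Sum>k=1..<N. if a \<in> DN_exponents N d \<and> exp_size N a = Suc n then of_nat (lookup a k) * (fact n / exp_fact N a) else 0)"
  proof (rule sum.cong)
    fix k assume k: "k \<in> {1..<N}"
    have "lookup ((fps_const (pvar k) * fps_X ^ (N - k) * superpot_tail N ^ n) $ d) a =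
        (if N - k \<le> d then lookup (superpot_tail N ^ n $ (d - (N - k)) * pvar k) a else 0)"
      by (simp add: mult.assoc fps_X_power_mult_nth) (simp add: mult.commute)
    also have "\<dots> = (if a \<in> DN_exponents N d \<and> exp_size N a = Suc n then of_nat (lookup a k) * (fact n / exp_fact N a) else 0)"
    proof (cases "lookup a k = 0")
      case True
      then show ?thesis by (simp add: lookup_mult_pvar)
    next
      case False
      then show ?thesis unfolding lookup_mult_pvar Suc.IH red[OF k False]
        using fct[OF k False] by (auto simp del: One_nat_def)
    qed
    finally show "lookup ((fps_const (pvar k) * fps_X ^ (N - k) * superpot_tail N ^ n) $ d) a = \<dots>" .
  qed simp
  also have "\<dots> = (if a \<in> DN_exponents N d \<and> exp_size N a = Suc n then fact (Suc n) / exp_fact N a else 0)"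
    by (auto simp: exp_size_def sum_distrib_right simp flip: sum_divide_distrib sum_distrib_right of_nat_sum)
  finally show ?case .
qed

text \<open>The power (1 + (2N - 2) \<open>superpot_tail N\<close>)^r for rational r, by Newton's
  binomial series.\<close>

definition binom_series :: "nat \<Rightarrow> rat \<Rightarrow> qpoly fps" where
  "binom_series N r = Abs_fps (\<lambda>n. single 0 ((r gchoose n) * (2 * of_nat N - 2) ^ n)) oo superpot_tail N"

lemma superpot_tail_0: "superpot_tail N $ 0 = 0"
  by (simp add: superpot_tail_def fps_sum_nth)

lemma binom_series_add: "binom_series N (r + s) = binom_series N r * binom_series N s"
proof -
  let ?c = "2 * of_nat N - 2 :: rat"
  let ?B = "\<lambda>r. Abs_fps (\<lambda>n. single 0 ((r gchoose n) * ?c ^ n)) :: qpoly fps"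
  have "?B r * ?B s = ?B (r + s)"
  proof (rule fps_ext)
    fix n
    have "(?B r * ?B s) $ n = (\<Sum>i=0..n. single 0 (((r gchoose i) * (s gchoose (n - i))) * ?c ^ n))"
      unfolding fps_mult_nth
      by (rule sum.cong) (simp_all add: mult_single mult_ac flip: power_add)
    also have "\<dots> = single 0 ((\<Sum>i=0..n. (r gchoose i) * (s gchoose (n - i))) * ?c ^ n)"
      unfolding sub.hsum[symmetric] sum_distrib_right ..
    finally show "(?B r * ?B s) $ n = ?B (r + s) $ n" unfolding gbinomial_Vandermonde by simp
  qed
  then show ?thesis
    unfolding binom_series_def fps_compose_mult_distrib[OF superpot_tail_0, symmetric] by simp
qed

lemma binom_series_0: "binom_series N 0 = 1"
proof -
  have "Abs_fps (\<lambda>n. single 0 ((0 gchoose n) * (2 * of_nat N - 2) ^ n)) = (1 :: qpoly fps)"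
  proof (rule fps_ext)
    fix n
    have "(0 gchoose n) = (of_nat (0 choose n) :: rat)" by (simp add: binomial_gbinomial)
    then show "Abs_fps (\<lambda>n. single 0 ((0 gchoose n) * (2 * of_nat N - 2) ^ n)) $ n = (1 :: qpoly fps) $ n"
      by (cases n) simp_all
  qed
  then show ?thesis by (simp add: binom_series_def)
qed

lemma binom_series_power: "binom_series N r ^ n = binom_series N (of_nat n * r)"
  by (induction n) (simp_all add: binom_series_0 binom_series_add distrib_right)

lemma binom_series_1: "binom_series N 1 = 1 + fps_const (of_nat (2 * (N - 1))) * superpot_tail N" if "N \<ge> 1"
proof -
  have c: "single 0 (2 * of_nat N - 2 :: rat) = (of_nat (2 * (N - 1)) :: qpoly)"
  proof -
    have "2 * of_nat N - 2 = (of_nat (2 * (N - 1)) :: rat)" using that by (simp add: of_nat_diff algebra_simps)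
    then show ?thesis by (simp only: single_of_nat)
  qed
  have "Abs_fps (\<lambda>n. single 0 ((1 gchoose n) * (2 * of_nat N - 2 :: rat) ^ n)) = 1 + fps_const (of_nat (2 * (N - 1))) * (fps_X :: qpoly fps)"
  proof (rule fps_ext)
    fix n
    have "(1 gchoose n) = (if n \<le> 1 then 1 else 0 :: rat)"
      using binomial_gbinomial[of 1 n, where 'a = rat] by (auto simp: le_Suc_eq binomial_eq_0)
    then show "Abs_fps (\<lambda>n. single 0 ((1 gchoose n) * (2 * of_nat N - 2 :: rat) ^ n)) $ n = (1 + fps_const (of_nat (2 * (N - 1))) * (fps_X :: qpoly fps)) $ n"
      using c by (cases n) (auto simp: fps_X_def)
  qed
  then show ?thesis
    unfolding binom_series_def by (simp add: fps_compose_add_distrib fps_compose_mult_distrib[OF superpot_tail_0] superpot_tail_0)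
qed

lemma binom_series_nth_0: "binom_series N r $ 0 = 1"
  by (simp add: binom_series_def)

lemma lookup_binom_series_nth:
  assumes "N \<ge> 2"
  shows "lookup (binom_series N (of_nat m / (2 * of_nat N - 2)) $ d) a =
    (if a \<in> DN_exponents N d then (\<Prod>i<exp_size N a. of_nat m - of_nat i * (2 * of_nat N - 2)) / exp_fact N a else 0)"
proof -
  let ?c = "2 * of_nat N - 2 :: rat"
  let ?r = "of_nat m / ?c"
  have "of_nat N \<noteq> (1 :: rat)" using assms by simp
  then have c: "?c \<noteq> 0" by simp
  have "lookup (binom_series N ?r $ d) a = (\<Sum>n=0..d. ((?r gchoose n) * ?c ^ n) * lookup (superpot_tail N ^ n $ d) a)"
    by (simp add: binom_series_def fps_compose_nth lookup_sum lookup_const_mult)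
  also have "\<dots> = (\<Sum>n=0..d. if n = exp_size N a then (if a \<in> DN_exponents N d then ((?r gchoose n) * ?c ^ n) * (fact n / exp_fact N a) else 0) else 0)"
    by (rule sum.cong) (auto simp: superpot_tail_power_nth)
  also have "\<dots> = (if a \<in> DN_exponents N d then ((?r gchoose exp_size N a) * ?c ^ exp_size N a) * (fact (exp_size N a) / exp_fact N a) else 0)"
    using exp_size_le_DN_weight[of N a] by (auto simp: DN_exponents_iff)
  also have "((?r gchoose n) * ?c ^ n) * (fact n / exp_fact N a) = (\<Prod>i<n. of_nat m - of_nat i * ?c) / exp_fact N a" for n
  proof -
    have "fact n * (?r gchoose n) * ?c ^ n = (\<Prod>i<n. ?r - of_nat i) * (\<Prod>i<n. ?c)"
      unfolding gbinomial_mult_fact by (simp add: atLeast0LessThan)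
    also have "\<dots> = (\<Prod>i<n. of_nat m - of_nat i * ?c)"
      unfolding prod.distrib[symmetric] by (rule prod.cong) (use c in \<open>simp_all add: left_diff_distrib\<close>)
    finally show ?thesis by (simp add: mult_ac)
  qed
  finally show ?thesis .
qed

text \<open>This is z/p as a series in p^-2, the (2N - 2)-th root of the superpotential divided by
  p.\<close>

definition root_series :: "nat \<Rightarrow> qpoly fps" where
  "root_series N = binom_series N (1 / (2 * of_nat N - 2))"

lemma root_series_power: "root_series N ^ m = binom_series N (of_nat m / (2 * of_nat N - 2))"
  by (simp add: root_series_def binom_series_power)

text \<open>In the falling product for (2g - 1)/(2N - 2) the factor i = 0 is 2g - 1, and each later
  one is minus a factor of the product defining t_(N-g). Since g > 0, the empty monomial does not
  occur and the first factor is always present.\<close>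

lemma DN_t_of_v_root_series:
  assumes "N \<ge> 2" "1 \<le> g" "g < N"
  shows "of_nat (2 * g - 1) * DN_t_of_v N (N - g) = root_series N ^ (2 * g - 1) $ g"
proof (rule poly_mapping_eqI)
  fix a
  have "lookup (of_nat (2 * g - 1) * DN_t_of_v N (N - g)) a =
      of_nat (2 * g - 1) * (if a \<in> DN_exponents N g then ((-1) ^ (exp_size N a - 1) *
        (\<Prod>k<exp_size N a - 1. 2 * of_nat (N - g) - 1 + 2 * of_nat k * (of_nat N - 1)) / exp_fact N a) else 0)"
    unfolding DN_t_of_v_def single_of_nat[symmetric] lookup_const_mult
    using assms by (simp add: lookup_sum_single finite_DN_exponents)
  also have "\<dots> = (if a \<in> DN_exponents N g then (\<Prod>i<exp_size N a. of_nat (2 * g - 1) - of_nat i * (2 * of_nat N - 2)) / exp_fact N a else 0)"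
  proof (cases "a \<in> DN_exponents N g")
    case True
    then have "g \<le> (N - 1) * exp_size N a" using DN_weight_le_tdeg[of a N] by (auto simp: DN_exponents_iff)
    then have "exp_size N a \<noteq> 0" using assms by (metis mult_0_right not_one_le_zero le_zero_eq)
    then obtain n where n: "exp_size N a = Suc n" by (cases "exp_size N a") auto
    have "(\<Prod>k<n. of_nat (2 * g - 1) - of_nat (Suc k) * (2 * of_nat N - 2)) =
        (\<Prod>k<n. (-1) * (2 * of_nat (N - g) - 1 + 2 * of_nat k * (of_nat N - 1)) :: rat)"
      using assms by (intro prod.cong) (simp_all add: of_nat_diff algebra_simps)
    then show ?thesis using True unfolding n prod.lessThan_Suc_shift prod.distrib by simp
  qed simp
  finally show "lookup (of_nat (2 * g - 1) * DN_t_of_v N (N - g)) a = lookup (root_series N ^ (2 * g - 1) $ g) a"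
    unfolding root_series_power lookup_binom_series_nth[OF assms(1)] .
qed

text \<open>For g = N - 1 + \<alpha> two factors split off the falling product: 2g - 1 at i = 0, and
  2g - 1 - (2N - 2) = 2\<alpha> - 1 at i = 1. This explains why the product in the gradient is
  shorter by one than the one for t.\<close>

lemma DN_grad_v_root_series:
  assumes "N \<ge> 2" "1 \<le> \<alpha>"
  defines "g \<equiv> N - 1 + \<alpha>"
  shows "of_nat (2 * g - 1) * (of_nat (2 * \<alpha> - 1) * DN_grad_v N \<alpha>) = root_series N ^ (2 * g - 1) $ g"
proof (rule poly_mapping_eqI)
  fix a
  have "lookup (of_nat (2 * g - 1) * (of_nat (2 * \<alpha> - 1) * DN_grad_v N \<alpha>)) a =
      of_nat (2 * g - 1) * (of_nat (2 * \<alpha> - 1) * (if a \<in> DN_exponents N g then ((-1) ^ exp_size N a *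
        (\<Prod>k<exp_size N a - 2. 2 * (of_nat N - of_nat \<alpha>) - 1 + 2 * of_nat k * (of_nat N - 1)) / exp_fact N a) else 0))"
    unfolding DN_grad_v_def single_of_nat[symmetric] lookup_const_mult g_def
    by (simp add: lookup_sum_single finite_DN_exponents)
  also have "\<dots> = (if a \<in> DN_exponents N g then (\<Prod>i<exp_size N a. of_nat (2 * g - 1) - of_nat i * (2 * of_nat N - 2)) / exp_fact N a else 0)"
  proof (cases "a \<in> DN_exponents N g")
    case True
    \<comment> \<open>A single variable has weight at most N - 1 < g, so every monomial has size at
      least 2 and both factors exist.\<close>
    then have "(N - 1) * exp_size N a \<ge> N"
      using DN_weight_le_tdeg[of a N] assms by (auto simp: DN_exponents_iff)
    then have "exp_size N a \<noteq> 0" "exp_size N a \<noteq> 1"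
      using assms(1) by (metis mult_0_right le_zero_eq not_numeral_le_zero, fastforce)
    then obtain n where n: "exp_size N a = Suc (Suc n)" by (metis One_nat_def not0_implies_Suc)
    have "(\<Prod>k<n. of_nat (2 * g - 1) - of_nat (Suc (Suc k)) * (2 * of_nat N - 2)) =
        (\<Prod>k<n. (-1) * (2 * (of_nat N - of_nat \<alpha>) - 1 + 2 * of_nat k * (of_nat N - 1)) :: rat)"
      using assms by (intro prod.cong) (simp_all add: of_nat_diff algebra_simps)
    moreover have "of_nat (2 * g - 1) - (2 * of_nat N - 2) = (of_nat (2 * \<alpha> - 1) :: rat)"
      using assms by (simp add: of_nat_diff algebra_simps)
    ultimately show ?thesis using True unfolding n prod.lessThan_Suc_shift prod.distrib by (simp add: mult_ac)
  qed simp
  finally show "lookup (of_nat (2 * g - 1) * (of_nat (2 * \<alpha> - 1) * DN_grad_v N \<alpha>)) a = lookup (root_series N ^ (2 * g - 1) $ g) a"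
    unfolding root_series_power lookup_binom_series_nth[OF assms(1)] .
qed

section \<open>Lagrange inversion\<close>

lemma fps_compose_mult_nth:
  fixes A B :: "'a::comm_ring_1 fps"
  assumes "\<xi> $ 0 = 0"
  shows "((A oo \<xi>) * B) $ n = (\<Sum>i=0..n. A $ i * (\<xi> ^ i * B) $ n)"
proof -
  have x: "(A oo \<xi>) $ j = (\<Sum>i=0..n. A $ i * \<xi> ^ i $ j)" if "j \<le> n" for j
    unfolding fps_compose_nth
    by (rule sum.mono_neutral_left) (use that startsby_zero_power_prefix[OF assms] in auto)
  have "((A oo \<xi>) * B) $ n = (\<Sum>j=0..n. \<Sum>i=0..n. A $ i * (\<xi> ^ i $ j * B $ (n - j)))"
    unfolding fps_mult_nth by (rule sum.cong) (simp_all add: x sum_distrib_right mult.assoc)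
  also have "\<dots> = (\<Sum>i=0..n. \<Sum>j=0..n. A $ i * (\<xi> ^ i $ j * B $ (n - j)))" by (rule sum.swap)
  finally show ?thesis unfolding fps_mult_nth sum_distrib_left .
qed

lemma X_deriv_power:
  fixes W :: "'a::comm_ring_1 fps"
  shows "of_nat (Suc m) * (W ^ m * (fps_X * fps_deriv W)) $ n = of_nat n * W ^ Suc m $ n"
proof -
  have "of_nat (Suc m) * (W ^ m * (fps_X * fps_deriv W)) = fps_X * fps_deriv (W ^ Suc m)"
    by (simp only: fps_deriv_power diff_Suc_1 fps_of_nat) (simp only: mult_ac)
  then show ?thesis by (metis X_deriv_nth of_nat_mult_fps_nth)
qed

text \<open>A change of variables in a residue: with x = p^-2 and z = p W one has \<xi> = z^-2. For
  C the i-th power of the variable, \<xi>^i W^(2n) = x^i W^(2(n-i)), so only the coefficient of x^m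
  in G W^(2m) matters, where m = n - i and G = x \<xi>' / \<xi>.\<close>

lemma lagrange_coefficient:
  fixes W :: "'a::{idom,ring_char_0} fps"
  assumes W: "W $ 0 = 1" and Om: "W * \<Omega> = 1" and xi: "\<xi> = fps_X * \<Omega> ^ 2"
  shows "(W ^ (2 * n) * (fps_X * fps_deriv (C oo \<xi>))) $ n = of_nat n * C $ n"
proof -
  have xi0: "\<xi> $ 0 = 0" by (simp add: xi)
  define G where "G = 1 - 2 * (fps_X * fps_deriv W) * \<Omega>"
  have dOm: "fps_deriv \<Omega> = - (fps_deriv W * \<Omega>) * \<Omega>"
  proof -
    have "fps_deriv (W * \<Omega>) = 0" by (simp add: Om)
    then have "W * fps_deriv \<Omega> = - (fps_deriv W * \<Omega>)" by (simp add: eq_neg_iff_add_eq_0)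
    then have "\<Omega> * (W * fps_deriv \<Omega>) = - (fps_deriv W * \<Omega>) * \<Omega>" by (simp only: mult.commute)
    moreover have "\<Omega> * (W * fps_deriv \<Omega>) = (W * \<Omega>) * fps_deriv \<Omega>" by (simp only: mult_ac)
    ultimately show ?thesis using Om by simp
  qed
  have dxi: "fps_X * fps_deriv \<xi> = \<xi> * G"
    by (simp add: xi G_def power2_eq_square dOm algebra_simps)
  have "fps_X * fps_deriv (C oo \<xi>) = (fps_deriv C oo \<xi>) * (fps_X * fps_deriv \<xi>)"
    using fps_compose_deriv[OF xi0, of C] by (simp add: mult_ac)
  also have "\<dots> = ((fps_X * fps_deriv C) oo \<xi>) * G"
    unfolding dxi by (simp add: fps_compose_mult_distrib[OF xi0] xi0 mult_ac)
  finally have "(W ^ (2 * n) * (fps_X * fps_deriv (C oo \<xi>))) $ n = (((fps_X * fps_deriv C) oo \<xi>) * (G * W ^ (2 * n))) $ n"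
    by (simp add: mult_ac)
  also have "\<dots> = (\<Sum>i=0..n. of_nat i * C $ i * (\<xi> ^ i * (G * W ^ (2 * n))) $ n)"
    unfolding fps_compose_mult_nth[OF xi0] X_deriv_nth ..
  also have "\<dots> = (\<Sum>i=0..n. if i = n then of_nat n * C $ n else 0)"
  proof (rule sum.cong)
    fix i assume "i \<in> {0..n}"
    then obtain m where m: "n = i + m" using le_Suc_ex by auto
    have "\<xi> ^ i * W ^ (2 * n) = fps_X ^ i * (W ^ (2 * m) * (W * \<Omega>) ^ (2 * i))"
    proof -
      have "\<xi> ^ i = fps_X ^ i * \<Omega> ^ (2 * i)" by (simp add: xi power_mult_distrib power_mult)
      moreover have "W ^ (2 * n) = W ^ (2 * m) * W ^ (2 * i)" by (simp add: m add_mult_distrib2 add.commute flip: power_add)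
      ultimately show ?thesis by (simp only: power_mult_distrib mult_ac)
    qed
    then have "\<xi> ^ i * W ^ (2 * n) = fps_X ^ i * W ^ (2 * m)" by (simp add: Om)
    then have "(\<xi> ^ i * (G * W ^ (2 * n))) $ n = (fps_X ^ i * (G * W ^ (2 * m))) $ n"
      by (simp add: mult_ac)
    also have "\<dots> = (G * W ^ (2 * m)) $ m" by (simp add: m fps_X_power_mult_nth)
    also have "\<dots> = (if m = 0 then 1 else 0)"
    proof (cases m)
      case 0
      then show ?thesis by (simp add: G_def mult.assoc numeral_mult_fps_nth)
    next
      case (Suc k)
      \<comment> \<open>For m > 0 this is W^(2m) - x (W^(2m))' / m, whose coefficient at x^m is
        0.\<close>
      have "G * W ^ (2 * m) = W ^ (2 * m) - 2 * (W ^ (2 * k + 1) * (fps_X * fps_deriv W)) * (W * \<Omega>)"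
        unfolding G_def Suc by (simp add: algebra_simps)
      then have e: "(G * W ^ (2 * m)) $ m = W ^ (2 * m) $ m - 2 * (W ^ (2 * k + 1) * (fps_X * fps_deriv W)) $ m"
        by (simp only: Om mult_1_right fps_sub_nth numeral_mult_fps_nth)
      define Y where "Y = (W ^ (2 * k + 1) * (fps_X * fps_deriv W)) $ m"
      have "of_nat (2 * m) * Y = of_nat m * W ^ (2 * m) $ m"
        unfolding Y_def using X_deriv_power[of "2 * k + 1" W m] Suc by (simp only: mult_Suc_right) simp
      then have "of_nat m * (W ^ (2 * m) $ m - 2 * Y) = 0"
        by (auto simp: algebra_simps)
      then have "W ^ (2 * m) $ m - 2 * Y = 0" using Suc by (metis mult_eq_0_iff of_nat_eq_0_iff nat.distinct(1))
      then show ?thesis unfolding e Y_def[symmetric] using Suc by simp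
    qed
    finally show "of_nat i * C $ i * (\<xi> ^ i * (G * W ^ (2 * n))) $ n = (if i = n then of_nat n * C $ n else 0)"
      using m by auto
  qed simp
  finally show ?thesis by simp
qed

text \<open>The conclusion reads q(z^-2) = p/z. By \<open>lagrange_coefficient\<close> the two
  series agree under all functionals taking C to the n-th coefficient of W^(2n) x C'. These are
  triangular because W starts with 1, so they determine a series up to its constant term.\<close>

lemma lagrange_inversion:
  fixes W :: "'a::{idom,ring_char_0} fps"
  assumes W: "W $ 0 = 1" and Om: "W * \<Omega> = 1" and xi: "\<xi> = fps_X * \<Omega> ^ 2"
    and q0: "q $ 0 = 1" and q: "\<And>n. n \<ge> 1 \<Longrightarrow> of_nat (2 * n - 1) * q $ n = - (W ^ (2 * n - 1) $ n)"
  shows "q oo \<xi> = \<Omega>"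
proof -
  let ?D = "(q oo \<xi>) - \<Omega>"
  have dOm: "W ^ (2 * n) * (fps_X * fps_deriv \<Omega>) = - (W ^ (2 * n - 2) * (fps_X * fps_deriv W))" if n1: "n \<ge> 1" for n
  proof -
    obtain k where k: "n = Suc k" using n1 by (cases n) auto
    have "fps_deriv (W * \<Omega>) = 0" by (simp add: Om)
    then have 1: "W * fps_deriv \<Omega> = - (fps_deriv W * \<Omega>)" by (simp add: eq_neg_iff_add_eq_0)
    have "W ^ (2 * n) * (fps_X * fps_deriv \<Omega>) = W ^ (2 * k) * fps_X * W * (W * fps_deriv \<Omega>)"
      unfolding k by (simp add: mult_ac)
    also have "\<dots> = - (W ^ (2 * k) * (fps_X * fps_deriv W)) * (W * \<Omega>)"
      unfolding 1 by (simp add: mult_ac)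
    finally show ?thesis by (simp add: Om k)
  qed
  have Z: "(W ^ (2 * n) * (fps_X * fps_deriv ?D)) $ n = 0" for n
  proof (cases "n = 0")
    case False
    then obtain k where k: "n = Suc k" by (cases n) auto
    have "of_nat (2 * n - 1) * (W ^ (2 * n - 2) * (fps_X * fps_deriv W)) $ n = of_nat n * W ^ (2 * n - 1) $ n"
      using X_deriv_power[of "2 * k" W n] by (simp add: k)
    also have "\<dots> = - (of_nat (2 * n - 1) * (of_nat n * q $ n))" using q[of n] False
      by (simp add: mult_ac)
    finally have "of_nat (2 * n - 1) * ((W ^ (2 * n - 2) * (fps_X * fps_deriv W)) $ n + of_nat n * q $ n) = 0"
      by (simp add: distrib_left)
    moreover have "(of_nat (2 * n - 1) :: 'a) \<noteq> 0" using False by (simp only: of_nat_eq_0_iff)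
    ultimately have "(W ^ (2 * n - 2) * (fps_X * fps_deriv W)) $ n + of_nat n * q $ n = 0"
      by (metis mult_eq_0_iff)
    then show ?thesis
      using dOm[of n] False lagrange_coefficient[OF W Om xi, of n q]
      by (simp add: right_diff_distrib add.commute)
  qed simp
  have "?D $ n = 0" for n
  proof (induction n rule: less_induct)
    case (less n)
    show ?case
    proof (cases "n = 0")
      case True
      have "W $ 0 * \<Omega> $ 0 = 1" using Om by (metis fps_mult_nth_0 fps_one_nth)
      with True W q0 show ?thesis by simp
    next
      case False
      have "(W ^ (2 * n) * (fps_X * fps_deriv ?D)) $ n = (\<Sum>i=0..n. if i = 0 then of_nat n * ?D $ n else 0)"
        unfolding fps_mult_nth[of "W ^ _"] X_deriv_nth
      proof (rule sum.cong)
        fix i assume "i \<in> {0..n}"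
        then show "W ^ (2 * n) $ i * (of_nat (n - i) * ?D $ (n - i)) = (if i = 0 then of_nat n * ?D $ n else 0)"
          using less.IH[of "n - i"] False W by (cases "i = 0") (simp_all add: fps_power_zeroth)
      qed simp
      then show ?thesis using Z[of n] False by simp
    qed
  qed
  then have "?D = 0" by (simp add: fps_eq_iff)
  then show ?thesis by simp
qed

text \<open>
  For \<open>g \<ge> N\<close> the index \<open>g + 1 - N\<close> is the \<open>\<alpha>\<close> with \<open>g = N - 1 + \<alpha>\<close>.
\<close>

definition q_of_v :: "nat \<Rightarrow> qpoly fps" where
  "q_of_v N = Abs_fps (\<lambda>g. if g = 0 then 1 else if g < N then - DN_t_of_v N (N - g)
     else - (of_nat (2 * (g + 1 - N) - 1) * DN_grad_v N (g + 1 - N)))"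

text \<open>The superpotential \<open>z\<^bsup>2N-2\<^esup> = p\<^bsup>2N-2\<^esup> + (2N - 2)\<Sum>v\<^sub>kp\<^bsup>2k-2\<^esup>\<close> with \<open>p = z q(z\<^bsup>-2\<^esup>)\<close>.\<close>

lemma q_of_v_equation:
  assumes N: "N \<ge> 2"
  shows "q_of_v N ^ (2 * (N - 1)) + (\<Sum>k=1..<N. fps_const (of_nat (2 * (N - 1)) * pvar k) * fps_X ^ (N - k) * q_of_v N ^ (2 * (k - 1))) = 1"
    (is "?L = 1")
proof -
  define W where "W = root_series N"
  define \<Omega> where "\<Omega> = recip W"
  define \<xi> where "\<xi> = fps_X * \<Omega> ^ 2"
  have W0: "W $ 0 = 1" by (simp add: W_def root_series_def binom_series_nth_0)
  have Om: "W * \<Omega> = 1" unfolding \<Omega>_def by (rule recip_mult[OF W0])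
  have xi0: "\<xi> $ 0 = 0" by (simp add: \<xi>_def)
  have q: "q_of_v N oo \<xi> = \<Omega>"
  proof (rule lagrange_inversion[OF W0 Om \<xi>_def])
    show "q_of_v N $ 0 = 1" by (simp add: q_of_v_def)
    fix n :: nat assume n: "n \<ge> 1"
    show "of_nat (2 * n - 1) * q_of_v N $ n = - (W ^ (2 * n - 1) $ n)"
    proof (cases "n < N")
      case True
      then show ?thesis using DN_t_of_v_root_series[OF N n True] n by (simp add: q_of_v_def W_def)
    next
      case False
      then have "N - 1 + (n + 1 - N) = n" "1 \<le> n + 1 - N" using N by auto
      then show ?thesis using DN_grad_v_root_series[OF N, of "n + 1 - N"] n False by (simp add: q_of_v_def W_def)
    qed
  qed
  have M: "W ^ (2 * (N - 1)) = 1 + fps_const (of_nat (2 * (N - 1))) * superpot_tail N"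
  proof -
    have "of_nat (2 * (N - 1)) / (2 * of_nat N - 2) = (1 :: rat)" using N by (simp add: of_nat_diff field_simps)
    then show ?thesis unfolding W_def root_series_power using binom_series_1[of N] N by simp
  qed
  have t: "(fps_const (of_nat (2 * (N - 1)) * pvar k) * fps_X ^ (N - k) * q_of_v N ^ (2 * (k - 1))) oo \<xi> =
      \<Omega> ^ (2 * (N - 1)) * (fps_const (of_nat (2 * (N - 1))) * (fps_const (pvar k) * fps_X ^ (N - k)))"
    if k: "k \<in> {1..<N}" for k
  proof -
    have "(fps_const (of_nat (2 * (N - 1)) * pvar k) * fps_X ^ (N - k) * q_of_v N ^ (2 * (k - 1))) oo \<xi> =
       fps_const (of_nat (2 * (N - 1)) * pvar k) * (\<xi> ^ (N - k) * \<Omega> ^ (2 * (k - 1)))"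
      by (simp add: fps_compose_mult_distrib[OF xi0] fps_compose_power[OF xi0, symmetric] q xi0 mult.assoc)
    also have "\<xi> ^ (N - k) * \<Omega> ^ (2 * (k - 1)) = fps_X ^ (N - k) * \<Omega> ^ (2 * (N - k) + 2 * (k - 1))"
      unfolding \<xi>_def by (simp add: power_mult_distrib power_mult power_add mult.assoc)
    also have "2 * (N - k) + 2 * (k - 1) = 2 * (N - 1)" using k by auto
    finally show ?thesis by (simp add: mult_ac flip: fps_const_mult)
  qed
  \<comment> \<open>Composition with \<xi> = z^-2 is injective and sends \<open>q_of_v N\<close> to
    \<Omega> = 1/W. The claim becomes W^(2N-2) = 1 + (2N - 2) \<open>superpot_tail N\<close>, which
    holds because W is the root series.\<close>
  have "?L oo \<xi> = \<Omega> ^ (2 * (N - 1)) + (\<Sum>k=1..<N. \<Omega> ^ (2 * (N - 1)) * (fps_const (of_nat (2 * (N - 1))) * (fps_const (pvar k) * fps_X ^ (N - k))))"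
    unfolding fps_compose_add_distrib fps_compose_sum_distrib fps_compose_power[OF xi0, symmetric] q
    by (intro arg_cong2[of _ _ _ _ "(+)"] refl sum.cong t)
  also have "\<dots> = \<Omega> ^ (2 * (N - 1)) * W ^ (2 * (N - 1))"
    unfolding M superpot_tail_def by (simp add: sum_distrib_left distrib_left)
  also have "\<dots> = 1" using Om by (simp add: mult.commute flip: power_mult_distrib)
  finally have "(?L - 1) oo \<xi> = 0" by (simp add: fps_compose_sub_distrib)
  moreover have "\<xi> \<noteq> 0"
  proof
    assume "\<xi> = 0"
    then have "\<xi> $ 1 = 0" by simp
    moreover have "W $ 0 * \<Omega> $ 0 = 1" using Om by (metis fps_mult_nth_0 fps_one_nth)
    ultimately show False using W0 by (simp add: \<xi>_def fps_power_zeroth)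
  qed
  ultimately have "?L - 1 = 0" using fps_compose_eq_0_iff[OF xi0] by blast
  then show ?thesis by simp
qed

section \<open>The flat coordinates and the potential\<close>

lemma pvars_diff: "pvars (p - q) \<subseteq> pvars p \<union> pvars q"
  using pvars_add[of p "- q"] by simp

text \<open>Solve from the largest index downwards: v_k = t_k - R_k(v), where R_k involves only
  coordinates already found.\<close>

lemma triangular_inverse:
  assumes N: "N \<ge> 1" and T: "\<And>k. k \<in> {1..<N} \<Longrightarrow> T k = pvar k + R k"
    and R: "\<And>k. k \<in> {1..<N} \<Longrightarrow> pvars (R k) \<subseteq> {Suc k..<N}"
  shows "\<exists>v. (\<forall>k. k \<notin> {1..<N} \<longrightarrow> v k = 0) \<and>
     (\<forall>k\<in>{1..<N}. pvars (v k) \<subseteq> {1..<N} \<and> psubst T (v k) = pvar k) \<and>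
     (\<forall>k\<in>{1..<N}. psubst v (T k) = pvar k)"
proof -
  have "\<exists>v. (\<forall>k. k \<notin> {N-n..<N} \<longrightarrow> v k = 0) \<and> (\<forall>k\<in>{N-n..<N}. pvars (v k) \<subseteq> {N-n..<N} \<and>
      psubst T (v k) = pvar k \<and> psubst v (T k) = pvar k)" if "n < N" for n
    using that
  proof (induction n)
    case 0
    show ?case by (rule exI[of _ "\<lambda>_. 0"]) simp
  next
    case (Suc n)
    define k0 where "k0 = N - Suc n"
    have k0: "N - n = Suc k0" "k0 \<in> {1..<N}" using Suc.prems by (auto simp: k0_def)
    obtain v where v_IH: "(\<forall>k. k \<notin> {Suc k0..<N} \<longrightarrow> v k = 0) \<and> (\<forall>k\<in>{Suc k0..<N}. pvars (v k) \<subseteq> {Suc k0..<N} \<and>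
      psubst T (v k) = pvar k \<and> psubst v (T k) = pvar k)"
      using Suc.IH Suc.prems unfolding k0(1) by (meson Suc_lessD)
    have v0: "\<And>k. k \<notin> {Suc k0..<N} \<Longrightarrow> v k = 0"
      and v: "\<And>k. k \<in> {Suc k0..<N} \<Longrightarrow> pvars (v k) \<subseteq> {Suc k0..<N}"
        "\<And>k. k \<in> {Suc k0..<N} \<Longrightarrow> psubst T (v k) = pvar k"
        "\<And>k. k \<in> {Suc k0..<N} \<Longrightarrow> psubst v (T k) = pvar k"
      using v_IH by blast+
    define v' where "v' = v(k0 := pvar k0 - psubst v (R k0))"
    have R0: "pvars (R k0) \<subseteq> {Suc k0..<N}" by (rule R[OF k0(2)])
    have "pvars (psubst v (R k0)) \<subseteq> {Suc k0..<N}"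
      using R0 v(1) by (intro pvars_psubst) blast
    then have pv: "pvars (v' k0) \<subseteq> {k0..<N}"
      using pvars_diff[of "pvar k0" "psubst v (R k0)"] k0(2) by (fastforce simp: v'_def)
    have "psubst (\<lambda>k. psubst T (v k)) (R k0) = R k0"
      using R0 v(2) by (intro psubst_id) blast
    then have pT: "psubst T (v' k0) = pvar k0"
      unfolding v'_def by (simp add: psubst.diff psubst_psubst T[OF k0(2)])
    have vR: "psubst v' (R k) = psubst v (R k)" if "k \<in> {k0..<N}" for k
    proof (rule psubst_cong)
      fix j assume "j \<in> pvars (R k)"
      then show "v' j = v j" using R[of k] that k0(2) by (fastforce simp: v'_def)
    qed
    have vT: "psubst v' (T k) = pvar k" if "k \<in> {k0..<N}" for k
    proof (cases "k = k0")
      case True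
      then show ?thesis using vR[OF that] T[OF k0(2)] by (simp add: psubst.add) (simp add: v'_def)
    next
      case False
      then have k: "k \<in> {Suc k0..<N}" "k \<in> {1..<N}" using that k0(2) by auto
      then show ?thesis using vR[OF that] T[OF k(2)] v(3)[OF k(1)] by (simp add: psubst.add) (simp add: v'_def False)
    qed
    have "N - Suc n = k0" by (simp add: k0_def)
    moreover have "pvars (v' k) \<subseteq> {k0..<N} \<and> psubst T (v' k) = pvar k \<and> psubst v' (T k) = pvar k"
      if "k \<in> {k0..<N}" for k
    proof (cases "k = k0")
      case True
      then show ?thesis using pv pT vT that by simp
    next
      case False
      then have k: "k \<in> {Suc k0..<N}" using that by auto
      then have "pvars (v k) \<subseteq> {k0..<N}" using v(1)[OF k] by fastforce
      then show ?thesis using v(2)[OF k] vT[OF that] False by (simp add: v'_def)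
    qed
    moreover have "v' k = 0" if "k \<notin> {k0..<N}" for k
      using v0[of k] that k0(2) by (auto simp: v'_def)
    ultimately show ?case by (intro exI[of _ v']) simp
  qed
  from this[of "N - 1"] obtain v where v: "(\<forall>k. k \<notin> {1..<N} \<longrightarrow> v k = 0) \<and> (\<forall>k\<in>{1..<N}. pvars (v k) \<subseteq> {1..<N} \<and>
      psubst T (v k) = pvar k \<and> psubst v (T k) = pvar k)"
    using N by (auto simp: Suc_diff_le)
  then show ?thesis by (intro exI[of _ v]) blast
qed

text \<open>The variable v_k has weight N - k and t_\<gamma> has weight N - \<gamma>. An index below
  \<gamma> is too heavy, and v_\<gamma> alone uses up the whole weight.\<close>

lemma DN_t_of_v_triangular:
  assumes "\<gamma> \<in> {1..<N}"
  shows "\<exists>R. DN_t_of_v N \<gamma> = pvar \<gamma> + R \<and> pvars R \<subseteq> {Suc \<gamma>..<N}"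
proof -
  define f where "f a = (-1) ^ (exp_size N a - 1) *
        (\<Prod>k<exp_size N a - 1. 2 * of_nat \<gamma> - 1 + 2 * of_nat k * (of_nat N - 1)) / exp_fact N a" for a
  let ?E = "DN_exponents N (N - \<gamma>)"
  have in_E: "single \<gamma> 1 \<in> ?E" using assms DN_weight_single[OF assms] by (simp add: DN_exponents_iff)
  have "exp_size N (single \<gamma> 1) = 1" using assms exp_size_tdeg[of "single \<gamma> 1" N] by simp
  moreover have "exp_fact N (single \<gamma> 1) = 1"
    unfolding exp_fact_def by (rule prod.neutral) (simp add: lookup_single when_def)
  ultimately have f1: "f (single \<gamma> 1) = 1" by (simp add: f_def del: One_nat_def)
  have "DN_t_of_v N \<gamma> = (\<Sum>a\<in>?E. single a (f a))" by (simp add: DN_t_of_v_def f_def)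
  also have "\<dots> = single (single \<gamma> 1) 1 + (\<Sum>a\<in>?E - {single \<gamma> 1}. single a (f a))"
    using sum.remove[OF finite_DN_exponents in_E, of "\<lambda>a. single a (f a)"] f1 by simp
  finally have "DN_t_of_v N \<gamma> = pvar \<gamma> + (\<Sum>a\<in>?E - {single \<gamma> 1}. single a (f a))" by (simp add: pvar_def)
  moreover have "pvars (single a (f a)) \<subseteq> {Suc \<gamma>..<N}" if a: "a \<in> ?E - {single \<gamma> 1}" for a
  proof
    fix k assume "k \<in> pvars (single a (f a))"
    then have k: "k \<in> keys a" using pvars_single by blast
    have aE: "keys a \<subseteq> {1..<N}" "DN_weight N a = N - \<gamma>" using a by (auto simp: DN_exponents_iff)
    then have kN: "k \<in> {1..<N}" using k by auto
    have pos: "lookup a k > 0" using k by (simp add: in_keys_iff)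
    have w: "DN_weight N a = DN_weight N (a - single k 1) + (N - k)"
      using minus_single_add[OF pos] DN_weight_add[of N "a - single k 1" "single k 1"] DN_weight_single[OF kN] by simp
    have "k \<noteq> \<gamma>"
    proof
      assume "k = \<gamma>"
      then have "DN_weight N (a - single k 1) = 0" using w aE by simp
      then have "exp_size N (a - single k 1) = 0" using exp_size_le_DN_weight[of N "a - single k 1"] by simp
      moreover have "keys (a - single k 1) \<subseteq> {1..<N}" using aE(1) by (auto simp: in_keys_iff lookup_minus)
      ultimately have "a - single k 1 = 0" using exp_size_tdeg by (simp add: tdeg_0_iff)
      then have "a = single k 1" using minus_single_add[OF pos] by simp
      then show False using a \<open>k = \<gamma>\<close> by simp
    qed
    then show "k \<in> {Suc \<gamma>..<N}" using w aE(2) kN assms by auto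
  qed
  then have "pvars (\<Sum>a\<in>?E - {single \<gamma> 1}. single a (f a)) \<subseteq> {Suc \<gamma>..<N}" by (rule pvars_sum)
  ultimately show ?thesis by blast
qed

text \<open>Existence comes from \<open>triangular_inverse\<close>. For uniqueness, a left inverse
  equals a right inverse, and the values outside {1..<N} are fixed to 0.\<close>

lemma DN_v_spec:
  assumes N: "N \<ge> 1"
  shows "(\<forall>k. k \<notin> {1..<N} \<longrightarrow> DN_v N k = 0) \<and>
     (\<forall>k\<in>{1..<N}. pvars (DN_v N k) \<subseteq> {1..<N} \<and> psubst (DN_t_of_v N) (DN_v N k) = pvar k) \<and>
     (\<forall>\<gamma>\<in>{1..<N}. psubst (DN_v N) (DN_t_of_v N \<gamma>) = pvar \<gamma>)"
proof -
  define P where "P v \<longleftrightarrow> (\<forall>k. k \<notin> {1..<N} \<longrightarrow> v k = 0) \<and>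
     (\<forall>k\<in>{1..<N}. pvars (v k) \<subseteq> {1..<N} \<and> psubst (DN_t_of_v N) (v k) = pvar k) \<and>
     (\<forall>\<gamma>\<in>{1..<N}. psubst v (DN_t_of_v N \<gamma>) = pvar \<gamma>)" for v
  have "\<forall>\<gamma>. \<exists>R. \<gamma> \<in> {1..<N} \<longrightarrow> DN_t_of_v N \<gamma> = pvar \<gamma> + R \<and> pvars R \<subseteq> {Suc \<gamma>..<N}"
    using DN_t_of_v_triangular by blast
  then obtain R where R: "\<And>\<gamma>. \<gamma> \<in> {1..<N} \<Longrightarrow> DN_t_of_v N \<gamma> = pvar \<gamma> + R \<gamma>"
      "\<And>\<gamma>. \<gamma> \<in> {1..<N} \<Longrightarrow> pvars (R \<gamma>) \<subseteq> {Suc \<gamma>..<N}" by metis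
  have ex: "\<exists>v. P v" unfolding P_def by (rule triangular_inverse[OF N R])
  have un: "v = w" if v: "P v" and w: "P w" for v w
  proof
    fix k
    show "v k = w k"
    proof (cases "k \<in> {1..<N}")
      case True
      have "psubst w (psubst (DN_t_of_v N) (v k)) = v k"
        unfolding psubst_psubst
      proof (rule psubst_id)
        fix j assume "j \<in> pvars (v k)"
        then have "j \<in> {1..<N}" using v True unfolding P_def by blast
        then show "psubst w (DN_t_of_v N j) = pvar j" using w unfolding P_def by blast
      qed
      moreover have "psubst (DN_t_of_v N) (v k) = pvar k" using v True by (simp add: P_def)
      ultimately show ?thesis by simp
    next
      case False
      then show ?thesis using v w by (simp add: P_def)
    qed
  qed
  have "\<exists>!v. P v" using ex un by blast
  then have "P (THE v. P v)" by (rule theI')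
  moreover have "DN_v N = (THE v. P v)" unfolding DN_v_def P_def ..
  ultimately have "P (DN_v N)" by simp
  then show ?thesis unfolding P_def .
qed

section \<open>Flows of the superpotential along the flat coordinates\<close>

definition DN_grad :: "nat \<Rightarrow> nat \<Rightarrow> qpoly" where
  "DN_grad N \<alpha> = psubst (DN_v N) (DN_grad_v N \<alpha>)"

definition q_of_t :: "nat \<Rightarrow> qpoly fps" where
  "q_of_t N = coeffwise (psubst (DN_v N)) (q_of_v N)"

lemma q_of_t_0 [simp]: "q_of_t N $ 0 = 1"
  by (simp add: q_of_t_def q_of_v_def psubst.one)

lemma q_of_t_low: "N \<ge> 1 \<Longrightarrow> g \<in> {1..<N} \<Longrightarrow> q_of_t N $ g = - pvar (N - g)"
  using DN_v_spec[of N] by (auto simp: q_of_t_def q_of_v_def psubst.uminus)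

lemma q_of_t_high:
  assumes "N \<ge> 1"
  shows "q_of_t N $ (m + N) = - (of_nat (2 * Suc m - 1) * DN_grad N (Suc m))"
proof -
  define n where "n = 2 * Suc m - 1"
  have "q_of_v N $ (m + N) = - (of_nat n * DN_grad_v N (Suc m))" 
    using assms by (simp add: q_of_v_def n_def)
  then show ?thesis unfolding q_of_t_def n_def[symmetric]
    by (simp add: psubst.uminus psubst.mult psubst.of_nat DN_grad_def)
qed

lemma q_of_t_equation:
  assumes "N \<ge> 2"
  shows "q_of_t N ^ (2 * (N - 1)) + (\<Sum>k=1..<N. fps_const (of_nat (2 * (N - 1)) * DN_v N k) * fps_X ^ (N - k) * q_of_t N ^ (2 * (k - 1))) = 1"
proof -
  let ?\<phi> = "coeffwise (psubst (DN_v N))"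
  interpret c: comm_ring_hom ?\<phi> by (rule psubst.coeffwise_hom)
  have "?\<phi> (q_of_v N ^ (2 * (N - 1)) + (\<Sum>k=1..<N. fps_const (of_nat (2 * (N - 1)) * pvar k) * fps_X ^ (N - k) * q_of_v N ^ (2 * (k - 1)))) = ?\<phi> 1"
    unfolding q_of_v_equation[OF assms] ..
  then show ?thesis
    unfolding c.add c.hsum c.mult c.power c.one psubst.coeffwise_fps_const psubst.coeffwise_fps_X
      psubst.mult psubst.of_nat psubst_pvar q_of_t_def[symmetric] .
qed

lemma coeffwise_pdiff_mult:
  "coeffwise (pdiff i) (A * B) = coeffwise (pdiff i) A * B + A * coeffwise (pdiff i) B"
  by (simp add: fps_eq_iff fps_mult_nth additive_sum[of "pdiff i", OF pdiff_add] pdiff_mult sum.distrib)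

lemma derivation_power:
  fixes \<delta> :: "'a::comm_ring_1 \<Rightarrow> 'a"
  assumes mult: "\<And>a b. \<delta> (a * b) = \<delta> a * b + a * \<delta> b"
  shows "\<delta> (a ^ n) = of_nat n * a ^ (n - 1) * \<delta> a"
proof (induction n)
  case 0
  show ?case using mult[of 1 1] by simp
next
  case (Suc n)
  then show ?case by (cases n) (simp_all add: mult algebra_simps)
qed

text \<open>Used for two derivations of the superpotential equation, along t_\<beta> and x d/dx.
  Both produce the same first factor, the derivative with respect to p, which can then be
  eliminated.\<close>

lemma derivation_power_sum:
  fixes \<delta> :: "'a::comm_ring_1 \<Rightarrow> 'a"
  assumes add: "\<And>a b. \<delta> (a + b) = \<delta> a + \<delta> b" and mult: "\<And>a b. \<delta> (a * b) = \<delta> a * b + a * \<delta> b"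
    and eq: "p ^ m + (\<Sum>k\<in>I. A k * p ^ s k) = 1"
  shows "(of_nat m * p ^ (m - 1) + (\<Sum>k\<in>I. A k * of_nat (s k) * p ^ (s k - 1))) * \<delta> p + (\<Sum>k\<in>I. \<delta> (A k) * p ^ s k) = 0"
proof -
  have "\<delta> (p ^ m + (\<Sum>k\<in>I. A k * p ^ s k)) = 0" unfolding eq using mult[of 1 1] by simp
  then show ?thesis
    by (simp add: add additive_sum[of \<delta>, OF add] mult derivation_power[of \<delta>, OF mult]
        distrib_right sum_distrib_right sum.distrib mult.assoc add.assoc add.commute add.left_commute)
qed

lemma coeffwise_pdiff_const: "coeffwise (pdiff i) (fps_const a) = fps_const (pdiff i a)"
  by (simp add: fps_eq_iff)

lemma coeffwise_pdiff_X_power: "coeffwise (pdiff i) (fps_X ^ n) = 0"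
  by (simp add: fps_eq_iff fps_X_power_nth)

lemma pdiff_of_nat [simp]: "pdiff i (of_nat n) = 0"
  using pdiff_const[of i "of_nat n"] by simp

text \<open>\<open>Q\<close> is the derivative of the superpotential in p, up to a power of z. The
  equation along x d/dx, combined with homogeneity, gives \<open>Q * dp_dz q\<close> = 2N - 2, that
  is \<lambda>'(p) p'(z) = (2N - 2) z^(2N-3) for the superpotential \<lambda>. Multiplying the
  equation along t_\<beta> by \<open>dp_dz q\<close> therefore removes \<open>Q\<close>.\<close>

lemma flow_equation:
  assumes N: "N \<ge> 2"
  defines "q \<equiv> q_of_t N"
  shows "dp_dz q * (\<Sum>k=1..<N. fps_const (pdiff \<beta> (DN_v N k)) * fps_X ^ (N - k) * q ^ (2 * (k - 1))) = - coeffwise (pdiff \<beta>) q"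
proof -
  let ?D = "coeffwise (pdiff \<beta>)"
  define c :: qpoly where "c = of_nat (2 * (N - 1))"
  define A where "A k = fps_const (c * DN_v N k) * fps_X ^ (N - k)" for k
  define Q where "Q = of_nat (2 * (N - 1)) * q ^ (2 * (N - 1) - 1) + (\<Sum>k=1..<N. A k * of_nat (2 * (k - 1)) * q ^ (2 * (k - 1) - 1))"
  have eq: "q ^ (2 * (N - 1)) + (\<Sum>k=1..<N. A k * q ^ (2 * (k - 1))) = 1"
    using q_of_t_equation[OF N] by (simp add: q_def A_def c_def)
  have DA: "?D (A k) = fps_const (c * pdiff \<beta> (DN_v N k)) * fps_X ^ (N - k)" for k
  proof -
    have "pdiff \<beta> c = 0" by (simp only: c_def pdiff_of_nat)
    then show ?thesis
      by (simp add: A_def coeffwise_pdiff_mult coeffwise_pdiff_const coeffwise_pdiff_X_power pdiff_mult)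
  qed
  have 1: "Q * ?D q + (\<Sum>k=1..<N. ?D (A k) * q ^ (2 * (k - 1))) = 0"
    unfolding Q_def
    by (rule derivation_power_sum[of ?D, OF _ coeffwise_pdiff_mult eq]) (simp add: coeffwise_add pdiff_add)
  have XA: "fps_X * fps_deriv (A k) = of_nat (N - k) * A k" for k
  proof (rule fps_ext)
    fix n
    have "A k $ n = (if n = N - k then c * DN_v N k else 0)" by (simp add: A_def fps_X_power_nth)
    then show "(fps_X * fps_deriv (A k)) $ n = (of_nat (N - k) * A k) $ n"
      unfolding X_deriv_nth of_nat_mult_fps_nth by simp
  qed
  have "Q * (fps_X * fps_deriv q) + (\<Sum>k=1..<N. fps_X * fps_deriv (A k) * q ^ (2 * (k - 1))) = 0"
    unfolding Q_def
    by (rule derivation_power_sum[of "\<lambda>B. fps_X * fps_deriv B", OF _ _ eq]) (simp_all add: algebra_simps)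
  then have 2: "Q * (fps_X * fps_deriv q) + (\<Sum>k=1..<N. of_nat (N - k) * A k * q ^ (2 * (k - 1))) = 0"
    unfolding XA .
  have pw: "q * (of_nat m * q ^ (m - 1)) = of_nat m * q ^ m" for m by (cases m) (simp_all add: mult_ac)
  have "q * Q = q * (of_nat (2 * (N - 1)) * q ^ (2 * (N - 1) - 1)) + (\<Sum>k=1..<N. A k * (q * (of_nat (2 * (k - 1)) * q ^ (2 * (k - 1) - 1))))"
    unfolding Q_def distrib_left sum_distrib_left by (simp only: mult_ac)
  then have 3: "q * Q = of_nat (2 * (N - 1)) * q ^ (2 * (N - 1)) + (\<Sum>k=1..<N. of_nat (2 * (k - 1)) * (A k * q ^ (2 * (k - 1))))"
    unfolding pw by (simp only: mult_ac)
  have 4: "Q * dp_dz q = of_nat (2 * (N - 1))"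
  proof -
    have "Q * dp_dz q = q * Q - 2 * (Q * (fps_X * fps_deriv q))"
      by (simp add: dp_dz_def algebra_simps)
    also have "Q * (fps_X * fps_deriv q) = - (\<Sum>k=1..<N. of_nat (N - k) * A k * q ^ (2 * (k - 1)))"
      using 2 by (simp add: eq_neg_iff_add_eq_0)
    also have "q * Q - 2 * - (\<Sum>k=1..<N. of_nat (N - k) * A k * q ^ (2 * (k - 1))) =
        of_nat (2 * (N - 1)) * q ^ (2 * (N - 1)) + (\<Sum>k=1..<N. (of_nat (2 * (k - 1)) + 2 * of_nat (N - k)) * (A k * q ^ (2 * (k - 1))))"
      unfolding 3 by (simp only: mult_minus_right diff_minus_eq_add sum_distrib_left distrib_right sum.distrib mult.assoc add.assoc)
    also have "(\<Sum>k=1..<N. (of_nat (2 * (k - 1)) + 2 * of_nat (N - k)) * (A k * q ^ (2 * (k - 1)))) =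
        (\<Sum>k=1..<N. of_nat (2 * (N - 1)) * (A k * q ^ (2 * (k - 1))))"
    proof (rule sum.cong)
      fix k assume k: "k \<in> {1..<N}"
      have "of_nat (2 * (k - 1)) + 2 * of_nat (N - k) = (of_nat (2 * (k - 1) + 2 * (N - k)) :: qpoly fps)" by simp
      also have "2 * (k - 1) + 2 * (N - k) = 2 * (N - 1)" using k by auto
      finally show "(of_nat (2 * (k - 1)) + 2 * of_nat (N - k)) * (A k * q ^ (2 * (k - 1))) = of_nat (2 * (N - 1)) * (A k * q ^ (2 * (k - 1)))" by simp
    qed simp
    also have "of_nat (2 * (N - 1)) * q ^ (2 * (N - 1)) + \<dots> = of_nat (2 * (N - 1)) * 1"
      unfolding eq[symmetric] by (simp only: distrib_left sum_distrib_left)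
    finally show ?thesis by simp
  qed
  let ?S = "\<Sum>k=1..<N. fps_const (pdiff \<beta> (DN_v N k)) * fps_X ^ (N - k) * q ^ (2 * (k - 1))"
  have S: "(\<Sum>k=1..<N. ?D (A k) * q ^ (2 * (k - 1))) = of_nat (2 * (N - 1)) * ?S"
    unfolding DA c_def sum_distrib_left by (simp only: fps_const_mult[symmetric] fps_of_nat mult.assoc)
  have "of_nat (2 * (N - 1)) * (dp_dz q * ?S + ?D q) = dp_dz q * (of_nat (2 * (N - 1)) * ?S) + Q * dp_dz q * ?D q"
    unfolding 4 by (simp only: distrib_left mult_ac)
  also have "\<dots> = dp_dz q * (Q * ?D q + of_nat (2 * (N - 1)) * ?S)" by (simp only: distrib_left mult_ac add_ac)
  also have "\<dots> = 0" using 1 unfolding S by simp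
  finally have z: "of_nat (2 * (N - 1)) * (dp_dz q * ?S + ?D q) = 0" .
  have "(of_nat (2 * (N - 1)) :: qpoly fps) \<noteq> 0"
  proof
    assume "(of_nat (2 * (N - 1)) :: qpoly fps) = 0"
    then have "(of_nat (2 * (N - 1)) :: qpoly fps) $ 0 = 0" by simp
    then have "(of_nat (2 * (N - 1)) :: qpoly) = 0" by (simp only: fps_nth_of_nat simp_thms if_True)
    then show False using N by (simp only: of_nat_eq_0_iff)
  qed
  moreover have "of_nat (2 * (N - 1)) = (0 :: qpoly fps) \<or> dp_dz q * ?S + ?D q = 0"
    by (rule iffD1[OF mult_eq_0_iff z])
  ultimately have "dp_dz q * ?S + ?D q = 0" by blast
  then show ?thesis by (simp add: eq_neg_iff_add_eq_0)
qed

text \<open>The coefficients of \<open>q_of_t N\<close> at x, ..., x^(N-1) are minus flat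
  coordinates, so up to x^(N-1) the series -\<partial>_\<beta> q has the single term x^(N-\<beta>).
  This is the input of \<open>flow_unique\<close> with M = N - 1 and n = \<beta> - 1.\<close>

lemma flows:
  assumes N: "N \<ge> 2" and \<beta>: "1 \<le> \<beta>" "\<beta> < N"
  shows "of_nat (2 * Suc m - 1) * pdiff \<beta> (DN_grad N (Suc m)) = grunsky (q_of_t N) $ (\<beta> - 1) $ m"
    and "pdiff \<beta> (DN_v N 1) = recip (q_of_t N) $ (\<beta> - 1)"
proof -
  define q where "q = q_of_t N"
  have N1: "N \<ge> 1" using N by simp
  \<comment> \<open>The value 0 at j = 0 records that the leading coefficient of the superpotential
    is constant; j = N - 1 is the constant term v_1.\<close>
  define a where "a j = (if j = 0 then 0 else pdiff \<beta> (DN_v N (N - j)))" for j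
  define B where "B = Abs_fps (\<lambda>m. of_nat (2 * Suc m - 1) * pdiff \<beta> (DN_grad N (Suc m)))"
  have "(\<Sum>k=1..<N. fps_const (pdiff \<beta> (DN_v N k)) * fps_X ^ (N - k) * q ^ (2 * (k - 1))) =
      (\<Sum>j\<in>{1..<N}. fps_const (a j) * fps_X ^ j * q ^ (2 * (N - 1 - j)))"
    by (rule sum.reindex_bij_witness[of _ "\<lambda>j. N - j" "\<lambda>k. N - k"]) (auto simp: a_def)
  also have "\<dots> = (\<Sum>j\<le>N-1. fps_const (a j) * fps_X ^ j * q ^ (2 * (N - 1 - j)))"
    by (rule sum.mono_neutral_left) (use N in \<open>auto simp: a_def\<close>)
  finally have S: "(\<Sum>k=1..<N. fps_const (pdiff \<beta> (DN_v N k)) * fps_X ^ (N - k) * q ^ (2 * (k - 1))) =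
      (\<Sum>j\<le>N-1. fps_const (a j) * fps_X ^ j * q ^ (2 * (N - 1 - j)))" .
  have "- coeffwise (pdiff \<beta>) q = fps_X ^ (N - \<beta>) + fps_X ^ N * B"
  proof (rule fps_ext)
    fix g
    have neg: "pdiff \<beta> (- p) = - pdiff \<beta> p" for p by (rule additive_uminus[of "pdiff \<beta>", OF pdiff_add])
    consider "g = 0" | "g \<in> {1..<N}" | m where "g = m + N" using le_Suc_ex[of N g] by (fastforce simp: add.commute)
    then show "(- coeffwise (pdiff \<beta>) q) $ g = (fps_X ^ (N - \<beta>) + fps_X ^ N * B) $ g"
    proof cases
      case 1
      then show ?thesis using \<beta> N by (simp add: q_def fps_X_power_nth fps_X_power_mult_nth)
    next
      case 2
      have "\<beta> = N - g \<longleftrightarrow> g = N - \<beta>" using 2 \<beta> by auto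
      then show ?thesis using 2 q_of_t_low[OF N1 2]
        by (simp add: q_def fps_X_power_nth fps_X_power_mult_nth neg pdiff_pvar)
    next
      case 3
      have "pdiff \<beta> (of_nat n * p) = of_nat n * pdiff \<beta> p" for n p by (simp add: pdiff_mult)
      then show ?thesis using 3 q_of_t_high[OF N1, of m] \<beta>
        by (simp add: q_def fps_X_power_nth fps_X_power_mult_nth neg B_def del: of_nat_Suc)
    qed
  qed
  then have flow: "dp_dz q * (\<Sum>j\<le>N-1. fps_const (a j) * fps_X ^ j * q ^ (2 * (N - 1 - j))) =
      fps_X ^ (N - 1 - (\<beta> - 1)) + fps_X ^ Suc (N - 1) * B"
    using flow_equation[OF N, of \<beta>, folded q_def] N \<beta> unfolding S by simp
  have "q $ 0 = 1" "\<beta> - 1 \<le> N - 1" using \<beta> by (simp_all add: q_def)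
  note fu = flow_unique[OF this flow]
  show "of_nat (2 * Suc m - 1) * pdiff \<beta> (DN_grad N (Suc m)) = grunsky (q_of_t N) $ (\<beta> - 1) $ m"
    using arg_cong[OF fu(1), of "\<lambda>A. A $ m"] unfolding B_def q_def fps_nth_Abs_fps .
  show "pdiff \<beta> (DN_v N 1) = recip (q_of_t N) $ (\<beta> - 1)"
    using fu(2) N unfolding a_def q_def by simp
qed

lemma q_of_t_univ: "coeffwise (psubst (\<lambda>k. - q_of_t N $ k)) q_univ = q_of_t N"
  by (auto simp: fps_eq_iff q_univ_def psubst.one psubst.uminus)

text \<open>\<open>grunsky_symmetric\<close> enters only through \<open>hess_poly\<close>: the rows
  of \<open>flows\<close> are specialisations of the universal ones. For large \<alpha> the
  substitution also involves components of the gradient, sitting in the coefficients from x^N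
  on.\<close>

lemma pdiff_DN_grad:
  assumes N: "N \<ge> 2" and \<beta>: "1 \<le> \<beta>" "\<beta> < N" and \<alpha>: "1 \<le> \<alpha>"
  shows "pdiff \<beta> (DN_grad N \<alpha>) = psubst (\<lambda>k. - q_of_t N $ k) (hess_poly \<alpha> \<beta>)"
proof -
  let ?s = "psubst (\<lambda>k. - q_of_t N $ k)"
  obtain m where m: "\<alpha> = Suc m" using \<alpha> by (cases \<alpha>) auto
  have "of_nat (2 * \<alpha> - 1) * pdiff \<beta> (DN_grad N \<alpha>) = grunsky (q_of_t N) $ (\<beta> - 1) $ (\<alpha> - 1)"
    using flows(1)[OF N \<beta>, of m] by (simp add: m)
  also have "\<dots> = ?s (grunsky q_univ $ (\<beta> - 1) $ (\<alpha> - 1))"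
    unfolding psubst.coeffwise_grunsky[OF q_univ_0, of "\<lambda>k. - q_of_t N $ k", unfolded q_of_t_univ, symmetric] coeffwise_nth ..
  also have "\<dots> = of_nat (2 * \<alpha> - 1) * ?s (hess_poly \<alpha> \<beta>)"
    unfolding of_nat_mult_hess_poly[OF \<alpha>, symmetric] by (simp only: psubst.mult psubst.of_nat)
  finally have e: "of_nat (2 * \<alpha> - 1) * pdiff \<beta> (DN_grad N \<alpha>) = of_nat (2 * \<alpha> - 1) * ?s (hess_poly \<alpha> \<beta>)" .
  have "of_nat (2 * \<alpha> - 1) * (pdiff \<beta> (DN_grad N \<alpha>) - ?s (hess_poly \<alpha> \<beta>)) = 0"
    by (simp only: right_diff_distrib e diff_self)
  moreover have "(of_nat (2 * \<alpha> - 1) :: qpoly) \<noteq> 0" unfolding of_nat_eq_0_iff using \<alpha> by simp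
  moreover note iffD1[OF mult_eq_0_iff, OF \<open>of_nat (2 * \<alpha> - 1) * (pdiff \<beta> (DN_grad N \<alpha>) - ?s (hess_poly \<alpha> \<beta>)) = 0\<close>]
  ultimately have "pdiff \<beta> (DN_grad N \<alpha>) - ?s (hess_poly \<alpha> \<beta>) = 0" by blast
  then show ?thesis by simp
qed

lemma pdiff_DN_v:
  assumes N: "N \<ge> 2" and \<beta>: "1 \<le> \<beta>" "\<beta> < N"
  shows "pdiff \<beta> (DN_v N 1) = psubst (\<lambda>k. - q_of_t N $ k) (recip q_univ $ (\<beta> - 1))"
  unfolding flows(2)[OF N \<beta>]
    psubst.coeffwise_recip[OF q_univ_0, of "\<lambda>k. - q_of_t N $ k", unfolded q_of_t_univ, symmetric] coeffwise_nth ..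

section \<open>Existence and uniqueness of the potential\<close>

lemma poincare:
  assumes V: "finite V" and vars: "\<And>\<alpha>. \<alpha> \<in> V \<Longrightarrow> pvars (F \<alpha>) \<subseteq> V"
    and closed: "\<And>\<alpha> \<beta>. \<alpha> \<in> V \<Longrightarrow> \<beta> \<in> V \<Longrightarrow> pdiff \<beta> (F \<alpha>) = pdiff \<alpha> (F \<beta>)"
  shows "\<exists>P. pvars P \<subseteq> V \<and> lookup P 0 = 0 \<and> (\<forall>\<alpha>\<in>V. pdiff \<alpha> P = F \<alpha>)"
proof -
  \<comment> \<open>Each monomial is integrated along its smallest variable; closedness shows that
    any other variable would give the same coefficient.\<close>
  define f where "f m = (if m = 0 \<or> \<not> keys m \<subseteq> V then 0
     else lookup (F (Min (keys m))) (m - single (Min (keys m)) 1) / of_nat (lookup m (Min (keys m))))" for m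
  have Min: "Min (keys m) \<in> keys m" if "m \<noteq> 0" for m :: "nat \<Rightarrow>\<^sub>0 nat"
    using that keys_empty_iff[of m] by (intro Min_in) auto
  have "{m. f m \<noteq> 0} \<subseteq> (\<Union>\<alpha>\<in>V. (\<lambda>m. m + single \<alpha> 1) ` keys (F \<alpha>))"
  proof
    fix m assume "m \<in> {m. f m \<noteq> 0}"
    then have f: "f m \<noteq> 0" by simp
    define \<alpha> where "\<alpha> = Min (keys m)"
    have m: "m \<noteq> 0" "keys m \<subseteq> V" using f by (auto simp: f_def split: if_splits)
    have "\<alpha> \<in> keys m" using Min[OF m(1)] by (simp add: \<alpha>_def)
    then have "\<alpha> \<in> V" "m = m - single \<alpha> 1 + single \<alpha> 1"
      using m minus_single_add[of m \<alpha>] by (auto simp: in_keys_iff)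
    moreover have "m - single \<alpha> 1 \<in> keys (F \<alpha>)"
      using f m by (simp add: f_def \<alpha>_def in_keys_iff)
    ultimately show "m \<in> (\<Union>\<alpha>\<in>V. (\<lambda>m. m + single \<alpha> 1) ` keys (F \<alpha>))" by blast
  qed
  then have fin: "finite {m. f m \<noteq> 0}" by (rule finite_subset) (use V in auto)
  define P where "P = Abs_poly_mapping f"
  have P: "lookup P = f" unfolding P_def using fin by (rule lookup_Abs_poly_mapping)
  have "pvars P \<subseteq> V"
  proof
    fix k assume "k \<in> pvars P"
    then obtain m where "f m \<noteq> 0" "k \<in> keys m" by (auto simp: pvars_def in_keys_iff[of _ P] P)
    then show "k \<in> V" by (auto simp: f_def split: if_splits)
  qed
  moreover have "lookup P 0 = 0" by (simp add: P f_def)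
  moreover have "pdiff \<beta> P = F \<beta>" if \<beta>: "\<beta> \<in> V" for \<beta>
  proof (rule poly_mapping_eqI)
    fix m :: "nat \<Rightarrow>\<^sub>0 nat"
    let ?m = "m + single \<beta> 1"
    have km: "keys ?m = insert \<beta> (keys m)" by (auto simp: keys_add_nat)
    have m0: "?m \<noteq> 0" using km keys_empty_iff[of ?m] by auto
    define \<alpha> where "\<alpha> = Min (keys ?m)"
    show "lookup (pdiff \<beta> P) m = lookup (F \<beta>) m"
    proof (cases "keys m \<subseteq> V")
      case False
      then have "m \<notin> keys (F \<beta>)" using vars[OF \<beta>] by (auto simp: pvars_def)
      then show ?thesis using False km by (simp add: lookup_pdiff P f_def in_keys_iff del: One_nat_def)
    next
      case True
      have f: "f ?m = lookup (F \<alpha>) (?m - single \<alpha> 1) / of_nat (lookup ?m \<alpha>)"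
        using m0 km True \<beta> by (simp add: f_def \<alpha>_def del: One_nat_def)
      have \<alpha>: "\<alpha> \<in> insert \<beta> (keys m)" using Min[OF m0] km by (simp only: \<alpha>_def)
      show ?thesis
      proof (cases "\<alpha> = \<beta>")
        case True
        then show ?thesis unfolding lookup_pdiff P f by (simp add: lookup_add del: of_nat_Suc of_nat_add)
      next
        case False
        then have a: "\<alpha> \<in> keys m" "\<alpha> \<in> V" using \<alpha> True by auto
        then have pos: "lookup m \<alpha> > 0" by (simp add: in_keys_iff)
        have e1: "?m - single \<alpha> 1 = m - single \<alpha> 1 + single \<beta> 1"
          using False pos by (intro poly_mapping_eqI) (auto simp: lookup_add lookup_minus lookup_single when_def)
        have "lookup (pdiff \<beta> (F \<alpha>)) (m - single \<alpha> 1) = lookup (pdiff \<alpha> (F \<beta>)) (m - single \<alpha> 1)"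
          using closed[OF a(2) \<beta>] by simp
        then have "of_nat (lookup m \<beta> + 1) * lookup (F \<alpha>) (?m - single \<alpha> 1) = of_nat (lookup m \<alpha>) * lookup (F \<beta>) m"
          unfolding lookup_pdiff e1 minus_single_add[OF pos] using False pos
          by (simp add: lookup_minus lookup_single when_def)
        then have "of_nat (lookup m \<beta> + 1) * (lookup (F \<alpha>) (?m - single \<alpha> 1) / of_nat (lookup m \<alpha>)) = lookup (F \<beta>) m"
          using pos by (simp add: field_simps)
        moreover have "lookup ?m \<alpha> = lookup m \<alpha>" using False by (simp add: lookup_add lookup_single when_def)
        ultimately show ?thesis unfolding lookup_pdiff P f by simp
      qed
    qed
  qed
  ultimately show ?thesis by blast
qed

lemma lookup_psubst_eq_0:
  "lookup (psubst (\<lambda>k. if k = N then 0 else pvar k) p) m = (if lookup m N = 0 then lookup p m else 0)"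
proof (induction p arbitrary: m rule: qpoly_induct_all)
  case (const c)
  then show ?case by (simp add: lookup_single when_def)
next
  case (add p q)
  then show ?case by (simp add: psubst.add lookup_add)
next
  case (mult p k)
  then show ?case
    by (auto simp: psubst.mult lookup_mult_pvar lookup_minus lookup_single when_def)
qed

lemma DN_grad_pvars: "N \<ge> 1 \<Longrightarrow> pvars (DN_grad N \<alpha>) \<subseteq> {1..<N}"
  unfolding DN_grad_def
proof (rule pvars_psubst)
  fix k assume N: "N \<ge> 1" and "k \<in> pvars (DN_grad_v N \<alpha>)"
  moreover have "pvars (DN_grad_v N \<alpha>) \<subseteq> {1..<N}"
    unfolding DN_grad_v_def by (intro pvars_sum order_trans[OF pvars_single]) (auto simp: DN_exponents_def)
  ultimately show "pvars (DN_v N k) \<subseteq> {1..<N}" using DN_v_spec[OF N] by blast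
qed

lemma pdiff_eq_0: "i \<notin> pvars p \<Longrightarrow> pdiff i p = 0"
proof (rule poly_mapping_eqI)
  fix m :: "nat \<Rightarrow>\<^sub>0 nat" assume i: "i \<notin> pvars p"
  have "i \<in> keys (m + single i 1)" by (simp add: in_keys_iff lookup_add)
  then have "m + single i 1 \<notin> keys p" using i by (auto simp: pvars_def)
  then show "lookup (pdiff i p) m = lookup 0 m" by (simp add: lookup_pdiff in_keys_iff)
qed

text \<open>The remainder divisible by t_N disappears under derivatives at the origin along the
  other coordinates, so nothing more about it is recorded.\<close>

lemma DN_potential_eq:
  assumes N: "N \<ge> 2"
  shows "\<exists>Y. \<forall>\<alpha>\<in>{1..<N}. pdiff \<alpha> (DN_potential N) = DN_grad N \<alpha> + Y \<alpha> * pvar N"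
proof -
  have N1: "N \<ge> 1" using N by simp
  define Q where "Q F \<longleftrightarrow> pvars F \<subseteq> {1..N} \<and> lookup F 0 = 0 \<and> pdiff N F = DN_v N 1 * pvar N \<and>
     (\<forall>\<alpha>\<in>{1..<N}. psubst (\<lambda>k. if k = N then 0 else pvar k) (pdiff \<alpha> F) = psubst (DN_v N) (DN_grad_v N \<alpha>))" for F
  have "\<exists>P. pvars P \<subseteq> {1..<N} \<and> lookup P 0 = 0 \<and> (\<forall>\<alpha>\<in>{1..<N}. pdiff \<alpha> P = DN_grad N \<alpha>)"
  proof (rule poincare)
    show "pvars (DN_grad N \<alpha>) \<subseteq> {1..<N}" for \<alpha> by (rule DN_grad_pvars[OF N1])
    show "pdiff \<beta> (DN_grad N \<alpha>) = pdiff \<alpha> (DN_grad N \<beta>)" if "\<alpha> \<in> {1..<N}" "\<beta> \<in> {1..<N}" for \<alpha> \<beta>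
      using that by (simp add: pdiff_DN_grad[OF N] hess_poly_commute[of \<alpha> \<beta>])
  qed simp
  then obtain P where P: "pvars P \<subseteq> {1..<N}" "lookup P 0 = 0" "\<And>\<alpha>. \<alpha> \<in> {1..<N} \<Longrightarrow> pdiff \<alpha> P = DN_grad N \<alpha>"
    by blast
  define v where "v = DN_v N 1"
  have v: "pvars v \<subseteq> {1..<N}" using DN_v_spec[OF N1] N by (simp add: v_def)
  \<comment> \<open>The added term is v_1 t_N^2 / 2, the integral of v_1 t_N in t_N.\<close>
  define F where "F = P + single 0 (1 / 2) * (v * pvar N) * pvar N"
  have dF: "pdiff \<alpha> F = DN_grad N \<alpha> + (single 0 (1 / 2) * (pdiff \<alpha> v * pvar N)) * pvar N" if "\<alpha> \<in> {1..<N}" for \<alpha>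
    using that P(3)[OF that] by (simp add: F_def pdiff_add pdiff_mult_pvar pdiff_const_mult)
  have NP: "N \<notin> pvars P" "N \<notin> pvars v" using P(1) v by auto
  have h: "single 0 (1 / 2) * p + single 0 (1 / 2) * p = p" for p :: qpoly
    by (simp flip: distrib_right single_add)
  have QF: "Q F" unfolding Q_def
  proof (intro conjI ballI)
    have "pvars (single 0 (1 / 2) * (v * pvar N) * pvar N) \<subseteq> {1..N}"
      using pvars_mult[of "single 0 (1 / 2) * (v * pvar N)" "pvar N"] pvars_mult[of "single 0 (1 / 2)" "v * pvar N"]
        pvars_mult[of v "pvar N"] v N by fastforce
    then show "pvars F \<subseteq> {1..N}" unfolding F_def using pvars_add P(1) by fastforce
    show "lookup F 0 = 0" by (simp add: F_def lookup_add P(2) lookup_mult_pvar)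
    show "pdiff N F = DN_v N 1 * pvar N"
    proof -
      have "pdiff N F = single 0 (1 / 2) * v * pvar N + single 0 (1 / 2) * (v * pvar N)"
        using NP by (simp add: F_def pdiff_add pdiff_mult_pvar pdiff_const_mult pdiff_eq_0)
      then show ?thesis by (simp only: mult.assoc h v_def)
    qed
    show "psubst (\<lambda>k. if k = N then 0 else pvar k) (pdiff \<alpha> F) = psubst (DN_v N) (DN_grad_v N \<alpha>)"
      if "\<alpha> \<in> {1..<N}" for \<alpha>
    proof -
      have "psubst (\<lambda>k. if k = N then 0 else pvar k) (DN_grad N \<alpha>) = DN_grad N \<alpha>"
        using DN_grad_pvars[OF N1, of \<alpha>] by (intro psubst_id) auto
      then show ?thesis unfolding dF[OF that] by (simp add: psubst.add psubst.mult DN_grad_def)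
    qed
  qed
  \<comment> \<open>A monomial containing t_N is fixed by the derivative in t_N, any other
    nonconstant one by the gradient on t_N = 0.\<close>
  have "F1 = F2" if Q: "Q F1" "Q F2" for F1 F2
  proof (rule poly_mapping_eqI)
    fix m :: "nat \<Rightarrow>\<^sub>0 nat"
    show "lookup F1 m = lookup F2 m"
    proof (cases "m = 0 \<or> \<not> keys m \<subseteq> {1..N}")
      case True
      then have "m = 0 \<or> m \<notin> keys F1 \<and> m \<notin> keys F2" using Q by (auto simp: Q_def pvars_def)
      then show ?thesis using Q by (auto simp: Q_def in_keys_iff)
    next
      case False
      show ?thesis
      proof (cases "lookup m N = 0")
        case False
        then have "m - single N 1 + single N 1 = m" by (simp add: minus_single_add del: One_nat_def)
        moreover have "lookup (pdiff N F1) (m - single N 1) = lookup (pdiff N F2) (m - single N 1)"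
          using Q by (simp add: Q_def)
        ultimately show ?thesis unfolding lookup_pdiff by (simp del: of_nat_Suc of_nat_add)
      next
        case True
        obtain \<alpha> where a: "\<alpha> \<in> keys m" using False keys_empty_iff[of m] by blast
        then have "\<alpha> \<noteq> N" using True by (auto simp: in_keys_iff)
        then have a': "\<alpha> \<in> {1..<N}" using a False by fastforce
        have e: "m - single \<alpha> 1 + single \<alpha> 1 = m" using a by (simp add: minus_single_add in_keys_iff del: One_nat_def)
        have "lookup (psubst (\<lambda>k. if k = N then 0 else pvar k) (pdiff \<alpha> F1)) (m - single \<alpha> 1) =
            lookup (psubst (\<lambda>k. if k = N then 0 else pvar k) (pdiff \<alpha> F2)) (m - single \<alpha> 1)"
          using Q a' by (simp add: Q_def)
        then show ?thesis
          using True e unfolding lookup_psubst_eq_0 lookup_pdiff by (simp add: lookup_minus del: of_nat_Suc of_nat_add)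
      qed
    qed
  qed
  then have "\<exists>!F. Q F" using QF by blast
  then have "Q (THE F. Q F)" by (rule theI')
  moreover have "DN_potential N = (THE F. Q F)" unfolding DN_potential_def Q_def ..
  ultimately have "DN_potential N = F" using QF \<open>\<And>F1 F2. Q F1 \<Longrightarrow> Q F2 \<Longrightarrow> F1 = F2\<close> by simp
  then show ?thesis using dF by (intro exI[of _ "\<lambda>\<alpha>. single 0 (1 / 2) * (pdiff \<alpha> v * pvar N)"]) simp
qed

section \<open>The coefficients of the system and their independence of N\<close>

lemma lookup_psubst_reflect: "lookup (psubst (\<lambda>k. pvar (N - k)) p) 0 = lookup p 0"
proof (induction p rule: qpoly_induct_all)
  case (const c)
  show ?case by simp
next
  case (add p q)
  then show ?case by (simp add: psubst.add lookup_add)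
next
  case (mult p k)
  show ?case by (simp add: psubst.mult lookup_mult_pvar)
qed

text \<open>The reflection k \<mapsto> N - k exchanges derivatives along t_(N-\<gamma>) with
  derivatives along y_\<gamma>; by the chain rule one summand survives.\<close>

lemma pdiffs_reflect:
  assumes "pvars p \<subseteq> {1..<N}" "set ks \<subseteq> {1..<N}"
  shows "pdiffs_at_0 (map (\<lambda>k. N - k) ks) (psubst (\<lambda>k. pvar (N - k)) p) = pdiffs_at_0 ks p"
  using assms
proof (induction ks arbitrary: p)
  case Nil
  show ?case by (simp add: pdiffs_at_0_def lookup_psubst_reflect)
next
  case (Cons k ks)
  have k: "k \<in> {1..<N}" using Cons.prems by simp
  have "pdiff (N - k) (psubst (\<lambda>k. pvar (N - k)) p) =
     (\<Sum>j\<in>{1..<N}. psubst (\<lambda>k. pvar (N - k)) (pdiff j p) * pdiff (N - k) (pvar (N - j)))"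
    by (rule chain_rule[OF Cons.prems(1)]) simp
  also have "\<dots> = (\<Sum>j\<in>{1..<N}. if j = k then psubst (\<lambda>k. pvar (N - k)) (pdiff k p) else 0)"
    by (rule sum.cong) (use k in \<open>auto simp: pdiff_pvar\<close>)
  also have "\<dots> = psubst (\<lambda>k. pvar (N - k)) (pdiff k p)" using k by simp
  finally have e: "pdiff (N - k) (psubst (\<lambda>k. pvar (N - k)) p) = psubst (\<lambda>k. pvar (N - k)) (pdiff k p)" .
  have "pvars (pdiff k p) \<subseteq> {1..<N}" using pvars_pdiff Cons.prems(1) by blast
  from Cons.IH[OF this] Cons.prems(2) show ?case
    by (simp add: pdiffs_at_0_def foldr_pdiff_commute e)
qed

lemma psubst_reflect:
  assumes "N \<ge> 1" "pvars p \<subseteq> {1..<N}"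
  shows "psubst (\<lambda>k. - q_of_t N $ k) p = psubst (\<lambda>k. pvar (N - k)) p"
  by (rule psubst_cong) (use assms q_of_t_low[OF assms(1)] in \<open>auto simp: subset_iff\<close>)

lemma pdiffs_mult_pvar:
  "N \<notin> set ks \<Longrightarrow> pdiffs_at_0 ks (p * pvar N) = 0"
proof -
  assume "N \<notin> set ks"
  then have "foldr pdiff ks (p * pvar N) = foldr pdiff ks p * pvar N"
    by (induction ks) (simp_all add: pdiff_mult_pvar)
  then show ?thesis by (simp add: pdiffs_at_0_def lookup_mult_pvar)
qed

lemma pdiffs_add: "pdiffs_at_0 ks (p + q) = pdiffs_at_0 ks p + pdiffs_at_0 ks q"
proof -
  have "foldr pdiff ks (p + q) = foldr pdiff ks p + foldr pdiff ks q"
    by (induction ks) (simp_all add: pdiff_add)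
  then show ?thesis by (simp add: pdiffs_at_0_def lookup_add)
qed

text \<open>The weight \<alpha> + \<beta> - 1 is below N, so \<open>hess_poly\<close> involves only
  variables that specialise to flat coordinates, and there the specialisation is a reflection. All
  derivatives are along coordinates other than t_N. The right side no longer mentions N.\<close>

lemma RD1_at_eq:
  assumes "\<alpha> \<ge> 1" "\<beta> \<ge> 1" "\<gamma>s \<in> index_tuples" "RD1_admissible N \<alpha> \<beta> \<gamma>s"
  shows "RD1_at N \<alpha> \<beta> \<gamma>s = 1 / fact (length \<gamma>s) * pdiffs_at_0 \<gamma>s (hess_poly \<alpha> \<beta>)"
proof -
  let ?L = "map (\<lambda>\<gamma>. N - \<gamma>) \<gamma>s"
  have N: "N \<ge> 2" "N \<ge> 1" and ab: "\<alpha> \<in> {1..<N}" "\<beta> \<in> {1..<N}" and \<gamma>s: "set \<gamma>s \<subseteq> {1..<N}"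
    using assms by (auto simp: RD1_admissible_def index_tuples_def)
  have pv: "pvars (hess_poly \<beta> \<alpha>) \<subseteq> {1..<N}"
    by (rule order_trans[OF homog_pvars[OF homog_hess_poly[OF assms(2,1)]]]) (use assms in \<open>auto simp: RD1_admissible_def\<close>)
  obtain Y where Y: "pdiff \<beta> (DN_potential N) = DN_grad N \<beta> + Y * pvar N"
    using DN_potential_eq[OF N(1)] ab by blast
  have "pdiff \<alpha> (pdiff \<beta> (DN_potential N)) = psubst (\<lambda>k. pvar (N - k)) (hess_poly \<beta> \<alpha>) + pdiff \<alpha> Y * pvar N"
  proof -
    have "pdiff \<alpha> (DN_grad N \<beta>) = psubst (\<lambda>k. pvar (N - k)) (hess_poly \<beta> \<alpha>)"
      unfolding psubst_reflect[OF N(2) pv, symmetric] by (rule pdiff_DN_grad[OF N(1)]) (use ab in auto)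
    then show ?thesis unfolding Y using ab by (simp add: pdiff_add pdiff_mult_pvar)
  qed
  moreover have "pdiffs_at_0 (\<alpha> # \<beta> # ?L) (DN_potential N) = pdiffs_at_0 ?L (pdiff \<alpha> (pdiff \<beta> (DN_potential N)))"
    by (simp add: pdiffs_at_0_def foldr_pdiff_commute)
  moreover have NL: "N \<notin> set ?L" using \<gamma>s by (auto dest!: subsetD[OF \<gamma>s])
  ultimately have "pdiffs_at_0 (\<alpha> # \<beta> # ?L) (DN_potential N) = pdiffs_at_0 \<gamma>s (hess_poly \<beta> \<alpha>)"
    by (simp only: pdiffs_add pdiffs_mult_pvar[OF NL] pdiffs_reflect[OF pv \<gamma>s] add_0_right)
  then show ?thesis unfolding RD1_at_def using hess_poly_commute[OF assms(1,2)] by simp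
qed

lemma RD2_at_eq:
  assumes "\<alpha> \<ge> 1" "\<gamma>s \<in> index_tuples" "RD2_admissible N \<alpha> \<gamma>s"
  shows "RD2_at N \<alpha> \<gamma>s = 1 / fact (length \<gamma>s) * pdiffs_at_0 \<gamma>s (recip q_univ $ (\<alpha> - 1))"
proof -
  let ?L = "map (\<lambda>\<gamma>. N - \<gamma>) \<gamma>s"
  have N: "N \<ge> 2" "N \<ge> 1" and ab: "1 \<le> \<alpha>" "\<alpha> < N" and \<gamma>s: "set \<gamma>s \<subseteq> {1..<N}"
    using assms by (auto simp: RD2_admissible_def index_tuples_def)
  have pv: "pvars (recip q_univ $ (\<alpha> - 1)) \<subseteq> {1..<N}"
    by (rule order_trans[OF homog_pvars[OF homog_recip[OF homog_fps_q_univ q_univ_0], of "\<alpha> - 1"]]) (use ab in auto)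
  have "pdiffs_at_0 (\<alpha> # ?L) (DN_v N 1) = pdiffs_at_0 ?L (pdiff \<alpha> (DN_v N 1))"
    by (simp add: pdiffs_at_0_def foldr_pdiff_commute)
  also have "\<dots> = pdiffs_at_0 \<gamma>s (recip q_univ $ (\<alpha> - 1))"
    by (simp only: pdiff_DN_v[OF N(1) ab] psubst_reflect[OF N(2) pv] pdiffs_reflect[OF pv \<gamma>s])
  finally show ?thesis unfolding RD2_at_def by simp
qed

lemma admissible_ex:
  "\<exists>N. RD1_admissible N \<alpha> \<beta> \<gamma>s" "\<exists>N. RD2_admissible N \<alpha> \<gamma>s"
proof -
  have "\<gamma> \<le> 4 + \<alpha> + \<beta> + sum_list \<gamma>s + 1 - 1" if "\<gamma> \<in> set \<gamma>s" for \<gamma> \<beta>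
    using member_le_sum_list[OF that] by simp
  then have "RD1_admissible (4 + \<alpha> + \<beta> + sum_list \<gamma>s + 1) \<alpha> \<beta> \<gamma>s"
    "RD2_admissible (4 + \<alpha> + \<beta> + sum_list \<gamma>s + 1) \<alpha> \<gamma>s"
    unfolding RD1_admissible_def RD2_admissible_def by auto
  then show "\<exists>N. RD1_admissible N \<alpha> \<beta> \<gamma>s" "\<exists>N. RD2_admissible N \<alpha> \<gamma>s" by blast+
qed

lemma RD1_eq:
  assumes "\<alpha> \<ge> 1" "\<beta> \<ge> 1" "\<gamma>s \<in> index_tuples"
  shows "RD1 \<alpha> \<beta> \<gamma>s = 1 / fact (length \<gamma>s) * pdiffs_at_0 \<gamma>s (hess_poly \<alpha> \<beta>)"
  unfolding RD1_def by (rule RD1_at_eq[OF assms]) (rule LeastI_ex[OF admissible_ex(1)])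

lemma RD2_eq:
  assumes "\<alpha> \<ge> 1" "\<gamma>s \<in> index_tuples"
  shows "RD2 \<alpha> \<gamma>s = 1 / fact (length \<gamma>s) * pdiffs_at_0 \<gamma>s (recip q_univ $ (\<alpha> - 1))"
  unfolding RD2_def by (rule RD2_at_eq[OF assms]) (rule LeastI_ex[OF admissible_ex(2)])

section \<open>The Fay identity\<close>

lemma mfps_coeff_0 [simp]: "mfps_coeff 0 m = 0" by (simp add: zero_mfps_def)
lemma mfps_coeff_1: "mfps_coeff 1 m = (if m = 0 then 1 else 0)" by (simp add: one_mfps_def)
lemma mfps_coeff_add [simp]: "mfps_coeff (p + q) m = mfps_coeff p m + mfps_coeff q m" by (simp add: plus_mfps_def)
lemma mfps_coeff_mult: "mfps_coeff (p * q) m = (\<Sum>(a, b) | a + b = m. mfps_coeff p a * mfps_coeff q b)"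
  by (simp add: times_mfps_def)
lemma mfps_coeff_const: "mfps_coeff (mfps_const c) m = (if m = 0 then c else 0)" by (simp add: mfps_const_def)

lemma mfps_coeff_const_mult [simp]: "mfps_coeff (mfps_const c * p) m = c * mfps_coeff p m"
proof -
  have "mfps_coeff (mfps_const c * p) m = (\<Sum>x | fst x + snd x = m. if x = (0, m) then c * mfps_coeff p m else 0)"
    unfolding mfps_coeff_mult case_prod_unfold
    by (rule sum.cong) (auto simp: mfps_coeff_const)
  also have "\<dots> = c * mfps_coeff p m"
    using finite_monomial_splits[of m] by (simp add: sum.delta case_prod_unfold)
  finally show ?thesis .
qed

lemma mfps_const_hom: "comm_ring_hom (mfps_const :: 'k::comm_ring_1 \<Rightarrow> ('v, 'k) mfps)"
proof
  show "mfps_const (a * b) = (mfps_const a * mfps_const b :: ('v, 'k) mfps)" for a b :: 'k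
    by (rule mfps_eqI) (simp add: mfps_coeff_const)
  show "mfps_const (a + b) = (mfps_const a + mfps_const b :: ('v, 'k) mfps)" for a b :: 'k
    by (rule mfps_eqI) (simp add: mfps_coeff_const)
  show "mfps_const 1 = (1 :: ('v, 'k) mfps)"
    by (rule mfps_eqI) (simp add: mfps_coeff_const mfps_coeff_1)
qed

interpretation mfps_const: comm_ring_hom mfps_const by (rule mfps_const_hom)

lemma mfps_of_nat_mult_eq_0:
  "of_nat (Suc n) * p = 0 \<Longrightarrow> p = (0 :: ('v, 'k::field_char_0) mfps)"
proof -
  assume a: "of_nat (Suc n) * p = 0"
  have "mfps_coeff p m = 0" for m
  proof -
    have "mfps_coeff (mfps_const (of_nat (Suc n)) * p) m = 0"
      unfolding mfps_const.of_nat using a by simp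
    then have "of_nat (Suc n) * mfps_coeff p m = 0" unfolding mfps_coeff_const_mult .
    then show ?thesis by (simp del: of_nat_Suc)
  qed
  then show "p = 0" by (intro mfps_eqI) simp
qed

lemma mfps_deriv_coeff: "mfps_coeff (mfps_deriv v F) m = of_nat (lookup m v + 1) * mfps_coeff F (m + single v 1)"
  by (simp add: mfps_deriv_def)

lemma mfps_deriv_add: "mfps_deriv v (F + G) = mfps_deriv v F + mfps_deriv v G"
  by (rule mfps_eqI) (simp add: mfps_deriv_coeff algebra_simps)

lemma mfps_deriv_const_mult: "mfps_deriv v (mfps_const c * F) = mfps_const c * mfps_deriv v F"
  by (rule mfps_eqI) (simp only: mfps_deriv_coeff mfps_coeff_const_mult mult.left_commute)

lemma mfps_deriv_numeral_mult: "mfps_deriv v (numeral w * F) = numeral w * mfps_deriv v F"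
  using mfps_deriv_const_mult[of v "numeral w" F] by (simp add: mfps_const.numeral)

lemma mfps_deriv_0 [simp]: "mfps_deriv v 0 = 0"
  by (rule mfps_eqI) (simp add: mfps_deriv_coeff)

lemma mfps_deriv_commute: "mfps_deriv v (mfps_deriv w F) = mfps_deriv w (mfps_deriv v F)"
proof (rule mfps_eqI)
  fix m
  have "m + single v 1 + single w 1 = m + single w 1 + single v (1::nat)" by (simp add: add_ac)
  then show "mfps_coeff (mfps_deriv v (mfps_deriv w F)) m = mfps_coeff (mfps_deriv w (mfps_deriv v F)) m"
    by (simp only: mfps_deriv_coeff lookup_add lookup_single) (auto simp: when_def)
qed

lemma of_rat_hom: "comm_ring_hom (of_rat :: rat \<Rightarrow> 'k::field_char_0)"
  by standard (simp_all add: of_rat_add of_rat_mult)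

definition rat_const :: "rat \<Rightarrow> ('v, 'k::field_char_0) mfps" where
  "rat_const r = mfps_const (of_rat r)"

interpretation rat_const: rat_hom rat_const
proof -
  interpret r: comm_ring_hom "of_rat :: rat \<Rightarrow> 'b" by (rule of_rat_hom)
  show "rat_hom (rat_const :: rat \<Rightarrow> ('a, 'b) mfps)"
    unfolding rat_hom_def comm_ring_hom_def rat_const_def
    by (simp add: r.add r.mult mfps_const.add mfps_const.mult mfps_const.one)
qed

section \<open>Even series in 1/z\<close>

definition stretch :: "'a::comm_ring_1 fps \<Rightarrow> 'a fps" where
  "stretch A = Abs_fps (\<lambda>n. if even n then A $ (n div 2) else 0)"

lemma stretch_nth: "stretch A $ n = (if even n then A $ (n div 2) else 0)"
  by (simp add: stretch_def)

lemma stretch_even [simp]: "stretch A $ (2 * n) = A $ n" by (simp add: stretch_nth)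

lemma stretch_hom: "comm_ring_hom stretch"
proof
  show "stretch (A + B) = stretch A + stretch B" for A B :: "'a fps"
    by (simp add: fps_eq_iff stretch_nth)
  show "stretch 1 = 1" by (auto simp: fps_eq_iff stretch_nth fps_one_nth elim!: evenE)
  show "stretch (A * B) = stretch A * stretch B" for A B :: "'a fps"
  proof (rule fps_ext)
    fix n
    show "stretch (A * B) $ n = (stretch A * stretch B) $ n"
    proof (cases "even n")
      case True
      then obtain m where m: "n = 2 * m" by (auto elim: evenE)
      have "(stretch A * stretch B) $ n = (\<Sum>i\<in>(\<lambda>i. 2 * i) ` {0..m}. stretch A $ i * stretch B $ (n - i))"
        unfolding fps_mult_nth
      proof (rule sum.mono_neutral_right)
        show "\<forall>i\<in>{0..n} - (\<lambda>i. 2 * i) ` {0..m}. stretch A $ i * stretch B $ (n - i) = 0"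
        proof
          fix i assume i: "i \<in> {0..n} - (\<lambda>i. 2 * i) ` {0..m}"
          have "odd i" using i m by (auto elim!: evenE)
          then show "stretch A $ i * stretch B $ (n - i) = 0" by (simp add: stretch_nth)
        qed
      qed (auto simp: m)
      also have "\<dots> = (\<Sum>i=0..m. A $ i * B $ (m - i))"
        by (subst sum.reindex) (auto simp: inj_on_def m simp flip: diff_mult_distrib2)
      finally show ?thesis by (simp add: m fps_mult_nth)
    next
      case False
      have "stretch A $ i * stretch B $ (n - i) = 0" if "i \<le> n" for i
        using False that by (auto simp: stretch_nth)
      then have "(stretch A * stretch B) $ n = 0" unfolding fps_mult_nth by (intro sum.neutral) auto
      then show ?thesis using False by (simp add: stretch_nth)
    qed
  qed
qed

interpretation stretch: comm_ring_hom stretch by (rule stretch_hom)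

lemma stretch_X: "stretch fps_X = (fps_X ^ 2 :: 'a::comm_ring_1 fps)"
proof -
  have "fps_X $ k = (if k = 1 then 1 else 0 :: 'a)" for k by (simp add: fps_X_def)
  then show ?thesis by (auto simp: fps_eq_iff stretch_nth fps_X_power_nth elim!: evenE)
qed

text \<open>The substitution \<open>x = w\<^sub>1\<^sup>2\<close>, \<open>y = w\<^sub>2\<^sup>2\<close>, under which the identities contain even powers only.\<close>

definition stretch2 :: "'a::comm_ring_1 fps fps \<Rightarrow> 'a fps fps" where
  "stretch2 A = coeffwise stretch (stretch A)"

interpretation stretch2: comm_ring_hom stretch2
  unfolding stretch2_def by (rule comm_ring_hom.comp_hom[OF stretch.coeffwise_hom stretch_hom])

lemma stretch2_nth: "stretch2 A $ n $ m = (if even n \<and> even m then A $ (n div 2) $ (m div 2) else 0)"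
  by (auto simp: stretch2_def stretch_nth)

lemma stretch2_eq_0: "stretch2 A = 0 \<Longrightarrow> A = 0"
proof -
  assume a: "stretch2 A = 0"
  have "A $ n $ m = stretch2 A $ (2 * n) $ (2 * m)" for n m by (simp add: stretch2_nth)
  then show "A = 0" unfolding a by (simp add: fps_eq_iff)
qed

lemma stretch2_z1: "stretch2 (in_z1 A) = in_z1 (stretch A)"
  by (auto simp: fps_eq_iff stretch2_nth stretch_nth elim!: evenE)
lemma stretch2_z2: "stretch2 (in_z2 A) = in_z2 (stretch A)"
  by (auto simp: fps_eq_iff stretch2_nth stretch_nth elim!: evenE)
lemma stretch2_X1: "stretch2 X1 = X1 ^ 2"
  by (simp add: stretch2_z1 stretch_X in_z1_power)
lemma stretch2_X2: "stretch2 X2 = X2 ^ 2"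
  using stretch2_z2[of fps_X] by (simp add: stretch_X in_z2_power in_z2_X)

text \<open>For x = w^2 the operator 2x d/dx becomes w d/dw, which absorbs the factor 2 in
  \<open>dp_dz\<close>.\<close>

lemma stretch_dp_dz: "stretch (dp_dz q) = stretch q - fps_X * fps_deriv (stretch q)"
proof (rule fps_ext)
  fix n
  have k: "dp_dz q $ m = q $ m - of_nat (2 * m) * q $ m" for m
    by (simp add: dp_dz_def mult.assoc numeral_mult_fps_nth X_deriv_nth)
  show "stretch (dp_dz q) $ n = (stretch q - fps_X * fps_deriv (stretch q)) $ n"
    unfolding fps_sub_nth X_deriv_nth by (cases "even n") (auto simp: stretch_nth k elim!: evenE)
qed

section \<open>The Fay identity in logarithmic form\<close>

lemma fps_ODE_unique:
  fixes S U V G :: "'a::comm_ring_1 fps"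
  assumes tf: "\<And>n a. of_nat (Suc n) * a = 0 \<Longrightarrow> a = (0 :: 'a)"
    and S: "S $ 0 = 1" and "U $ 0 = V $ 0"
    and "S * fps_deriv U = G * U" "S * fps_deriv V = G * V"
  shows "U = V"
proof -
  define D where "D = U - V"
  have D: "D $ 0 = 0" "S * fps_deriv D = G * D" using assms by (simp_all add: D_def algebra_simps)
  have "D $ n = 0" for n
  proof (induction n rule: less_induct)
    case (less n)
    show ?case
    proof (cases n)
      case (Suc k)
      have "(S * fps_deriv D) $ k = (\<Sum>i=0..k. if i = 0 then of_nat (Suc k) * D $ n else 0)"
        unfolding fps_mult_nth
      proof (rule sum.cong)
        fix i assume "i \<in> {0..k}"
        then show "S $ i * fps_deriv D $ (k - i) = (if i = 0 then of_nat (Suc k) * D $ n else 0)"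
          using less.IH[of "k - i + 1"] Suc S by (cases "i = 0") (simp_all del: of_nat_Suc)
      qed simp
      moreover have "(G * D) $ k = 0"
        unfolding fps_mult_nth by (rule sum.neutral) (use less.IH Suc in auto)
      ultimately have "of_nat (Suc k) * D $ n = 0" using D(2) by simp
      then show ?thesis by (rule tf)
    qed (simp add: D)
  qed
  then have "D = 0" by (simp add: fps_eq_iff)
  then show ?thesis by (simp add: D_def)
qed

lemma fay_exp_0: "fay_exp A $ 0 = 1"
  by (simp add: fay_exp_def mfps_const.one)

lemma fay_exp_deriv:
  fixes A :: "('v, 'k::field_char_0) mfps fps fps"
  assumes "A $ 0 = 0"
  shows "fps_deriv (fay_exp A) = fay_exp A * fps_deriv A"
proof (rule fps_ext)
  fix n
  define C where "C = Abs_fps (\<lambda>n. fps_const (mfps_const (1 / fact n)) :: ('v, 'k::field_char_0) mfps fps)"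
  have C: "of_nat (Suc i) * C $ Suc i = C $ i" for i
  proof -
    have "of_nat (Suc i) * C $ Suc i = fps_const (mfps_const (of_nat (Suc i) * (1 / fact (Suc i))))"
      unfolding C_def fps_nth_Abs_fps mfps_const.mult mfps_const.of_nat fps_const_mult[symmetric] fps_of_nat ..
    also have "of_nat (Suc i) * (1 / fact (Suc i)) = (1 / fact i :: 'k)"
      by (simp del: of_nat_Suc)
    finally show ?thesis by (simp add: C_def)
  qed
  have "fps_deriv (fay_exp A) $ n = of_nat (Suc n) * (C oo A) $ Suc n"
    by (simp add: fay_exp_def C_def)
  also have "\<dots> = (\<Sum>i=0..Suc n. C $ i * (of_nat (Suc n) * A ^ i $ Suc n))"
    unfolding fps_compose_nth sum_distrib_left by (simp only: mult.left_commute)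
  also have "\<dots> = (\<Sum>i=0..Suc n. C $ i * fps_deriv (A ^ i) $ n)" by simp
  also have "\<dots> = (\<Sum>i=0..n. C $ Suc i * fps_deriv (A ^ Suc i) $ n)"
  proof -
    have "fps_deriv (A ^ 0) = 0" by simp
    then show ?thesis
      unfolding sum.atLeast0_atMost_Suc_shift by (simp only: fps_zero_nth mult_zero_right add_0_left o_def)
  qed
  also have "\<dots> = (\<Sum>i=0..n. C $ i * (A ^ i * fps_deriv A) $ n)"
  proof (rule sum.cong)
    fix i
    have "fps_deriv (A ^ Suc i) = of_nat (Suc i) * (A ^ i * fps_deriv A)"
      by (simp only: fps_deriv_power diff_Suc_1 fps_of_nat) (simp only: mult_ac)
    then have "C $ Suc i * fps_deriv (A ^ Suc i) $ n = (of_nat (Suc i) * C $ Suc i) * (A ^ i * fps_deriv A) $ n"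
      by (simp only: of_nat_mult_fps_nth) (simp only: mult_ac)
    then show "C $ Suc i * fps_deriv (A ^ Suc i) $ n = C $ i * (A ^ i * fps_deriv A) $ n" unfolding C .
  qed simp
  also have "\<dots> = ((C oo A) * fps_deriv A) $ n" by (simp only: fps_compose_mult_nth[OF assms])
  finally show "fps_deriv (fay_exp A) $ n = (fay_exp A * fps_deriv A) $ n" by (simp add: fay_exp_def C_def)
qed

lemma fps_torsion_free:
  assumes "\<And>n a. of_nat (Suc n) * a = 0 \<Longrightarrow> a = (0 :: 'a::comm_ring_1)"
  shows "of_nat (Suc n) * A = 0 \<Longrightarrow> A = (0 :: 'a fps)"
proof -
  assume "of_nat (Suc n) * A = 0"
  then have "of_nat (Suc n) * A $ m = 0" for m by (metis of_nat_mult_fps_nth fps_zero_nth)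
  then have "A $ m = 0" for m by (rule assms)
  then show "A = 0" by (simp add: fps_eq_iff)
qed

text \<open>With w_i = 1/z_i this is (p_1 + p_2) / (z_1 + z_2), and \<open>M_fay\<close> is (p_1 -
  p_2) / (z_1 - z_2); the divided difference carries out the division (\<open>S_fay_eq\<close>,
  \<open>M_fay_eq\<close>).\<close>

definition S_fay :: "'a::comm_ring_1 fps \<Rightarrow> 'a fps fps" where
  "S_fay q = in_z1 (stretch q) + X1 * (X2 - X1) * stretch2 (divdiff q)"

definition M_fay :: "'a::comm_ring_1 fps \<Rightarrow> 'a fps fps" where
  "M_fay q = in_z1 (stretch q) - X1 * (X2 + X1) * stretch2 (divdiff q)"

lemma stretch2_divdiff: "(X2 ^ 2 - X1 ^ 2) * stretch2 (divdiff q) = in_z2 (stretch q) - in_z1 (stretch q)"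
  using arg_cong[OF divdiff_eq[of q], of stretch2]
  by (simp add: stretch2.mult stretch2.diff stretch2_X2 stretch2_z1 stretch2_z2 stretch_X in_z1_power)

lemma S_fay_eq: "S_fay q * (X2 + X1) = in_z1 (stretch q) * X2 + in_z2 (stretch q) * X1"
proof -
  have "S_fay q * (X2 + X1) = in_z1 (stretch q) * (X2 + X1) + X1 * ((X2 ^ 2 - X1 ^ 2) * stretch2 (divdiff q))"
    by (simp add: S_fay_def algebra_simps power2_eq_square)
  then show ?thesis unfolding stretch2_divdiff by (simp add: algebra_simps)
qed

lemma M_fay_eq: "M_fay q * (X2 - X1) = in_z1 (stretch q) * X2 - in_z2 (stretch q) * X1"
proof -
  have "M_fay q * (X2 - X1) = in_z1 (stretch q) * (X2 - X1) - X1 * ((X2 ^ 2 - X1 ^ 2) * stretch2 (divdiff q))"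
    by (simp add: M_fay_def algebra_simps power2_eq_square)
  then show ?thesis unfolding stretch2_divdiff by (simp add: algebra_simps)
qed

lemma stretch_q_divdiff: "q $ 0 = 1 \<Longrightarrow> fps_X * (fps_X * stretch (divdiff q $ 0)) = stretch q - 1"
proof -
  assume q: "q $ 0 = 1"
  have "fps_X * divdiff q $ 0 = q - 1"
  proof (rule fps_ext)
    show "(fps_X * divdiff q $ 0) $ n = (q - 1) $ n" for n using q by (cases n) (simp_all add: divdiff_def)
  qed
  from arg_cong[OF this, of stretch] show ?thesis
    by (simp add: stretch.mult stretch.diff stretch.one stretch_X power2_eq_square mult.assoc)
qed

lemma S_fay_0: "q $ 0 = 1 \<Longrightarrow> S_fay q $ 0 = 1"
  using stretch_q_divdiff[of q] by (simp add: S_fay_def mult.assoc left_diff_distrib stretch2_def stretch_nth)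

lemma M_fay_0: "q $ 0 = 1 \<Longrightarrow> M_fay q $ 0 = 1"
  using stretch_q_divdiff[of q] by (simp add: M_fay_def mult.assoc distrib_right stretch2_def stretch_nth)

text \<open>Here \<open>y\<close> and \<open>w\<close> are w_2 and w_1. The third and fourth
  hypotheses are the w_2-derivatives of the first two, so this computes the numerator of the
  derivative of log M - log S without dividing by \<open>d\<close> or \<open>e\<close>.\<close>

lemma wronskian_identity:
  fixes d e S M S' M' w p r r' :: "'a::comm_ring_1"
  assumes "S * e = p * y + r * w" "M * d = p * y - r * w"
    "S' * e + S = p + r' * w" "M' * d + M = p - r' * w" "e = y + w" "d = y - w"
  shows "(d * e) * ((d * e) * (M' * S - S' * M)) =
     2 * w * ((d * e) * (p * (r - y * r')) - (p * y + r * w) * (p * y - r * w))"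
proof -
  have m': "M' * d = p - r' * w - M" and s': "S' * e = p + r' * w - S"
    using assms(3,4) by (metis add_diff_cancel_right')+
  have "(d * e) * ((d * e) * (M' * S - S' * M)) = (d * e) * ((M' * d) * (S * e) - (S' * e) * (M * d))"
    by (simp add: algebra_simps)
  also have "\<dots> = (d * e) * ((p - r' * w) * (S * e) - (p + r' * w) * (M * d)) - (M * d) * e * (S * e) + (S * e) * d * (M * d)"
    unfolding m' s' by (simp add: algebra_simps)
  also have "\<dots> = 2 * w * ((d * e) * (p * (r - y * r')) - (p * y + r * w) * (p * y - r * w))"
    unfolding assms(1,2) unfolding assms(5,6) by (simp add: algebra_simps)
  finally show ?thesis .
qed

lemma mult_rearrange:
  "(d * e) * ((d * e) * (a * b * (2 * x * h))) = 2 * x * ((d * e) * (((a * e) * (b * d)) * (h :: 'a::comm_ring_1)))"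
  by (simp only: mult_ac)

text \<open>After clearing denominators only the equation of \<open>sq_diff_grunsky\<close> remains.
  The derivative here is in the outer variable, whereas \<open>grunsky\<close> comes from one in the
  inner variable; this accounts for the swap of H.\<close>

lemma fay_log_deriv_iff:
  fixes q :: "'a::comm_ring_1 fps" and H :: "'a fps fps"
  assumes tf: "\<And>n a. of_nat (Suc n) * a = 0 \<Longrightarrow> a = (0 :: 'a)" and q: "q $ 0 = 1"
  shows "fps_deriv (M_fay q) * S_fay q - fps_deriv (S_fay q) * M_fay q = S_fay q * M_fay q * (2 * X1 * stretch2 H)
    \<longleftrightarrow> fps_swap H = grunsky q" (is "?L = ?R \<longleftrightarrow> _")
proof -
  define d e :: "'a fps fps" where "d = X2 - X1" and "e = X2 + X1"
  define p r where "p = in_z1 (stretch q)" and "r = in_z2 (stretch q)"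
  have dX: "fps_deriv X1 = (0 :: 'a fps fps)" "fps_deriv d = 1" "fps_deriv e = 1" "fps_deriv p = 0"
    by (simp_all add: d_def e_def p_def in_z1_deriv)
  have de: "d * e = stretch2 (X2 - X1)"
    by (simp add: d_def e_def stretch2.diff stretch2_X1 stretch2_X2 power2_eq_square algebra_simps)
  have S: "S_fay q * e = p * X2 + r * X1" unfolding e_def p_def r_def by (rule S_fay_eq)
  have M: "M_fay q * d = p * X2 - r * X1" unfolding d_def p_def r_def by (rule M_fay_eq)
  have S': "fps_deriv (S_fay q) * e + S_fay q = p + fps_deriv r * X1"
    using arg_cong[OF S, of fps_deriv] by (simp add: dX add.commute mult.commute)
  have M': "fps_deriv (M_fay q) * d + M_fay q = p - fps_deriv r * X1"
    using arg_cong[OF M, of fps_deriv] by (simp add: dX add.commute mult.commute)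
  have K: "(p * X2 + r * X1) * (p * X2 - r * X1) = stretch2 (sq_diff q)"
    by (simp add: sq_diff_def stretch2.diff stretch2.mult stretch2.power stretch2_X2 stretch2_z1 stretch2_z2 stretch_X in_z1_power in_z1_mult
        p_def r_def power2_eq_square algebra_simps)
  have k: "p * (r - X2 * fps_deriv r) = stretch2 (in_z1 q * in_z2 (dp_dz q))"
    by (simp add: stretch2.mult stretch2_z1 stretch2_z2 stretch_dp_dz p_def r_def in_z2_deriv in_z_simps)
  have R: "(d * e) * ((d * e) * ?R) = 2 * X1 * ((d * e) * (stretch2 (sq_diff q) * stretch2 H))"
    unfolding mult_rearrange S M K ..
  have L: "(d * e) * ((d * e) * ?L) = 2 * X1 * ((d * e) * stretch2 (in_z1 q * in_z2 (dp_dz q)) - stretch2 (sq_diff q))"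
    unfolding wronskian_identity[OF S M S' M' e_def d_def] k K ..
  \<comment> \<open>Once the common factor 2 w_1 is removed, only even powers of w_1 and w_2 are
    left, so the equation descends to x and y.\<close>
  define T where "T = (X2 - X1) * (in_z1 q * in_z2 (dp_dz q)) - sq_diff q - (X2 - X1) * (sq_diff q * H)"
  have LR: "(d * e) * ((d * e) * (?L - ?R)) = 2 * X1 * stretch2 T"
  proof -
    have T: "stretch2 T = d * e * stretch2 (in_z1 q * in_z2 (dp_dz q)) - stretch2 (sq_diff q) - d * e * (stretch2 (sq_diff q) * stretch2 H)"
      by (simp only: T_def de stretch2.mult stretch2.diff)
    have "(d * e) * ((d * e) * (?L - ?R)) = (d * e) * ((d * e) * ?L) - (d * e) * ((d * e) * ?R)"
      by (simp only: right_diff_distrib)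
    also have "\<dots> = 2 * X1 * stretch2 T" unfolding L R T by (simp only: right_diff_distrib)
    finally show ?thesis .
  qed
  have T: "T = (X2 - X1) * (in_z1 q * in_z2 (dp_dz q) - sq_quot q - sq_diff q * H)"
    by (simp add: T_def algebra_simps flip: sq_quot_sq_diff)
  have de0: "A = 0" if "(d * e) * A = 0" for A
    using that X2_minus_X1_mult_eq_0[of "e * A"] X2_plus_X1_mult_eq_0[of A] by (simp add: d_def e_def mult.assoc)
  have two: "A = 0" if "2 * X1 * A = 0" for A :: "'a fps fps"
  proof -
    have "X1 * (of_nat (Suc 1) * A) = 0" using that by (simp add: mult_ac)
    then have "of_nat (Suc 1) * A = 0" by (rule X1_mult_eq_0)
    moreover have "of_nat (Suc n) * a = 0 \<Longrightarrow> a = 0" for n and a :: "'a fps"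
      by (rule fps_torsion_free[OF tf])
    ultimately show ?thesis by (rule fps_torsion_free[rotated])
  qed
  have de2: "(d * e) * ((d * e) * A) = 0 \<longleftrightarrow> A = 0" for A
    using de0[of "(d * e) * A"] de0[of A] by auto
  have two': "2 * X1 * A = 0 \<longleftrightarrow> A = 0" for A :: "'a fps fps"
    using two[of A] by auto
  have diff0: "(X2 - X1) * A = 0 \<longleftrightarrow> A = 0" for A :: "'a fps fps"
    using X2_minus_X1_mult_eq_0[of A] by auto
  have swap0: "fps_swap (0 :: 'a fps fps) = 0" by (simp add: fps_eq_iff)
  have swap_iff: "A = 0 \<longleftrightarrow> fps_swap A = 0" for A :: "'a fps fps"
    by (metis fps_swap_swap swap0)
  have "?L = ?R \<longleftrightarrow> (d * e) * ((d * e) * (?L - ?R)) = 0"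
    unfolding de2 by (rule right_minus_eq[symmetric])
  also have "\<dots> \<longleftrightarrow> stretch2 T = 0" unfolding LR by (rule two')
  also have "\<dots> \<longleftrightarrow> T = 0" using stretch2_eq_0[of T] by (auto simp: stretch2.zero)
  also have "\<dots> \<longleftrightarrow> in_z1 q * in_z2 (dp_dz q) - sq_quot q - sq_diff q * H = 0"
    unfolding T by (rule diff0)
  also have "\<dots> \<longleftrightarrow> in_z1 (dp_dz q) * in_z2 q - sq_quot q + sq_diff q * fps_swap H = 0"
    unfolding swap_iff[of "in_z1 q * in_z2 (dp_dz q) - sq_quot q - sq_diff q * H"]
    by (simp add: fps_swap_simps sq_diff_swap sq_quot_swap mult.commute)
  also have "\<dots> \<longleftrightarrow> sq_diff q * fps_swap H = sq_quot q - in_z1 (dp_dz q) * in_z2 q"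
  proof -
    have "a - b + c = 0 \<longleftrightarrow> c = b - a" for a b c :: "'a fps fps"
    proof -
      have "a - b + c = c - (b - a)" by simp
      then show ?thesis by (simp only: right_minus_eq)
    qed
    then show ?thesis .
  qed
  also have "\<dots> \<longleftrightarrow> fps_swap H = grunsky q"
  proof
    assume "sq_diff q * fps_swap H = sq_quot q - in_z1 (dp_dz q) * in_z2 q"
    then show "fps_swap H = grunsky q" by (rule grunsky_unique[OF q])
  next
    assume h: "fps_swap H = grunsky q"
    show "sq_diff q * fps_swap H = sq_quot q - in_z1 (dp_dz q) * in_z2 q" unfolding h by (rule sq_diff_grunsky[OF q])
  qed
  finally show ?thesis .
qed

text \<open>Given the logarithmic derivative, both sides solve the same linear first-order equation
  in w_2, and both equal 1 at w_2 = 0.\<close>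

lemma fay_iff:
  fixes q :: "('v, 'k::field_char_0) mfps fps"
  assumes q: "q $ 0 = 1" and A: "A $ 0 = 0" "fps_deriv A = 2 * X1 * stretch2 H"
  shows "S_fay q * fay_exp A = M_fay q \<longleftrightarrow> fps_swap H = grunsky q"
proof -
  let ?S = "S_fay q" and ?M = "M_fay q"
  have S0: "?S $ 0 = 1" and M0: "?M $ 0 = 1" by (rule S_fay_0[OF q], rule M_fay_0[OF q])
  have "?S * fay_exp A = ?M \<longleftrightarrow> fps_deriv ?M * ?S - fps_deriv ?S * ?M = ?S * ?M * fps_deriv A"
  proof
    assume *: "?S * fay_exp A = ?M"
    have "fps_deriv ?M = fps_deriv ?S * fay_exp A + ?S * (fay_exp A * fps_deriv A)"
      unfolding *[symmetric] by (simp add: fay_exp_deriv[OF A(1)] add.commute)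
    then show "fps_deriv ?M * ?S - fps_deriv ?S * ?M = ?S * ?M * fps_deriv A"
      unfolding *[symmetric] by (simp add: algebra_simps)
  next
    assume *: "fps_deriv ?M * ?S - fps_deriv ?S * ?M = ?S * ?M * fps_deriv A"
    show "?S * fay_exp A = ?M"
    proof (rule fps_ODE_unique[where S = ?S and G = "fps_deriv ?S + ?S * fps_deriv A"])
      show "?S * fps_deriv (?S * fay_exp A) = (fps_deriv ?S + ?S * fps_deriv A) * (?S * fay_exp A)"
        by (simp add: fay_exp_deriv[OF A(1)] algebra_simps)
      show "?S * fps_deriv ?M = (fps_deriv ?S + ?S * fps_deriv A) * ?M"
        using * by (simp add: algebra_simps)
      show "(?S * fay_exp A) $ 0 = ?M $ 0" by (simp add: S0 M0 fay_exp_0)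
      show "of_nat (Suc n) * a = 0 \<Longrightarrow> a = 0" for n and a :: "('v, 'k) mfps fps"
        by (rule fps_torsion_free) (rule mfps_of_nat_mult_eq_0)
    qed (rule S0)
  qed
  also have "\<dots> \<longleftrightarrow> fps_swap H = grunsky q"
    unfolding A(2) by (rule fay_log_deriv_iff[OF mfps_of_nat_mult_eq_0 q])
  finally show ?thesis .
qed

section \<open>The reduced hierarchy and the system\<close>

lemma exact_quot_eq:
  assumes "\<And>x. b * x = 0 \<Longrightarrow> x = 0" and "q * b = a"
  shows "exact_quot a b = q"
  unfolding exact_quot_def
proof (rule the_equality)
  fix q' assume "q' * b = a"
  then have "b * (q' - q) = 0" using assms(2) by (simp add: right_diff_distrib mult.commute)
  then show "q' = q" using assms(1) by fastforce
qed (rule assms(2))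

text \<open>Multiplied by w_1 w_2, the numerator is w_2 (1 - q_1) + w_1 (1 - q_2), and
  \<open>S_fay_eq\<close> shows that w_2 q_1 + w_1 q_2 is divisible by w_2 + w_1.\<close>

lemma over_z1_plus_z2_eq:
  assumes "fps_X * Z = 1 - stretch q"
  shows "1 - over_z1_plus_z2 (in_z1 Z + in_z2 Z) = S_fay q"
proof -
  have "X1 * X2 * (in_z1 Z + in_z2 Z) = X2 * in_z1 (fps_X * Z) + X1 * in_z2 (fps_X * Z)"
    by (simp add: in_z_simps algebra_simps)
  also have "\<dots> = (1 - S_fay q) * (X2 + X1)"
    unfolding assms left_diff_distrib S_fay_eq by (simp add: in_z_simps algebra_simps)
  finally have "over_z1_plus_z2 (in_z1 Z + in_z2 Z) = 1 - S_fay q"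
    unfolding over_z1_plus_z2_def in_z2_X by (intro exact_quot_eq) (auto dest: X2_plus_X1_mult_eq_0)
  then show ?thesis by simp
qed

lemma over_z1_minus_z2_eq:
  assumes "fps_X * Z = 1 - stretch q"
  shows "1 - over_z1_minus_z2 (in_z1 Z - in_z2 Z) = M_fay q"
proof -
  have "X1 * X2 * (in_z1 Z - in_z2 Z) = X2 * in_z1 (fps_X * Z) - X1 * in_z2 (fps_X * Z)"
    by (simp add: in_z_simps algebra_simps)
  also have "\<dots> = (1 - M_fay q) * (X2 - X1)"
    unfolding assms left_diff_distrib M_fay_eq by (simp add: in_z_simps algebra_simps)
  finally have "over_z1_minus_z2 (in_z1 Z - in_z2 Z) = 1 - M_fay q"
    unfolding over_z1_minus_z2_def in_z2_X by (intro exact_quot_eq) (auto dest: X2_minus_X1_mult_eq_0)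
  then show ?thesis by simp
qed

text \<open>In terms of \<open>f = 2F\<^sub>0\<close> these are \<open>\<partial>\<^sub>\<alpha>\<partial>\<^sub>\<beta>f\<close> and \<open>\<partial>\<^sub>0\<partial>\<^sub>\<alpha>f\<close>, still written in the times \<open>T\<close>.\<close>

definition hess :: "(bkp_time, 'k::field_char_0) mfps \<Rightarrow> nat \<Rightarrow> nat \<Rightarrow> (bkp_time, 'k) mfps" where
  "hess F \<alpha> \<beta> = mfps_const (1 / of_nat (2 * (\<alpha> - 1) + 1)) * (mfps_const (1 / of_nat (2 * (\<beta> - 1) + 1)) *
     mfps_deriv (T_odd (\<alpha> - 1)) (mfps_deriv (T_odd (\<beta> - 1)) (2 * F)))"

definition hess_bar :: "(bkp_time, 'k::field_char_0) mfps \<Rightarrow> nat \<Rightarrow> (bkp_time, 'k) mfps" where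
  "hess_bar F \<alpha> = mfps_const (1 / of_nat (2 * (\<alpha> - 1) + 1)) * d_bar (mfps_deriv (T_odd (\<alpha> - 1)) (2 * F))"

definition q_bkp :: "(bkp_time, 'k::field_char_0) mfps \<Rightarrow> (bkp_time, 'k) mfps fps" where
  "q_bkp F = Abs_fps (\<lambda>n. if n = 0 then 1 else - hess F 1 n)"

definition d_T1_DB :: "(bkp_time, 'k::field_char_0) mfps \<Rightarrow> (bkp_time, 'k) mfps fps" where
  "d_T1_DB F = coeffwise d_T1 (DB (2 * F))"

lemma q_bkp_0 [simp]: "q_bkp F $ 0 = 1" by (simp add: q_bkp_def)

lemma DB_nth_odd: "DB F $ (2 * j + 1) = mfps_const (1 / of_nat (2 * j + 1)) * mfps_deriv (T_odd j) F"
  by (simp add: DB_def)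

lemma DB_nth_even: "even j \<Longrightarrow> DB F $ j = 0"
  by (simp add: DB_def)

lemma X_d_T1_DB: "fps_X * d_T1_DB F = 1 - stretch (q_bkp F)"
proof (rule fps_ext)
  fix n
  show "(fps_X * d_T1_DB F) $ n = (1 - stretch (q_bkp F)) $ n"
  proof (cases n)
    case 0
    then show ?thesis by (simp add: stretch_nth)
  next
    case (Suc k)
    show ?thesis
    proof (cases "odd k")
      case True
      then obtain j where j: "k = 2 * j + 1" by (auto elim: oddE)
      have "n = 2 * (j + 1)" by (simp add: Suc j)
      then have "stretch (q_bkp F) $ n = - hess F 1 (j + 1)" unfolding stretch_nth by (simp add: q_bkp_def)
      moreover have "d_T1_DB F $ k = hess F 1 (j + 1)"
        unfolding d_T1_DB_def j coeffwise_nth DB_nth_odd mfps_deriv_const_mult by (simp add: hess_def mfps_const.one)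
      ultimately show ?thesis by (simp add: Suc)
    next
      case False
      then show ?thesis using Suc by (simp add: d_T1_DB_def DB_nth_even stretch_nth)
    qed
  qed
qed

lemma DB_2: "DB (2 * F) = 2 * DB F"
  by (rule fps_ext) (simp add: DB_def numeral_mult_fps_nth mfps_deriv_numeral_mult mult.left_commute)

lemma in_z1_numeral: "in_z1 (numeral w) = numeral w"
  by (simp add: in_z1_def numeral_fps_const)

lemma mfps_deriv_diff: "mfps_deriv v (F - G) = mfps_deriv v F - mfps_deriv v G"
  by (rule additive_diff[of "mfps_deriv v", OF mfps_deriv_add])

lemma d_T1_plus:
  "coeffwise (coeffwise d_T1) (2 * in_z1 (DB F) + 2 * in_z2 (DB F)) = in_z1 (d_T1_DB F) + in_z2 (d_T1_DB F)"
proof -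
  have "2 * in_z1 (DB F) + 2 * in_z2 (DB F) = in_z1 (DB (2 * F)) + in_z2 (DB (2 * F))"
    by (simp add: DB_2 in_z_simps in_z1_numeral in_z2_numeral)
  then show ?thesis by (simp add: fps_eq_iff d_T1_DB_def mfps_deriv_add)
qed

lemma d_T1_minus:
  "coeffwise (coeffwise d_T1) (2 * in_z1 (DB F) - 2 * in_z2 (DB F)) = in_z1 (d_T1_DB F) - in_z2 (d_T1_DB F)"
proof -
  have "2 * in_z1 (DB F) - 2 * in_z2 (DB F) = in_z1 (DB (2 * F)) - in_z2 (DB (2 * F))"
    by (simp add: DB_2 in_z_simps in_z1_numeral in_z2_numeral)
  then show ?thesis by (simp add: fps_eq_iff d_T1_DB_def mfps_deriv_diff)
qed

text \<open>The factor 2n + 1 comes from differentiating w_2^(2n+1) in 2 D_1 D_2 f; see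
  \<open>DB1_DB2_deriv\<close>.\<close>

definition hess_series :: "(bkp_time, 'k::field_char_0) mfps \<Rightarrow> (bkp_time, 'k) mfps fps fps" where
  "hess_series F = Abs_fps (\<lambda>n. Abs_fps (\<lambda>m. of_nat (2 * n + 1) * hess F (m + 1) (n + 1)))"

lemma DB1_DB2_0: "(2 * 2 * DB1_DB2 F) $ 0 = 0"
proof -
  have "DB (DB F $ 0) = 0" by (simp add: DB_nth_even fps_eq_iff) (simp add: DB_def)
  then show ?thesis unfolding mult.assoc numeral_mult_fps_nth by (simp add: DB1_DB2_def)
qed

lemma DB1_DB2_deriv: "fps_deriv (2 * 2 * DB1_DB2 F) = 2 * X1 * stretch2 (hess_series F)"
proof -
  have "fps_deriv (2 * 2 * DB1_DB2 F) $ n $ m = (2 * X1 * stretch2 (hess_series F)) $ n $ m" for n m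
  proof -
    have L: "fps_deriv (2 * 2 * DB1_DB2 F) $ n $ m = of_nat (Suc n) * (2 * (2 * DB (DB F $ Suc n) $ m))"
      by (simp only: fps_deriv_nth mult.assoc of_nat_mult_fps_nth numeral_mult_fps_nth DB1_DB2_def coeffwise_nth Suc_eq_plus1)
    have R: "(2 * X1 * stretch2 (hess_series F)) $ n $ m = 2 * (if m = 0 then 0 else stretch2 (hess_series F) $ n $ (m - 1))"
      by (simp only: mult.assoc numeral_mult_fps_nth X1_mult_nth fps_X_mult_nth)
    show ?thesis
    proof (cases "even n \<and> odd m")
      case True
      then obtain a b where n: "n = 2 * b" and m: "m = 2 * a + 1" by (auto elim!: evenE oddE)
      have "DB (DB F $ Suc n) $ m = mfps_const (1 / of_nat (2 * a + 1)) * (mfps_const (1 / of_nat (2 * b + 1)) *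
          mfps_deriv (T_odd a) (mfps_deriv (T_odd b) F))"
        unfolding m n Suc_eq_plus1 DB_nth_odd mfps_deriv_const_mult ..
      then have "2 * DB (DB F $ Suc n) $ m = hess F (a + 1) (b + 1)"
        by (simp add: hess_def mfps_deriv_numeral_mult mult.left_commute)
      moreover have "stretch2 (hess_series F) $ n $ (m - 1) = of_nat (2 * b + 1) * hess F (a + 1) (b + 1)"
        by (simp add: stretch2_nth n m hess_series_def)
      ultimately show ?thesis unfolding L R by (simp add: n m mult.left_commute)
    next
      case False
      then consider "odd n" | "even n" "even m" by blast
      then have "DB (DB F $ Suc n) $ m = 0"
        by cases (simp_all add: DB_nth_even DB_def)
      moreover have "m \<noteq> 0 \<Longrightarrow> stretch2 (hess_series F) $ n $ (m - 1) = 0"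
        using False by (auto simp: stretch2_nth)
      ultimately show ?thesis unfolding L R by simp
    qed
  qed
  then show ?thesis by (simp add: fps_eq_iff)
qed

lemma hess_commute: "hess F \<alpha> \<beta> = hess F \<beta> \<alpha>"
  unfolding hess_def mfps_deriv_commute[of "T_odd (\<alpha> - 1)" "T_odd (\<beta> - 1)"] by (rule mult.left_commute)

abbreviation hess_eval :: "(bkp_time, 'k::field_char_0) mfps \<Rightarrow> qpoly \<Rightarrow> (bkp_time, 'k) mfps" where
  "hess_eval F \<equiv> peval rat_const (hess F 1)"

lemma q_bkp_univ: "coeffwise (hess_eval F) q_univ = q_bkp F"
proof -
  interpret p: comm_ring_hom "hess_eval F" by (rule rat_const.peval_hom)
  show ?thesis by (auto simp: fps_eq_iff q_univ_def q_bkp_def p.one p.uminus simp del: One_nat_def)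
qed

lemma hess_eval_grunsky: "grunsky (q_bkp F) $ n $ m = of_nat (2 * m + 1) * hess_eval F (hess_poly (m + 1) (n + 1))"
proof -
  interpret p: comm_ring_hom "hess_eval F" by (rule rat_const.peval_hom)
  have "grunsky (q_bkp F) $ n $ m = hess_eval F (grunsky q_univ $ n $ m)"
    unfolding q_bkp_univ[of F, symmetric] p.coeffwise_grunsky[OF q_univ_0, symmetric] coeffwise_nth ..
  also have "grunsky q_univ $ n $ m = of_nat (2 * m + 1) * hess_poly (m + 1) (n + 1)"
    using of_nat_mult_hess_poly[of "m + 1" "n + 1"] by simp
  finally show ?thesis by (simp only: p.mult p.of_nat)
qed

lemma hess_poly_1: "\<alpha> \<ge> 1 \<Longrightarrow> hess_poly \<alpha> 1 = pvar \<alpha>"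
proof -
  assume a: "\<alpha> \<ge> 1"
  then obtain m where m: "\<alpha> = Suc m" by (cases \<alpha>) auto
  have "of_nat (2 * \<alpha> - 1) * hess_poly \<alpha> 1 = grunsky q_univ $ 0 $ m"
    using of_nat_mult_hess_poly[OF a, of 1] by (simp add: m)
  also have "\<dots> = of_nat (2 * \<alpha> - 1) * pvar \<alpha>"
    unfolding grunsky_0[OF q_univ_0] by (simp add: q_univ_def m algebra_simps)
  finally have e: "of_nat (2 * \<alpha> - 1) * hess_poly \<alpha> 1 = of_nat (2 * \<alpha> - 1) * pvar \<alpha>" .
  have "of_nat (2 * \<alpha> - 1) * (hess_poly \<alpha> 1 - pvar \<alpha>) = 0" by (simp only: right_diff_distrib e diff_self)
  then have "of_nat (2 * \<alpha> - 1) = (0 :: qpoly) \<or> hess_poly \<alpha> 1 - pvar \<alpha> = 0" by (rule iffD1[OF mult_eq_0_iff])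
  moreover have "(of_nat (2 * \<alpha> - 1) :: qpoly) \<noteq> 0" unfolding of_nat_eq_0_iff using a by simp
  ultimately show ?thesis by simp
qed

text \<open>The Fay identity gives an equation for every pair of indices from 1 on. Those with an
  index 1 are tautologies by \<open>hess_poly_1\<close>, which leaves exactly the range of the
  system.\<close>

lemma fay_identity_iff:
  fixes F :: "(bkp_time, 'k::field_char_0) mfps"
  shows "(1 - over_z1_plus_z2 (coeffwise (coeffwise d_T1) (2 * in_z1 (DB F) + 2 * in_z2 (DB F)))) *
       fay_exp (2 * 2 * DB1_DB2 F) =
     1 - over_z1_minus_z2 (coeffwise (coeffwise d_T1) (2 * in_z1 (DB F) - 2 * in_z2 (DB F)))
   \<longleftrightarrow> (\<forall>\<alpha>\<ge>2. \<forall>\<beta>\<ge>2. hess F \<alpha> \<beta> = hess_eval F (hess_poly \<alpha> \<beta>))" (is "?fay \<longleftrightarrow> _")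
proof -
  have "?fay \<longleftrightarrow> fps_swap (hess_series F) = grunsky (q_bkp F)"
    unfolding d_T1_plus d_T1_minus over_z1_plus_z2_eq[OF X_d_T1_DB] over_z1_minus_z2_eq[OF X_d_T1_DB]
    by (rule fay_iff[OF q_bkp_0 DB1_DB2_0 DB1_DB2_deriv])
  also have "\<dots> \<longleftrightarrow> (\<forall>n m. of_nat (2 * m + 1) * hess F (n + 1) (m + 1) = of_nat (2 * m + 1) * hess_eval F (hess_poly (m + 1) (n + 1)))"
    unfolding fps_eq_iff fps_swap_nth hess_eval_grunsky by (simp add: hess_series_def)
  also have "\<dots> \<longleftrightarrow> (\<forall>n m. hess F (n + 1) (m + 1) = hess_eval F (hess_poly (n + 1) (m + 1)))"
  proof -
    have "of_nat (2 * m + 1) * a = of_nat (2 * m + 1) * b \<longleftrightarrow> a = b" for m and a b :: "(bkp_time, 'k) mfps"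
    proof
      assume "of_nat (2 * m + 1) * a = of_nat (2 * m + 1) * b"
      then have "of_nat (Suc (2 * m)) * (a - b) = 0" by (simp only: right_diff_distrib Suc_eq_plus1 diff_self)
      then have "a - b = 0" by (rule mfps_of_nat_mult_eq_0)
      then show "a = b" by simp
    qed simp
    moreover have "hess_poly (m + 1) (n + 1) = hess_poly (n + 1) (m + 1)" for m n by (rule hess_poly_commute) auto
    ultimately show ?thesis by simp
  qed
  also have "\<dots> \<longleftrightarrow> (\<forall>\<alpha>\<ge>2. \<forall>\<beta>\<ge>2. hess F \<alpha> \<beta> = hess_eval F (hess_poly \<alpha> \<beta>))"
  proof
    assume *: "\<forall>n m. hess F (n + 1) (m + 1) = hess_eval F (hess_poly (n + 1) (m + 1))"
    show "\<forall>\<alpha>\<ge>2. \<forall>\<beta>\<ge>2. hess F \<alpha> \<beta> = hess_eval F (hess_poly \<alpha> \<beta>)"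
    proof (intro allI impI)
      fix \<alpha> \<beta> :: nat assume "2 \<le> \<alpha>" "2 \<le> \<beta>"
      then show "hess F \<alpha> \<beta> = hess_eval F (hess_poly \<alpha> \<beta>)" using *[rule_format, of "\<alpha> - 1" "\<beta> - 1"] by simp
    qed
  next
    assume *: "\<forall>\<alpha>\<ge>2. \<forall>\<beta>\<ge>2. hess F \<alpha> \<beta> = hess_eval F (hess_poly \<alpha> \<beta>)"
    have 1: "hess F 1 \<alpha> = hess_eval F (hess_poly \<alpha> 1)" if "\<alpha> \<ge> 1" for \<alpha>
      unfolding hess_poly_1[OF that] by simp
    show "\<forall>n m. hess F (n + 1) (m + 1) = hess_eval F (hess_poly (n + 1) (m + 1))"
    proof (intro allI)
      fix n m
      show "hess F (n + 1) (m + 1) = hess_eval F (hess_poly (n + 1) (m + 1))"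
      proof (cases "n = 0 \<or> m = 0")
        case True
        then show ?thesis
          using 1[of "n + 1"] 1[of "m + 1"] hess_poly_commute[of 1 "m + 1"] hess_commute[of F "n + 1" 1] by auto
      qed (use * in auto)
    qed
  qed
  finally show ?thesis .
qed

lemma hess_eval_recip: "recip (q_bkp F) $ n = hess_eval F (recip q_univ $ n)"
proof -
  interpret p: comm_ring_hom "hess_eval F" by (rule rat_const.peval_hom)
  show ?thesis unfolding q_bkp_univ[of F, symmetric] p.coeffwise_recip[OF q_univ_0, symmetric] coeffwise_nth ..
qed

text \<open>A partial sum differs from the limit by a multiple of the N-th power of the variable, so
  each coefficient is eventually constant.\<close>

lemma geometric_sums:
  fixes Z :: "'a::comm_ring_1 fps"
  assumes "fps_X * Z = 1 - s" "s * r = 1"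
  shows "(\<lambda>n. a * fps_X ^ (n + 1) * Z ^ n) sums (a * fps_X * r)"
  unfolding sums_def
proof (rule tendsto_fpsI)
  fix m
  have "(\<Sum>n<N. a * fps_X ^ (n + 1) * Z ^ n) * s = a * fps_X * (1 - (fps_X * Z) ^ N)" for N
  proof (induction N)
    case (Suc N)
    have s: "s = 1 - fps_X * Z" using assms(1) by simp
    show ?case unfolding sum.lessThan_Suc distrib_right Suc.IH unfolding s
      by (simp add: algebra_simps power_mult_distrib)
  qed simp
  then have "(\<Sum>n<N. a * fps_X ^ (n + 1) * Z ^ n) * (s * r) = a * fps_X * (1 - (fps_X * Z) ^ N) * r" for N
    by (simp only: mult.assoc[symmetric])
  then have e: "(\<Sum>n<N. a * fps_X ^ (n + 1) * Z ^ n) = a * fps_X * r - fps_X ^ N * (a * fps_X * Z ^ N * r)" for N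
    unfolding assms(2) by (simp add: algebra_simps power_mult_distrib)
  show "eventually (\<lambda>N. (\<Sum>n<N. a * fps_X ^ (n + 1) * Z ^ n) $ m = (a * fps_X * r) $ m) sequentially"
    unfolding e using eventually_gt_at_top[of m] by eventually_elim (simp add: fps_X_power_mult_nth)
qed

text \<open>The geometric series sums to \<partial>_0\<partial>_1 f / p. Both sides are odd in 1/z,
  so only odd coefficients matter, and the first is a tautology because 1/q starts with 1.\<close>

lemma bar_identity_iff:
  "(\<lambda>n. fps_const (d_bar (d_T1 (2 * F))) * fps_X ^ (n + 1) * coeffwise d_T1 (DB (2 * F)) ^ n)
       sums DB (d_bar (2 * F))
   \<longleftrightarrow> (\<forall>\<alpha>\<ge>2. hess_bar F \<alpha> = hess_bar F 1 * hess_eval F (recip q_univ $ (\<alpha> - 1)))"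
proof -
  let ?B = "fps_const (d_bar (d_T1 (2 * F)))"
  let ?r = "stretch (recip (q_bkp F))"
  have "stretch (q_bkp F) * ?r = 1"
    unfolding stretch.mult[symmetric] recip_mult[OF q_bkp_0] by (rule stretch.one)
  note s = geometric_sums[OF X_d_T1_DB this, of ?B, unfolded d_T1_DB_def]
  have "(\<lambda>n. ?B * fps_X ^ (n + 1) * coeffwise d_T1 (DB (2 * F)) ^ n) sums DB (d_bar (2 * F))
      \<longleftrightarrow> DB (d_bar (2 * F)) = ?B * fps_X * ?r"
  proof
    assume "(\<lambda>n. ?B * fps_X ^ (n + 1) * coeffwise d_T1 (DB (2 * F)) ^ n) sums DB (d_bar (2 * F))"
    then show "DB (d_bar (2 * F)) = ?B * fps_X * ?r" using s by (rule sums_unique2)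
  next
    assume e: "DB (d_bar (2 * F)) = ?B * fps_X * ?r"
    show "(\<lambda>n. ?B * fps_X ^ (n + 1) * coeffwise d_T1 (DB (2 * F)) ^ n) sums DB (d_bar (2 * F))"
      unfolding e by (rule s)
  qed
  also have "\<dots> \<longleftrightarrow> (\<forall>n. DB (d_bar (2 * F)) $ (2 * n + 1) = (?B * fps_X * ?r) $ (2 * n + 1))"
  proof -
    have "(?B * fps_X * ?r) $ m = 0" if "even m" for m
      using that by (cases m) (simp_all add: mult.assoc stretch_nth)
    then have "DB (d_bar (2 * F)) $ m = (?B * fps_X * ?r) $ m" if "even m" for m
      using that by (simp only: DB_nth_even)
    then show ?thesis unfolding fps_eq_iff by (metis oddE)
  qed
  also have "\<dots> \<longleftrightarrow> (\<forall>n. hess_bar F (n + 1) = hess_bar F 1 * hess_eval F (recip q_univ $ n))"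
  proof -
    have "DB (d_bar (2 * F)) $ (2 * n + 1) = hess_bar F (n + 1)" for n
      unfolding DB_nth_odd by (simp add: hess_bar_def mfps_deriv_commute[of "T_odd n" T_bar])
    moreover have "(?B * fps_X * ?r) $ (2 * n + 1) = hess_bar F 1 * hess_eval F (recip q_univ $ n)" for n
    proof -
      have "(?B * fps_X * ?r) $ (2 * n + 1) = d_bar (d_T1 (2 * F)) * recip (q_bkp F) $ n"
        by (simp add: mult.assoc)
      moreover have "hess_bar F 1 = d_bar (d_T1 (2 * F))" by (simp add: hess_bar_def mfps_const.one)
      ultimately show ?thesis by (simp only: hess_eval_recip)
    qed
    ultimately show ?thesis by simp
  qed
  also have "\<dots> \<longleftrightarrow> (\<forall>\<alpha>\<ge>2. hess_bar F \<alpha> = hess_bar F 1 * hess_eval F (recip q_univ $ (\<alpha> - 1)))"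
  proof
    assume *: "\<forall>n. hess_bar F (n + 1) = hess_bar F 1 * hess_eval F (recip q_univ $ n)"
    show "\<forall>\<alpha>\<ge>2. hess_bar F \<alpha> = hess_bar F 1 * hess_eval F (recip q_univ $ (\<alpha> - 1))"
    proof (intro allI impI)
      fix \<alpha> :: nat assume "2 \<le> \<alpha>"
      then show "hess_bar F \<alpha> = hess_bar F 1 * hess_eval F (recip q_univ $ (\<alpha> - 1))" using *[rule_format, of "\<alpha> - 1"] by simp
    qed
  next
    assume *: "\<forall>\<alpha>\<ge>2. hess_bar F \<alpha> = hess_bar F 1 * hess_eval F (recip q_univ $ (\<alpha> - 1))"
    have "recip (q_bkp F) $ 0 = 1" using recip_recurrence[OF q_bkp_0, of F 0] by simp
    then have "hess_eval F (recip q_univ $ 0) = 1" unfolding hess_eval_recip .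
    moreover have "hess_bar F (n + 1) = hess_bar F 1 * hess_eval F (recip q_univ $ n)" if "n \<noteq> 0" for n
      using *[rule_format, of "n + 1"] that by simp
    ultimately show "\<forall>n. hess_bar F (n + 1) = hess_bar F 1 * hess_eval F (recip q_univ $ n)"
      by (metis add_0 mult_1_right)
  qed
  finally show ?thesis .
qed

section \<open>Rescaling and renaming the variables\<close>

context
  fixes \<pi> :: "'v \<Rightarrow> 'w" and c :: "'v \<Rightarrow> 'a::field_char_0"
  assumes bij: "bij \<pi>" and c: "\<And>v. c v \<noteq> 0"
begin

definition cmon :: "('v \<Rightarrow>\<^sub>0 nat) \<Rightarrow> 'a" where
  "cmon m = (\<Prod>v\<in>keys m. c v ^ lookup m v)"

lemma inj_pi: "inj \<pi>" using bij by (rule bij_is_inj)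

lemma cmon_superset: "finite A \<Longrightarrow> keys m \<subseteq> A \<Longrightarrow> cmon m = (\<Prod>v\<in>A. c v ^ lookup m v)"
  unfolding cmon_def by (rule prod.mono_neutral_left) (auto simp: in_keys_iff)

lemma cmon_add: "cmon (m + n) = cmon m * cmon n"
  by (simp add: cmon_superset[of "keys m \<union> keys n"] keys_add_nat lookup_add power_add prod.distrib)

lemma cmon_single: "cmon (single v 1) = c v" by (simp add: cmon_def)

lemma cmon_neq_0: "cmon m \<noteq> 0" unfolding cmon_def using c by simp

lemma lookup_map_key: "lookup (Poly_Mapping.map_key \<pi> m) v = lookup m (\<pi> v)"
  by (simp add: map_key.rep_eq[OF inj_pi])

lemma rescale_coeff:
  "mfps_coeff (mfps_rescale \<pi> c F) m = mfps_coeff F (Poly_Mapping.map_key \<pi> m) * cmon (Poly_Mapping.map_key \<pi> m)"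
  by (simp add: mfps_rescale_def cmon_def lookup_map_key)

lemma map_key_inv: "Poly_Mapping.map_key \<pi> (Poly_Mapping.map_key (inv \<pi>) m) = m"
proof -
  have "inj (inv \<pi>)" using bij by (simp add: bij_imp_bij_inv bij_is_inj)
  then show ?thesis using map_key_compose[OF inj_pi, of "inv \<pi>" m] inj_pi by (simp add: map_key_id flip: id_def) (simp add: id_def map_key_id)
qed

lemma map_key_inv': "Poly_Mapping.map_key (inv \<pi>) (Poly_Mapping.map_key \<pi> m) = m"
proof -
  have i: "inj (inv \<pi>)" using bij by (simp add: bij_imp_bij_inv bij_is_inj)
  have "\<pi> \<circ> inv \<pi> = (\<lambda>x. x)" using bij by (auto simp: fun_eq_iff bij_is_surj surj_f_inv_f)
  then show ?thesis using map_key_compose[OF i inj_pi, of m] by (simp add: map_key_id)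
qed

lemma map_key_add: "Poly_Mapping.map_key \<pi> (m + n) = Poly_Mapping.map_key \<pi> m + Poly_Mapping.map_key \<pi> n"
  by (rule map_key_plus[OF inj_pi])

lemma rescale_hom: "comm_ring_hom (mfps_rescale \<pi> c)"
proof
  show "mfps_rescale \<pi> c (F + G) = mfps_rescale \<pi> c F + mfps_rescale \<pi> c G" for F G
    by (rule mfps_eqI) (simp add: rescale_coeff distrib_right)
  have z: "Poly_Mapping.map_key \<pi> m = 0 \<longleftrightarrow> m = 0" for m :: "'w \<Rightarrow>\<^sub>0 nat"
  proof
    assume "Poly_Mapping.map_key \<pi> m = 0"
    then have "m = Poly_Mapping.map_key (inv \<pi>) 0" using map_key_inv'[of m] by simp
    moreover have "inj (inv \<pi>)" using bij by (simp add: bij_imp_bij_inv bij_is_inj)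
    ultimately show "m = 0" by (simp add: map_key_zero)
  qed (simp add: map_key_zero[OF inj_pi])
  show "mfps_rescale \<pi> c 1 = 1"
    by (rule mfps_eqI) (simp add: rescale_coeff mfps_coeff_1 z cmon_def map_key_zero[OF inj_pi])
  show "mfps_rescale \<pi> c (F * G) = mfps_rescale \<pi> c F * mfps_rescale \<pi> c G" for F G
  proof (rule mfps_eqI)
    fix m :: "'w \<Rightarrow>\<^sub>0 nat"
    let ?k = "Poly_Mapping.map_key \<pi>" and ?l = "Poly_Mapping.map_key (inv \<pi>)"
    have li: "inj (inv \<pi>)" using bij by (simp add: bij_imp_bij_inv bij_is_inj)
    have "mfps_coeff (mfps_rescale \<pi> c (F * G)) m =
        (\<Sum>x | fst x + snd x = ?k m. mfps_coeff F (fst x) * mfps_coeff G (snd x) * cmon (?k m))"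
      by (simp add: rescale_coeff mfps_coeff_mult sum_distrib_right case_prod_unfold)
    also have "\<dots> = (\<Sum>x | fst x + snd x = m. mfps_coeff (mfps_rescale \<pi> c F) (fst x) * mfps_coeff (mfps_rescale \<pi> c G) (snd x))"
    proof (rule sum.reindex_bij_witness[of _ "\<lambda>x. (?k (fst x), ?k (snd x))" "\<lambda>x. (?l (fst x), ?l (snd x))"])
      fix x assume "x \<in> {x. fst x + snd x = ?k m}"
      then have x: "fst x + snd x = ?k m" by simp
      show "(?k (fst (?l (fst x), ?l (snd x))), ?k (snd (?l (fst x), ?l (snd x)))) = x" by (simp add: map_key_inv)
      have "?l (fst x) + ?l (snd x) = ?l (?k m)" unfolding map_key_plus[OF li, symmetric] x ..
      then show "(?l (fst x), ?l (snd x)) \<in> {x. fst x + snd x = m}" by (simp add: map_key_inv')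
      show "mfps_coeff (mfps_rescale \<pi> c F) (fst (?l (fst x), ?l (snd x))) * mfps_coeff (mfps_rescale \<pi> c G) (snd (?l (fst x), ?l (snd x))) =
          mfps_coeff F (fst x) * mfps_coeff G (snd x) * cmon (?k m)"
        unfolding x[symmetric] by (simp add: rescale_coeff map_key_inv cmon_add)
    next
      fix x assume "x \<in> {x. fst x + snd x = m}"
      then show "(?k (fst x), ?k (snd x)) \<in> {x. fst x + snd x = ?k m}" by (auto simp flip: map_key_add)
      show "(?l (fst (?k (fst x), ?k (snd x))), ?l (snd (?k (fst x), ?k (snd x)))) = x" by (simp add: map_key_inv')
    qed
    also have "\<dots> = mfps_coeff (mfps_rescale \<pi> c F * mfps_rescale \<pi> c G) m"
      by (simp add: mfps_coeff_mult case_prod_unfold)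
    finally show "mfps_coeff (mfps_rescale \<pi> c (F * G)) m = mfps_coeff (mfps_rescale \<pi> c F * mfps_rescale \<pi> c G) m" .
  qed
qed

lemma rescale_inj: "mfps_rescale \<pi> c F = mfps_rescale \<pi> c G \<longleftrightarrow> F = G"
proof
  assume e: "mfps_rescale \<pi> c F = mfps_rescale \<pi> c G"
  show "F = G"
  proof (rule mfps_eqI)
    fix m
    have "mfps_coeff (mfps_rescale \<pi> c F) (Poly_Mapping.map_key (inv \<pi>) m) = mfps_coeff (mfps_rescale \<pi> c G) (Poly_Mapping.map_key (inv \<pi>) m)"
      unfolding e ..
    then show "mfps_coeff F m = mfps_coeff G m" using cmon_neq_0 by (simp add: rescale_coeff map_key_inv)
  qed
qed simp

lemma rescale_const_mult: "mfps_rescale \<pi> c (mfps_const b * F) = mfps_const b * mfps_rescale \<pi> c F"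
  by (rule mfps_eqI) (simp add: rescale_coeff)

lemma rescale_const: "mfps_rescale \<pi> c (mfps_const b) = mfps_const b"
  using rescale_const_mult[of b 1] comm_ring_hom.one[OF rescale_hom] by simp

lemma rescale_deriv: "mfps_deriv (\<pi> v) (mfps_rescale \<pi> c F) = mfps_const (c v) * mfps_rescale \<pi> c (mfps_deriv v F)"
proof (rule mfps_eqI)
  fix m :: "'w \<Rightarrow>\<^sub>0 nat"
  have "Poly_Mapping.map_key \<pi> (m + single (\<pi> v) 1) = Poly_Mapping.map_key \<pi> m + single v 1"
    unfolding map_key_add map_key_single[OF inj_pi] ..
  then show "mfps_coeff (mfps_deriv (\<pi> v) (mfps_rescale \<pi> c F)) m = mfps_coeff (mfps_const (c v) * mfps_rescale \<pi> c (mfps_deriv v F)) m"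
    by (simp only: mfps_deriv_coeff rescale_coeff mfps_coeff_const_mult cmon_add cmon_single lookup_map_key) (simp only: mult_ac)
qed

end

lemma (in comm_ring_hom) peval_transport:
  "\<phi> (peval \<psi> P p) = peval (\<lambda>r. \<phi> (\<psi> r)) (\<lambda>k. \<phi> (P k)) p"
  by (simp add: peval_def monom_def hsum mult hprod power)

section \<open>The system rewritten in the times T\<close>

context
  fixes F :: "(bkp_time, 'k::field_char_0) mfps"
begin

abbreviation \<rho> :: "(bkp_time, 'k) mfps \<Rightarrow> (nat, 'k) mfps" where
  "\<rho> \<equiv> mfps_rescale time_index time_scale"

lemma time_scale_neq_0: "time_scale v \<noteq> (0 :: 'k)"
  by (cases v) (simp_all del: of_nat_Suc of_nat_add)

lemmas rho_deriv = rescale_deriv[OF bij_time_index time_scale_neq_0]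

lemma deriv_T_odd: "\<alpha> \<ge> 1 \<Longrightarrow> mfps_deriv \<alpha> (\<rho> G) = mfps_const (1 / of_nat (2 * (\<alpha> - 1) + 1)) * \<rho> (mfps_deriv (T_odd (\<alpha> - 1)) G)"
  using rho_deriv[where v = "T_odd (\<alpha> - 1)" and F = G] by simp

lemma f_of_hess: "\<alpha> \<ge> 1 \<Longrightarrow> \<beta> \<ge> 1 \<Longrightarrow> mfps_deriv \<alpha> (mfps_deriv \<beta> (f_of F)) = \<rho> (hess F \<alpha> \<beta>)"
  unfolding f_of_def hess_def deriv_T_odd mfps_deriv_const_mult rescale_const_mult[OF bij_time_index time_scale_neq_0]
  by (rule mult.left_commute)

lemma f_of_hess_bar: "\<alpha> \<ge> 1 \<Longrightarrow> mfps_deriv 0 (mfps_deriv \<alpha> (f_of F)) = \<rho> (hess_bar F \<alpha>)"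
proof -
  assume "\<alpha> \<ge> 1"
  moreover have "mfps_deriv 0 (\<rho> G) = \<rho> (d_bar G)" for G
    using rho_deriv[where v = T_bar and F = G] by (simp add: mfps_const.one)
  ultimately show ?thesis
    unfolding f_of_def hess_bar_def rescale_const_mult[OF bij_time_index time_scale_neq_0]
    by (simp only: deriv_T_odd mfps_deriv_const_mult)
qed

text \<open>\<open>taylor_homog\<close> evaluates the sum to p at the
  \<partial>_1\<partial>_\<gamma> f, and \<rho>, being a ring homomorphism that fixes constants,
  commutes with evaluation.\<close>

lemma tuple_sum:
  assumes "homog d p" "d > 0" "\<And>ks. ks \<in> index_tuples \<Longrightarrow> r ks = 1 / fact (length ks) * pdiffs_at_0 ks p"
  shows "(\<Sum>\<gamma>s | \<gamma>s \<in> index_tuples \<and> r \<gamma>s \<noteq> 0. mfps_const (of_rat (r \<gamma>s)) *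
     (\<Prod>\<gamma>\<leftarrow>\<gamma>s. mfps_deriv 1 (mfps_deriv \<gamma> (f_of F)))) = \<rho> (hess_eval F p)"
proof -
  interpret r: comm_ring_hom \<rho> by (rule rescale_hom[OF bij_time_index time_scale_neq_0])
  have "\<rho> (hess_eval F p) = peval rat_const (\<lambda>k. \<rho> (hess F 1 k)) p"
  proof -
    have "\<rho> (rat_const r) = rat_const r" for r
      unfolding rat_const_def by (rule rescale_const[OF bij_time_index time_scale_neq_0])
    then show ?thesis unfolding r.peval_transport by simp
  qed
  also have "\<dots> = peval rat_const (\<lambda>\<gamma>. mfps_deriv 1 (mfps_deriv \<gamma> (f_of F))) p"
    by (rule rat_const.peval_cong) (use homog_pvars[OF assms(1)] f_of_hess[of 1] in auto)
  finally show ?thesis using rat_const.taylor_homog[OF assms, of "\<lambda>\<gamma>. mfps_deriv 1 (mfps_deriv \<gamma> (f_of F))"]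
    by (simp add: rat_const_def)
qed

text \<open>Every equation of the system is the \<rho>-image of an equation in the times T, and
  \<rho> is injective. The right side is the conjunction that \<open>fay_identity_iff\<close> and
  \<open>bar_identity_iff\<close> give for the hierarchy.\<close>

lemma DN_system_iff:
  "DN_system (f_of F) \<longleftrightarrow> (\<forall>\<alpha>\<ge>2. \<forall>\<beta>\<ge>2. hess F \<alpha> \<beta> = hess_eval F (hess_poly \<alpha> \<beta>)) \<and>
     (\<forall>\<alpha>\<ge>2. hess_bar F \<alpha> = hess_bar F 1 * hess_eval F (recip q_univ $ (\<alpha> - 1)))"
proof -
  interpret r: comm_ring_hom \<rho> by (rule rescale_hom[OF bij_time_index time_scale_neq_0])
  have 1: "(\<Sum>\<gamma>s | \<gamma>s \<in> index_tuples \<and> RD1 \<alpha> \<beta> \<gamma>s \<noteq> 0. mfps_const (of_rat (RD1 \<alpha> \<beta> \<gamma>s)) *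
     (\<Prod>\<gamma>\<leftarrow>\<gamma>s. mfps_deriv 1 (mfps_deriv \<gamma> (f_of F)))) = \<rho> (hess_eval F (hess_poly \<alpha> \<beta>))" if "\<alpha> \<ge> 2" "\<beta> \<ge> 2" for \<alpha> \<beta>
    by (rule tuple_sum[OF homog_hess_poly]) (use that RD1_eq in auto)
  have 2: "(\<Sum>\<gamma>s | \<gamma>s \<in> index_tuples \<and> RD2 \<alpha> \<gamma>s \<noteq> 0. mfps_const (of_rat (RD2 \<alpha> \<gamma>s)) *
     (\<Prod>\<gamma>\<leftarrow>\<gamma>s. mfps_deriv 1 (mfps_deriv \<gamma> (f_of F)))) = \<rho> (hess_eval F (recip q_univ $ (\<alpha> - 1)))" if "\<alpha> \<ge> 2" for \<alpha>
    by (rule tuple_sum[OF homog_recip[OF homog_fps_q_univ q_univ_0]]) (use that RD2_eq in auto)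
  show ?thesis
    unfolding DN_system_def
    by (simp add: 1 2 f_of_hess f_of_hess_bar rescale_inj[OF bij_time_index time_scale_neq_0] flip: r.mult del: One_nat_def)
qed

end

theorem theorem7p1:
  fixes F0 :: "(bkp_time, 'k::field_char_0) mfps"
  shows
    "(\<forall>\<alpha>\<ge>1. \<forall>\<beta>\<ge>1. \<forall>\<gamma>s\<in>index_tuples.
        (\<forall>N. RD1_admissible N \<alpha> \<beta> \<gamma>s \<longrightarrow> RD1_at N \<alpha> \<beta> \<gamma>s = RD1 \<alpha> \<beta> \<gamma>s) \<and>
        (sum_list \<gamma>s \<noteq> \<alpha> + \<beta> - 1 \<longrightarrow> RD1 \<alpha> \<beta> \<gamma>s = 0)) \<and>
     (\<forall>\<alpha>\<ge>1. \<forall>\<gamma>s\<in>index_tuples.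
        (\<forall>N. RD2_admissible N \<alpha> \<gamma>s \<longrightarrow> RD2_at N \<alpha> \<gamma>s = RD2 \<alpha> \<gamma>s) \<and>
        (sum_list \<gamma>s \<noteq> \<alpha> - 1 \<longrightarrow> RD2 \<alpha> \<gamma>s = 0)) \<and>
     (DN_system (f_of F0) \<longleftrightarrow> reduced_BKP F0)"
proof (intro conjI allI impI ballI)
  fix \<alpha> \<beta> :: nat and \<gamma>s assume a: "1 \<le> \<alpha>" "1 \<le> \<beta>" "\<gamma>s \<in> index_tuples"
  show "RD1_at N \<alpha> \<beta> \<gamma>s = RD1 \<alpha> \<beta> \<gamma>s" if "RD1_admissible N \<alpha> \<beta> \<gamma>s" for N
    using RD1_at_eq[OF a that] RD1_eq[OF a] by simp
  show "RD1 \<alpha> \<beta> \<gamma>s = 0" if "sum_list \<gamma>s \<noteq> \<alpha> + \<beta> - 1"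
    using RD1_eq[OF a] homog_pdiffs[OF homog_hess_poly[OF a(1,2)], of \<gamma>s] that by auto
next
  fix \<alpha> :: nat and \<gamma>s assume a: "1 \<le> \<alpha>" "\<gamma>s \<in> index_tuples"
  show "RD2_at N \<alpha> \<gamma>s = RD2 \<alpha> \<gamma>s" if "RD2_admissible N \<alpha> \<gamma>s" for N
    using RD2_at_eq[OF a that] RD2_eq[OF a] by simp
  show "RD2 \<alpha> \<gamma>s = 0" if "sum_list \<gamma>s \<noteq> \<alpha> - 1"
  proof -
    have "homog (\<alpha> - 1) (recip q_univ $ (\<alpha> - 1))" by (rule homog_recip[OF homog_fps_q_univ q_univ_0])
    then show ?thesis using RD2_eq[OF a] homog_pdiffs[of "\<alpha> - 1" _ \<gamma>s] that by auto
  qed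
next
  show "DN_system (f_of F0) \<longleftrightarrow> reduced_BKP F0"
    unfolding DN_system_iff reduced_BKP_def fay_identity_iff bar_identity_iff ..
qed

end
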